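(* Let $\mu$ be a probability measure on $\mathbb R$ whose support is contained in $[-2,2]$, let $F$ be its reciprocal Cauchy transform, and let $\beta_{nk}$, $n,k\ge1$, be the Grunsky coefficients of the function $g=F\circ\psi$, where $\psi(z)=z+1/z$, $|z|>1$. Put $c_{nk}=\sqrt{k/n}\,\beta_{nk}$. Then $F$ is univalent in $\mathbb H$ if and only if for each integer $N\ge1$ the real symmetric matrix $[c_{nk}]_{n,k=1}^N$ has all its eigenvalues in $[-1,1]$.
   Context: $\mathbb H=\{z\in\mathbb C:\Im(z)>0\}$. The Cauchy transform of $\mu$ is $G(z)=\int_{\mathbb R}\frac{\mu(dx)}{z-x}$ and the reciprocal Cauchy transform is $F=1/G$; for $\mu$ supported in $[-2,2]$ both are analytic on $\mathbb C\setminus[-2,2]$. The map $\psi(z)=z+1/z$ maps $\{z\in\mathbb C:|z|>1\}$ bijectively and analytically onto $\mathbb C\setminus[-2,2]$, so $g=F\circ\psi$ is analytic on $\{|z|>1\}$, with an expansion $g(z)=z+b_0+b_1z^{-1}+b_2z^{-2}+\cdots$, $|z|>1$, with real coefficients. Univalent means analytic and injective. Grunsky coefficients: for an analytic function $g$ on $\{|z|>1\}$ with expansion $g(z)=z+b_0+b_1z^{-1}+\cdots$, the Faber polynomials $F_n(w)=w^n+\sum_{k=1}^n a_{nk}w^{n-k}$ of $g$ are defined by \[ \frac{\zeta g'(\zeta)}{g(\zeta)-w}=\sum_{n=0}^\infty F_n(w)\zeta^{-n} \] for $\zeta$ in a neighborhood of $\infty$. The Grunsky coefficients $\beta_{nk}$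 are defined by $F_n(g(z))=z^n+\sum_{k=1}^\infty\beta_{nk}z^{-k}$, $n=1,2,\dots$ *)

theory Defs
  imports
    "HOL-Probability.Distribution_Functions"
    "HOL-Complex_Analysis.Complex_Analysis"
    "Jordan_Normal_Form.Char_Poly"
begin

text \<open>The topological support of a Borel measure on the real line.\<close>

definition measure_support :: "real measure \<Rightarrow> real set" where
  "measure_support \<mu> = {x. \<forall>U. open U \<and> x \<in> U \<longrightarrow> emeasure \<mu> U > 0}"

definition cauchy_transform :: "real measure \<Rightarrow> complex \<Rightarrow> complex" where
  "cauchy_transform \<mu> z = (LINT x|\<mu>. 1 / (z - complex_of_real x))"

definition recip_cauchy_transform :: "real measure \<Rightarrow> complex \<Rightarrow> complex" where
  "recip_cauchy_transform \<mu> z = 1 / cauchy_transform \<mu> z"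

definition upper_half_plane :: "complex set" where
  "upper_half_plane = {z. Im z > 0}"

definition joukowski :: "complex \<Rightarrow> complex" where
  "joukowski z = z + 1 / z"

definition univalent_on :: "(complex \<Rightarrow> complex) \<Rightarrow> complex set \<Rightarrow> bool" where
  "univalent_on f S \<longleftrightarrow> f analytic_on S \<and> inj_on f S"

text \<open>
  The next two descriptions determine their objects uniquely when \<open>g\<close> is analytic on
  \<open>|z| > 1\<close> with an expansion \<open>g z = z + b\<^sub>0 + b\<^sub>1 / z + \<dots>\<close> there, and are only meant for such \<open>g\<close>;
  elsewhere the value of the definite description is irrelevant.  The neighbourhood of infinity in
  which the generating series of the Faber polynomials converges may depend on the point \<open>w\<close>.
\<close>

definition faber_poly :: "(complex \<Rightarrow> complex) \<Rightarrow> nat \<Rightarrow> complex poly" where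
  "faber_poly g = (THE P.
     (\<forall>n. degree (P n) = n \<and> lead_coeff (P n) = 1) \<and>
     (\<forall>w. eventually (\<lambda>\<zeta>. (\<lambda>n. poly (P n) w / \<zeta> ^ n) sums (\<zeta> * deriv g \<zeta> / (g \<zeta> - w)))
            at_infinity))"

text \<open>
  The condition \<open>\<beta> 0 = 0\<close> expresses that the series starts with the index 1.
\<close>

definition grunsky_coeff :: "(complex \<Rightarrow> complex) \<Rightarrow> nat \<Rightarrow> nat \<Rightarrow> complex" where
  "grunsky_coeff g n = (THE \<beta>. \<beta> 0 = 0 \<and>
     (\<forall>z. norm z > 1 \<longrightarrow>
        (\<lambda>k. \<beta> k / z ^ k) sums (poly (faber_poly g n) (g z) - z ^ n)))"

definition scaled_grunsky_coeff :: "(complex \<Rightarrow> complex) \<Rightarrow> nat \<Rightarrow> nat \<Rightarrow> complex" where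
  "scaled_grunsky_coeff g n k = complex_of_real (sqrt (real k / real n)) * grunsky_coeff g n k"

text \<open>Matrices are indexed from 0, the Grunsky coefficients from 1.\<close>

definition grunsky_mat :: "(complex \<Rightarrow> complex) \<Rightarrow> nat \<Rightarrow> complex Matrix.mat" where
  "grunsky_mat g N = Matrix.mat N N (\<lambda>(i, j). scaled_grunsky_coeff g (Suc i) (Suc j))"

end

theory Submission
  imports Defs "Jordan_Normal_Form.Spectral_Radius" "HOL-Real_Asymp.Real_Asymp"
begin

text \<open>
  The map \<open>F\<close> preserves the two half-planes and is injective on the real axis outside \<open>[-2, 2]\<close>,
  so it is univalent in the upper half-plane if and only if \<open>g\<close> is injective.
  Write \<open>g z = z * k (1 / z)\<close>, \<open>t = 1 / \<zeta>\<close>, \<open>s = 1 / z\<close>, and let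
  \<open>Q t s = (g \<zeta> - g z) / (\<zeta> - z)\<close>, which is a symmetric power series in \<open>t\<close>, \<open>s\<close>. Its logarithmic
  derivative \<open>- t * \<partial>\<^sub>t log Q\<close> has the coefficients \<open>\<beta>\<^sub>n\<^sub>k\<close>, which gives
  \<open>k * \<beta>\<^sub>n\<^sub>k = n * \<beta>\<^sub>k\<^sub>n\<close>.

  If the eigenvalues lie in \<open>[-1, 1]\<close>, then \<open>|c\<^sub>n\<^sub>k| \<le> 1\<close>, so the series of \<open>log Q\<close> converges on the whole
  bidisc. Hence \<open>Q\<close> has no zeros there, and \<open>g\<close> is injective.

  If \<open>g\<close> is injective, let \<open>P = \<Sum>n\<le>N. (x\<^sub>n / sqrt n) F\<^sub>n\<close>. The winding numbers of the curve \<open>P (g z)\<close>,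
  \<open>|z| = r > 1\<close>, are non-negative, since those of \<open>g\<close> are 0 or 1 and \<open>P - w\<close> splits into linear factors.
  The area enclosed by this curve is the integral of its winding number, hence non-negative; by Parseval it
  equals a positive multiple of \<open>\<Sum> |x\<^sub>n|\<^sup>2 r ^ (2 n) - \<Sum> |(C x)\<^sub>k|\<^sup>2 r ^ (- 2 k)\<close>. As \<open>r\<close> tends to 1 this
  yields \<open>norm (C x) \<le> norm x\<close> for the Grunsky matrices \<open>C\<close>.
\<close>

unbundle no vec_syntax
no_notation Matrix.vec_index (infixl "$" 100)

section \<open>Formal power series in two variables\<close>

text \<open>The weights sqrt (k / n) serve both ends: they turn
  \<open>k * \<beta>\<^sub>n\<^sub>k = n * \<beta>\<^sub>k\<^sub>n\<close> into symmetry, and with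
  coefficients \<open>x\<^sub>n / sqrt n\<close> they turn the area weights n into a Euclidean norm.
  The identities between Faber polynomials, Q and its logarithmic derivative are formal in t with s
  fixed in the disc, because the Faber series converges only for small t, on a range that depends on
  the point w, while s has to reach the whole disc. The curve P (g z) may cross itself and wind
  several times around a point, so its area is not the measure of a set. It is obtained by writing 2
  pi times the winding number as a Cauchy integral, integrating it over a rectangle and exchanging
  the integrals. The singularity of the Cauchy kernel is integrable in the plane but not along the
  curve, hence the absolute bound for the kernel. The rectangle grows in one direction only, so that
  the integral along it tends to a sign, whose integral across it is again elementary.\<close>

definition fps_eulerop :: "'a::comm_ring_1 fps \<Rightarrow> 'a fps" where
  "fps_eulerop f = fps_X * fps_deriv f"

definition fps_eulerop2 :: "'a::comm_ring_1 fps fps \<Rightarrow> 'a fps fps" where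
  "fps_eulerop2 f = Abs_fps (\<lambda>n. fps_eulerop (f $ n))"

definition fps_swap :: "'a::comm_ring_1 fps fps \<Rightarrow> 'a fps fps" where
  "fps_swap f = Abs_fps (\<lambda>n. Abs_fps (\<lambda>k. f $ k $ n))"

lemma fps_eulerop_nth [simp]: "fps_eulerop f $ n = of_nat n * f $ n"
  by (cases n) (simp_all add: fps_eulerop_def)

lemma fps_eulerop2_nth [simp]: "fps_eulerop2 f $ n = fps_eulerop (f $ n)"
  by (simp add: fps_eulerop2_def)

lemma fps_swap_nth [simp]: "fps_swap f $ n $ k = f $ k $ n"
  by (simp add: fps_swap_def)

lemma fps_eulerop_mult: "fps_eulerop (f * g) = fps_eulerop f * g + f * fps_eulerop g"
  by (simp add: fps_eulerop_def algebra_simps)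

lemma fps_eulerop_sum: "fps_eulerop (\<Sum>i\<in>A. f i) = (\<Sum>i\<in>A. fps_eulerop (f i))"
  by (simp add: fps_eulerop_def sum_distrib_left fps_deriv_sum)

lemma fps_eulerop_minus [simp]: "fps_eulerop (- f) = - fps_eulerop f"
  by (simp add: fps_eulerop_def)

lemma fps_eulerop2_minus [simp]: "fps_eulerop2 (- f) = - fps_eulerop2 f"
  by (simp add: fps_eq_iff)

lemma fps_eulerop2_mult: "fps_eulerop2 (f * g) = fps_eulerop2 f * g + f * fps_eulerop2 g"
  by (rule fps_ext)
    (simp add: fps_mult_nth fps_eulerop_sum fps_eulerop_mult sum.distrib)

lemma fps_of_nat_mult_nth: "(of_nat n * (f :: 'a::comm_ring_1 fps)) $ k = of_nat n * f $ k"
  by (metis fps_mult_left_const_nth fps_of_nat)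

lemma fps_eulerop_commute: "fps_eulerop (fps_eulerop2 f) = fps_eulerop2 (fps_eulerop f)"
  by (intro fps_ext) (simp add: fps_of_nat_mult_nth)

lemma fps_swap_mult: "fps_swap (f * g) = fps_swap f * fps_swap g"
proof (intro fps_ext)
  fix n k
  have "fps_swap (f * g) $ n $ k = (\<Sum>i=0..k. \<Sum>j=0..n. f $ i $ j * g $ (k - i) $ (n - j))"
    by (simp add: fps_mult_nth fps_sum_nth)
  also have "\<dots> = (\<Sum>j=0..n. \<Sum>i=0..k. f $ i $ j * g $ (k - i) $ (n - j))"
    by (rule sum.swap)
  also have "\<dots> = (fps_swap f * fps_swap g) $ n $ k"
    by (simp add: fps_mult_nth fps_sum_nth)
  finally show "fps_swap (f * g) $ n $ k = (fps_swap f * fps_swap g) $ n $ k" .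
qed

lemma fps_swap_minus [simp]: "fps_swap (- f) = - fps_swap f"
  by (intro fps_ext) simp

lemma fps_swap_eulerop: "fps_swap (fps_eulerop f) = fps_eulerop2 (fps_swap f)"
  by (intro fps_ext) (simp add: fps_of_nat_mult_nth)

text \<open>\<open>- B\<close> and \<open>- C\<close> are the logarithmic Euler derivatives of
  \<open>Q\<close> in the outer and the inner variable; \<open>C\<close> is the swap of
  \<open>B\<close> because \<open>Q\<close> is symmetric. The mixed derivatives of log Q agree, so
  \<open>fps_eulerop2 B = fps_eulerop C\<close>. Multiplying by \<open>Q * Q\<close> shows this
  without a logarithm or a quotient.\<close>

lemma log_derivative_symmetric:
  fixes B Q :: "'a::idom fps fps"
  assumes BQ: "B * Q = - fps_eulerop Q" and sym: "fps_swap Q = Q" and nz: "Q \<noteq> 0"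
  shows "of_nat k * B $ n $ k = of_nat n * B $ k $ n"
proof -
  define C where "C = fps_swap B"
  have CQ: "C * Q = - fps_eulerop2 Q"
    unfolding C_def using arg_cong[OF BQ, of fps_swap] sym
    by (simp add: fps_swap_mult fps_swap_eulerop)
  have e1: "fps_eulerop2 B * Q + B * fps_eulerop2 Q = - fps_eulerop2 (fps_eulerop Q)"
    using arg_cong[OF BQ, of fps_eulerop2] by (simp add: fps_eulerop2_mult)
  have e2: "fps_eulerop C * Q + C * fps_eulerop Q = - fps_eulerop2 (fps_eulerop Q)"
    using arg_cong[OF CQ, of fps_eulerop]
    by (simp add: fps_eulerop_mult fps_eulerop_commute)
  have "(fps_eulerop2 B - fps_eulerop C) * (Q * Q) =
      (fps_eulerop2 B * Q + B * fps_eulerop2 Q) * Q - (fps_eulerop C * Q + C * fps_eulerop Q) * Q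
      - (B * Q) * fps_eulerop2 Q + (C * Q) * fps_eulerop Q"
    by (simp add: algebra_simps)
  also have "\<dots> = 0" unfolding e1 e2 BQ CQ by (simp add: algebra_simps)
  finally have "fps_eulerop2 B = fps_eulerop C" using nz by simp
  then have "fps_eulerop2 B $ n $ k = fps_eulerop C $ n $ k" by simp
  then show ?thesis by (simp add: C_def fps_of_nat_mult_nth)
qed

section \<open>Formal Faber polynomials and Grunsky coefficients\<close>

text \<open>\<open>K\<close> is the expansion of \<open>g z / z\<close> in powers of \<open>1 / z\<close>. The outer variable of the iterated
  series is \<open>t = 1 / \<zeta>\<close>, the inner one \<open>s = 1 / z\<close>; in these variables \<open>grunsky_Q K\<close> is
  \<open>(g \<zeta> - g z) / (\<zeta> - z) = (s * k t - t * k s) / (s - t)\<close>, and \<open>grunsky_B K\<close> is its logarithmic derivative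
  \<open>- t * \<partial>\<^sub>t log Q\<close>.\<close>

definition grunsky_Q :: "complex fps \<Rightarrow> complex fps fps" where
  "grunsky_Q K = Abs_fps (\<lambda>i. Abs_fps (\<lambda>m.
     if i = 0 then (if m = 0 then 1 else 0) else if m = 0 then 0 else - K $ (i + m)))"

definition grunsky_B :: "complex fps \<Rightarrow> complex fps fps" where
  "grunsky_B K = - fps_eulerop (grunsky_Q K) * fps_left_inverse (grunsky_Q K) 1"

text \<open>The coefficient \<open>K $ j\<close> enters through (s t^j - t s^j) / (s - t). This is 1
  for j = 0, 0 for j = 1, and for larger j minus the sum of all t^i s^m with i + m = j and i, m
  positive.\<close>

lemma grunsky_Q_nth: "grunsky_Q K $ i $ m =
    (if i = 0 then (if m = 0 then 1 else 0) else if m = 0 then 0 else - K $ (i + m))"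
  by (simp add: grunsky_Q_def)

lemma grunsky_Q_0 [simp]: "grunsky_Q K $ 0 = 1"
  by (intro fps_ext) (simp add: grunsky_Q_nth)

lemma grunsky_Q_neq_0: "grunsky_Q K \<noteq> 0"
  using grunsky_Q_0[of K] by (metis fps_zero_nth zero_neq_one)

lemma grunsky_Q_swap: "fps_swap (grunsky_Q K) = grunsky_Q K"
  by (intro fps_ext) (simp add: grunsky_Q_nth add.commute)

lemma grunsky_B_mult: "grunsky_B K * grunsky_Q K = - fps_eulerop (grunsky_Q K)"
proof -
  have "fps_left_inverse (grunsky_Q K) 1 * grunsky_Q K = 1"
    by (rule fps_left_inverse) simp
  then show ?thesis by (simp add: grunsky_B_def mult.assoc)
qed

lemma grunsky_B_symmetric: "of_nat k * grunsky_B K $ n $ k = of_nat n * grunsky_B K $ k $ n"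
  by (rule log_derivative_symmetric[OF grunsky_B_mult grunsky_Q_swap grunsky_Q_neq_0])

text \<open>Row 0 of Q is 1, so the coefficient of t^n in \<open>grunsky_B_mult\<close> can be
  solved for row n of B. Vanishing at s = 0, reality and convergence of the rows are inductions
  along this recursion.\<close>

lemma grunsky_B_rec: "grunsky_B K $ n =
    - of_nat n * grunsky_Q K $ n - (\<Sum>i<n. grunsky_B K $ i * grunsky_Q K $ (n - i))"
proof -
  have "(\<Sum>i=0..n. grunsky_B K $ i * grunsky_Q K $ (n - i)) = - of_nat n * grunsky_Q K $ n"
    using arg_cong[OF grunsky_B_mult, of "\<lambda>f. f $ n" K] by (simp add: fps_mult_nth)
  moreover have "(\<Sum>i=0..n. grunsky_B K $ i * grunsky_Q K $ (n - i)) =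
      (\<Sum>i<n. grunsky_B K $ i * grunsky_Q K $ (n - i)) + grunsky_B K $ n"
    by (simp add: atLeast0AtMost lessThan_Suc_atMost[symmetric])
  ultimately show ?thesis by (simp add: algebra_simps)
qed

lemma grunsky_B_0 [simp]: "grunsky_B K $ 0 = 0"
  by (subst grunsky_B_rec) simp

lemma grunsky_B_nth_0 [simp]: "grunsky_B K $ n $ 0 = 0"
proof (induction n rule: less_induct)
  case (less n)
  show ?case
    by (subst grunsky_B_rec, cases "n = 0")
      (simp_all add: fps_sum_nth less fps_of_nat_mult_nth grunsky_Q_nth)
qed

lemma grunsky_B_real:
  assumes "\<And>i. K $ i \<in> \<real>"
  shows "grunsky_B K $ n $ k \<in> \<real>"
proof (induction n arbitrary: k rule: less_induct)
  case (less n)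
  have "grunsky_Q K $ i $ m \<in> \<real>" for i m
    using assms by (simp add: grunsky_Q_nth)
  then have "(of_nat n * grunsky_Q K $ n + (\<Sum>i<n. grunsky_B K $ i * grunsky_Q K $ (n - i))) $ k \<in> \<real>"
    unfolding fps_add_nth fps_sum_nth fps_mult_nth fps_of_nat_mult_nth using less
    by (intro Reals_add sum_in_Reals Reals_mult Reals_of_nat) auto
  moreover have "grunsky_B K $ n = - (of_nat n * grunsky_Q K $ n + (\<Sum>i<n. grunsky_B K $ i * grunsky_Q K $ (n - i)))"
    by (subst grunsky_B_rec) simp
  ultimately show ?case by (simp only: fps_neg_nth Reals_minus_iff)
qed

section \<open>Convergence of the rows of Q and B in s\<close>

lemma fps_conv_radius_sum_ge:
  assumes "\<And>i. i \<in> A \<Longrightarrow> fps_conv_radius (f i) \<ge> R"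
  shows "fps_conv_radius (\<Sum>i\<in>A. f i :: complex fps) \<ge> R"
  using assms
proof (induction A rule: infinite_finite_induct)
  case (insert x A)
  have "R \<le> min (fps_conv_radius (f x)) (fps_conv_radius (sum f A))"
    using insert by auto
  also have "\<dots> \<le> fps_conv_radius (f x + sum f A)" by (rule fps_conv_radius_add)
  finally show ?case using insert by simp
qed auto

lemma grunsky_Q_radius:
  assumes "fps_conv_radius K \<ge> 1"
  shows "fps_conv_radius (grunsky_Q K $ i) \<ge> 1"
proof (cases "i = 0")
  case False
  \<comment> \<open>The shifted series has \<open>K $ i\<close> at index 0, where the row of Q is 0;
    the constant cancels it.\<close>
  then have "grunsky_Q K $ i = fps_const (K $ i) - fps_shift i K"
    by (intro fps_ext) (auto simp: grunsky_Q_nth add.commute)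
  moreover have "fps_conv_radius (fps_const (K $ i) - fps_shift i K) \<ge>
      min (fps_conv_radius (fps_const (K $ i))) (fps_conv_radius (fps_shift i K))"
    by (rule fps_conv_radius_diff)
  ultimately show ?thesis using assms by simp
qed simp

text \<open>Each row is a polynomial expression in finitely many rows of Q. This is convergence in s
  alone; convergence in t on the whole disc comes later, from a bound on the coefficients.\<close>

lemma grunsky_B_radius:
  assumes "fps_conv_radius K \<ge> 1"
  shows "fps_conv_radius (grunsky_B K $ n) \<ge> 1"
proof (induction n rule: less_induct)
  case (less n)
  have m: "fps_conv_radius (f * h) \<ge> 1" if "fps_conv_radius f \<ge> 1" "fps_conv_radius h \<ge> 1" for f h :: "complex fps"
    by (rule order_trans[OF min.boundedI[OF that] fps_conv_radius_mult])
  have 1: "fps_conv_radius (- of_nat n * grunsky_Q K $ n) \<ge> 1"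
    by (intro m grunsky_Q_radius assms) (simp add: fps_of_nat[symmetric])
  have 2: "fps_conv_radius (\<Sum>i<n. grunsky_B K $ i * grunsky_Q K $ (n - i)) \<ge> 1"
    by (intro fps_conv_radius_sum_ge m less grunsky_Q_radius assms) auto
  show ?case
    by (subst grunsky_B_rec) (rule order_trans[OF min.boundedI[OF 1 2] fps_conv_radius_diff])
qed

text \<open>The recursion obtained by comparing coefficients in
  \<open>(\<Sum>n. F\<^sub>n w * t ^ n) * (k t - w * t) = k t - t * k' t\<close>.\<close>

fun faber_rec :: "complex fps \<Rightarrow> nat \<Rightarrow> complex poly" where
  "faber_rec K 0 = 1"
| "faber_rec K (Suc n) = [:- of_nat n * K $ Suc n:] + [:0, 1:] * faber_rec K n -
     (\<Sum>j\<leftarrow>[0..<Suc n]. Polynomial.smult (K $ (Suc n - j)) (faber_rec K j))"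

declare faber_rec.simps(2) [simp del]

lemma faber_rec_Suc: "faber_rec K (Suc n) = [:- of_nat n * K $ Suc n:] + [:0, 1:] * faber_rec K n -
     (\<Sum>j\<le>n. Polynomial.smult (K $ (Suc n - j)) (faber_rec K j))"
  by (simp only: faber_rec.simps(2) interv_sum_list_conv_sum_set_nat set_upt atLeast0LessThan lessThan_Suc_atMost)

lemma faber_rec_monic: "degree (faber_rec K n) = n \<and> lead_coeff (faber_rec K n) = 1"
proof (induction n rule: less_induct)
  case (less n)
  show ?case
  proof (cases n)
    case (Suc m)
    \<comment> \<open>\<open>A\<close> carries the leading term; the remainder \<open>R\<close> has
      degree at most \<open>m\<close>.\<close>
    define A where "A = [:0, 1:] * faber_rec K m"
    define S where "S = (\<Sum>j\<le>m. Polynomial.smult (K $ (Suc m - j)) (faber_rec K j))"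
    define R where "R = [:- of_nat m * K $ Suc m:] - S"
    have eq: "faber_rec K n = A + R" unfolding Suc faber_rec_Suc A_def R_def S_def by (simp only: algebra_simps)
    have ih: "degree (faber_rec K m) = m" "lead_coeff (faber_rec K m) = 1"
      using less[of m] Suc by auto
    then have nz: "faber_rec K m \<noteq> 0" by auto
    have dA: "degree A = Suc m" using nz ih by (simp add: A_def degree_mult_eq)
    have lA: "lead_coeff A = 1" using ih(2) by (simp only: A_def lead_coeff_mult) simp
    have "degree S \<le> m"
      unfolding S_def
    proof (rule degree_sum_le)
      fix j assume "j \<in> {..m}"
      then have "degree (faber_rec K j) \<le> m"
        using less[of j] Suc by simp
      then show "degree (Polynomial.smult (K $ (Suc m - j)) (faber_rec K j)) \<le> m"
        by (rule order_trans[OF degree_smult_le])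
    qed simp
    then have "degree R \<le> m" unfolding R_def by (intro degree_diff_le) simp_all
    then have lt: "degree R < degree A" using dA by simp
    have "degree (A + R) = degree A" using lt by (rule degree_add_eq_left)
    moreover from this have "lead_coeff (A + R) = lead_coeff A"
      using lt by (simp add: coeff_eq_0)
    ultimately show ?thesis unfolding eq using dA lA Suc by simp
  qed simp
qed

text \<open>In t = 1 / \<zeta> the second factor is (g \<zeta> - w) / \<zeta> and the right-hand
  side is the derivative of g at \<zeta>, so this is the generating function of the Faber
  polynomials with its denominator cleared.\<close>

lemma faber_rec_fps: "Abs_fps (\<lambda>n. poly (faber_rec K n) w) * (K - fps_const w * fps_X) = K - fps_eulerop K"
  if K0: "K $ 0 = 1"
proof (rule fps_ext)
  fix n
  show "(Abs_fps (\<lambda>n. poly (faber_rec K n) w) * (K - fps_const w * fps_X)) $ n = (K - fps_eulerop K) $ n"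
  proof (cases n)
    case 0
    then show ?thesis using K0 by (simp add: fps_mult_nth)
  next
    case (Suc m)
    have a: "(Abs_fps (\<lambda>n. poly (faber_rec K n) w) * K) $ Suc m =
       (\<Sum>j\<le>m. K $ (Suc m - j) * poly (faber_rec K j) w) + poly (faber_rec K (Suc m)) w"
      using K0 by (simp add: fps_mult_nth atLeast0AtMost mult.commute[of _ "K $ _"])
    have b: "(Abs_fps (\<lambda>n. poly (faber_rec K n) w) * (fps_const w * fps_X)) $ Suc m = w * poly (faber_rec K m) w"
      by (simp add: mult.assoc[symmetric] mult.commute[of _ "fps_const w"])
    have c: "poly (faber_rec K (Suc m)) w = - of_nat m * K $ Suc m + w * poly (faber_rec K m) w
       - (\<Sum>j\<le>m. K $ (Suc m - j) * poly (faber_rec K j) w)"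
      unfolding faber_rec_Suc by (simp add: poly_sum)
    show ?thesis unfolding Suc right_diff_distrib fps_sub_nth a b c by (simp add: algebra_simps)
  qed
qed

section \<open>Functions with a simple pole at infinity\<close>

text \<open>The identity theorem for power series in 1 / z. It makes the definite descriptions of
  Faber polynomials and Grunsky coefficients meaningful, and later gives the reality of the
  expansion.\<close>

lemma sums_at_infinity_unique:
  fixes a b :: "nat \<Rightarrow> complex"
  assumes "eventually (\<lambda>z. (\<lambda>n. a n / z ^ n) sums f z) at_infinity"
    and "eventually (\<lambda>z. (\<lambda>n. b n / z ^ n) sums f z) at_infinity"
  shows "a = b"
proof -
  define C where "C = Abs_fps (\<lambda>n. a n - b n)"
  have "eventually (\<lambda>z. (\<lambda>n. (a n - b n) / z ^ n) sums 0) at_infinity"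
    using assms
  proof eventually_elim
    case (elim z)
    from sums_diff[OF this] show ?case by (simp add: diff_divide_distrib)
  qed
  then obtain R0 where R0: "\<And>z. norm z \<ge> R0 \<Longrightarrow> (\<lambda>n. (a n - b n) / z ^ n) sums 0"
    unfolding eventually_at_infinity by blast
  define R where "R = max R0 1"
  have R: "R \<ge> 1" "R \<ge> R0" by (auto simp: R_def)
  have sums: "(\<lambda>n. (a n - b n) * t ^ n) sums 0" if "t \<noteq> 0" "norm t \<le> 1 / R" for t
  proof -
    have "norm (1 / t) \<ge> R" using that R by (simp add: norm_divide field_simps)
    then have "(\<lambda>n. (a n - b n) / (1 / t) ^ n) sums 0" using R by (intro R0) simp
    then show ?thesis by (simp add: divide_inverse power_inverse)
  qed
  have "summable (\<lambda>n. (a n - b n) * of_real (1 / R) ^ n)"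
    using sums[of "of_real (1 / R)"] R by (auto simp: sums_iff norm_divide)
  then have rad: "fps_conv_radius C \<ge> ereal (1 / R)"
    unfolding fps_conv_radius_def C_def using R conv_radius_geI[of "\<lambda>n. a n - b n" "of_real (1 / R)"]
    by (simp add: norm_divide)
  moreover have "ereal (1 / R) > 0" using R by simp
  ultimately have pos: "fps_conv_radius C > 0" by (rule less_le_trans[rotated])
  have ev: "eventually (\<lambda>t. eval_fps C t = 0) (at 0)"
    unfolding eventually_at
  proof (intro exI[of _ "1 / R"] conjI ballI impI)
    fix t :: complex assume "t \<noteq> 0 \<and> dist t 0 < 1 / R"
    then show "eval_fps C t = 0"
      using sums[of t] by (auto simp: eval_fps_def C_def sums_iff)
  qed (use R in auto)
  \<comment> \<open>The hypotheses concern t = 1 / z, which is never 0; the value at 0 is supplied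
    by continuity.\<close>
  have "isCont (eval_fps C) 0"
    using pos by (intro continuous_eval_fps) (simp add: zero_ereal_def)
  then have "((eval_fps C) \<longlongrightarrow> eval_fps C 0) (at 0)" by (simp add: isCont_def)
  moreover have "((eval_fps C) \<longlongrightarrow> 0) (at 0)"
    by (rule tendsto_eventually[OF ev])
  ultimately have z: "eval_fps C 0 = 0" by (rule tendsto_unique[rotated]) simp
  have "eventually (\<lambda>t. eval_fps C t = eval_fps 0 t) (nhds 0)"
    using ev unfolding eventually_at_filter by (rule eventually_mono) (use z in auto)
  then have "C = 0" using pos by (intro eval_fps_eqD) auto
  then show ?thesis by (auto simp: C_def fps_eq_iff)
qed

lemma eval_fps_sum:
  fixes f :: "'i \<Rightarrow> complex fps"
  assumes "\<And>i. i \<in> A \<Longrightarrow> 1 \<le> fps_conv_radius (f i)" and "norm z < 1"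
  shows "eval_fps (\<Sum>i\<in>A. f i) z = (\<Sum>i\<in>A. eval_fps (f i) z)"
  using assms(1)
proof (induction A rule: infinite_finite_induct)
  case (insert x A)
  have z: "ereal (norm z) < 1" using assms by simp
  have "1 \<le> fps_conv_radius (sum f A)"
    using insert by (intro fps_conv_radius_sum_ge) auto
  then show ?case
    using insert z by (simp add: eval_fps_add less_le_trans[of _ 1])
qed auto

text \<open>Coefficients may be arbitrary complex numbers here. Reality is assumed only where the
  Grunsky matrices have to be real symmetric.\<close>

locale laurent_at_infinity =
  fixes K :: "complex fps" and g :: "complex \<Rightarrow> complex"
  assumes K0: "K $ 0 = 1"
    and K_radius: "1 \<le> fps_conv_radius K"
    and g_eq: "norm z > 1 \<Longrightarrow> g z = z * eval_fps K (1 / z)"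
begin

abbreviation "k \<equiv> eval_fps K"
abbreviation "B \<equiv> grunsky_B K"

lemma radiusI: "norm z < 1 \<Longrightarrow> 1 \<le> fps_conv_radius F \<Longrightarrow> ereal (norm z) < fps_conv_radius F"
  using less_le_trans[of "ereal (norm z)" 1] by simp

text \<open>Only the inner variable is evaluated: identities in the formal variable t persist at
  each s in the disc, with no convergence in t.\<close>

definition evQ :: "complex \<Rightarrow> complex fps" where
  "evQ s = Abs_fps (\<lambda>n. eval_fps (grunsky_Q K $ n) s)"

definition evB :: "complex \<Rightarrow> complex fps" where
  "evB s = Abs_fps (\<lambda>n. eval_fps (B $ n) s)"

text \<open>\<open>U s\<close> is the expansion of \<open>s * k t - t * k s\<close> in \<open>t\<close>.\<close>

definition U :: "complex \<Rightarrow> complex fps" where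
  "U s = fps_const s * K - fps_const (k s) * fps_X"

lemma evB_mult:
  assumes s: "norm s < 1"
  shows "evB s * evQ s = - fps_eulerop (evQ s)"
proof (rule fps_ext)
  fix n
  note rB = radiusI[OF s grunsky_B_radius[OF K_radius]]
  note rQ = radiusI[OF s grunsky_Q_radius[OF K_radius]]
  have rM: "1 \<le> fps_conv_radius (B $ i * grunsky_Q K $ j)" for i j
    by (rule order_trans[OF _ fps_conv_radius_mult])
      (simp add: grunsky_B_radius grunsky_Q_radius K_radius)
  have "(evB s * evQ s) $ n = (\<Sum>i=0..n. eval_fps (B $ i) s * eval_fps (grunsky_Q K $ (n - i)) s)"
    by (simp add: evB_def evQ_def fps_mult_nth)
  also have "\<dots> = eval_fps ((B * grunsky_Q K) $ n) s"
    by (simp add: fps_mult_nth eval_fps_sum rM s eval_fps_mult rB rQ)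
  also have "\<dots> = eval_fps (fps_const (- of_nat n) * grunsky_Q K $ n) s"
    unfolding grunsky_B_mult by (simp flip: fps_of_nat fps_const_neg)
  also have "\<dots> = (- fps_eulerop (evQ s)) $ n"
    by (subst eval_fps_mult) (simp_all add: rQ evQ_def)
  finally show "(evB s * evQ s) $ n = (- fps_eulerop (evQ s)) $ n" .
qed

text \<open>This identifies the formal Q with the divided difference: for n > 1 it says that s times
  row n, minus row n - 1, equals s times \<open>K $ n\<close>.\<close>

lemma U_eq:
  assumes s: "norm s < 1"
  shows "U s = (fps_const s - fps_X) * evQ s"
proof (rule fps_ext)
  fix n
  note rQ = radiusI[OF s grunsky_Q_radius[OF K_radius]]
  note rK = radiusI[OF s K_radius]
  have X: "eval_fps (fps_X * F) s = s * eval_fps F s" if "ereal (norm s) < fps_conv_radius F" for F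
    using that by (subst eval_fps_mult) simp_all
  show "U s $ n = ((fps_const s - fps_X) * evQ s) $ n"
  proof (cases n)
    case 0
    then show ?thesis by (simp add: U_def evQ_def K0 left_diff_distrib)
  next
    case (Suc m)
    \<comment> \<open>At t^1 the pattern breaks: row 0 is 1 instead of a shifted tail of K, and the
      term with \<open>k s\<close> contributes.\<close>
    have "eval_fps (fps_X * grunsky_Q K $ n) s =
        (if m = 0 then 1 - k s + s * K $ 1 else eval_fps (grunsky_Q K $ m) s + s * K $ n)"
    proof (cases "m = 0")
      case True
      have r1: "1 \<le> fps_conv_radius (1 - K)"
        by (rule order_trans[OF _ fps_conv_radius_diff]) (simp add: K_radius)
      have r2: "1 \<le> fps_conv_radius (fps_X * fps_const (K $ 1))"
        by (rule order_trans[OF _ fps_conv_radius_mult]) simp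
      have "fps_X * grunsky_Q K $ n = 1 - K + fps_X * fps_const (K $ 1)"
        using True Suc K0 by (intro fps_ext) (auto simp: grunsky_Q_nth le_Suc_eq)
      then have "eval_fps (fps_X * grunsky_Q K $ n) s = 1 - k s + s * K $ 1"
        using radiusI[OF s r1] radiusI[OF s r2] rK
        by (simp add: eval_fps_add eval_fps_diff X del: One_nat_def)
      then show ?thesis using True by simp
    next
      case False
      have r2: "1 \<le> fps_conv_radius (fps_X * fps_const (K $ n))"
        by (rule order_trans[OF _ fps_conv_radius_mult]) simp
      have "fps_X * grunsky_Q K $ n = grunsky_Q K $ m + fps_X * fps_const (K $ n)"
        using False Suc by (intro fps_ext) (auto simp: grunsky_Q_nth le_Suc_eq)
      then have "eval_fps (fps_X * grunsky_Q K $ n) s = eval_fps (grunsky_Q K $ m) s + s * K $ n"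
        using radiusI[OF s r2] rQ by (simp add: eval_fps_add X)
      then show ?thesis using False by simp
    qed
    then have "s * eval_fps (grunsky_Q K $ n) s =
        (if m = 0 then 1 - k s + s * K $ 1 else eval_fps (grunsky_Q K $ m) s + s * K $ n)"
      by (simp add: X rQ)
    then show ?thesis using Suc
      by (auto simp: U_def evQ_def left_diff_distrib)
  qed
qed

text \<open>Apply 1 - t d/dt log to U = (s - t) Q. The left side gives the Faber series at w = g (1
  / s) = \<open>k s / s\<close>; on the right, the factor s - t gives s / (s - t), the geometric
  series \<open>Geo\<close>, and Q gives B. As formal series over a field have no zero divisors,
  comparing the products with \<open>U s\<close> is enough.\<close>

lemma faber_rec_g:
  assumes "0 < norm s" "norm s < 1"
  shows "poly (faber_rec K n) (k s / s) = (1 / s) ^ n + eval_fps (B $ n) s"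
proof -
  note s = assms(2)
  define Fab where "Fab = Abs_fps (\<lambda>n. poly (faber_rec K n) (k s / s))"
  define Geo where "Geo = Abs_fps (\<lambda>n. (1 / s) ^ n)"
  let ?S = "fps_const s - fps_X"
  have s0: "s \<noteq> 0" using assms by auto
  have Geo: "Geo * ?S = fps_const s"
  proof (rule fps_ext)
    fix m show "(Geo * ?S) $ m = fps_const s $ m"
      using s0 by (cases m) (simp_all add: Geo_def right_diff_distrib field_simps)
  qed
  have Fab: "Fab * U s = U s - fps_eulerop (U s)"
  proof -
    have "U s = fps_const s * (K - fps_const (k s / s) * fps_X)"
      using s0 by (simp add: U_def right_diff_distrib mult.assoc[symmetric])
    then have "Fab * U s = fps_const s * (Fab * (K - fps_const (k s / s) * fps_X))"
      by (simp only: mult.left_commute)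
    also have "\<dots> = fps_const s * (K - fps_eulerop K)"
      unfolding Fab_def faber_rec_fps[OF K0] ..
    also have "\<dots> = U s - fps_eulerop (U s)"
      by (intro fps_ext) (auto simp: U_def algebra_simps)
    finally show ?thesis .
  qed
  have ES: "fps_eulerop (?S * evQ s) = ?S * fps_eulerop (evQ s) - fps_X * evQ s"
    by (simp add: fps_eulerop_def algebra_simps)
  have "(Fab - Geo - evB s) * (?S * evQ s) =
      Fab * (?S * evQ s) - (Geo * ?S) * evQ s - ?S * (evB s * evQ s)"
    by (simp add: algebra_simps)
  also have "\<dots> = 0"
    unfolding Geo evB_mult[OF s] using Fab unfolding U_eq[OF s] ES by (simp add: algebra_simps)
  finally have "(Fab - Geo - evB s) * (?S * evQ s) = 0" .
  moreover have "?S \<noteq> 0"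
    using s0 by (auto simp: fps_eq_iff intro!: exI[of _ 0])
  moreover have "evQ s \<noteq> 0"
    by (auto simp: fps_eq_iff evQ_def intro!: exI[of _ 0])
  ultimately have "Fab - Geo - evB s = 0" by (simp only: mult_eq_0_iff simp_thms)
  then have "Fab = Geo + evB s" by (simp add: algebra_simps)
  then have "Fab $ n = Geo $ n + evB s $ n" by simp
  then show ?thesis by (simp add: Fab_def Geo_def evB_def)
qed

end

context laurent_at_infinity
begin

lemma has_field_derivative_g:
  assumes z: "norm z > 1"
  shows "(g has_field_derivative (k (1 / z) - (1 / z) * eval_fps (fps_deriv K) (1 / z))) (at z)"
proof (rule has_field_derivative_transform_within_open)
  have z0: "z \<noteq> 0" using z by auto
  have "norm (1 / z) < 1" using z by (simp add: norm_divide divide_simps)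
  then have k': "(k has_field_derivative eval_fps (fps_deriv K) (1 / z)) (at (1 / z))"
    by (intro has_field_derivative_eval_fps radiusI K_radius)
  have "((\<lambda>z. 1 / z) has_field_derivative - 1 / z ^ 2) (at z)"
    using z0 by (auto intro!: derivative_eq_intros simp: power2_eq_square)
  note DERIV_chain2[OF k' this]
  then have "((\<lambda>z. z * k (1 / z)) has_field_derivative
      1 * k (1 / z) + eval_fps (fps_deriv K) (1 / z) * (- 1 / z ^ 2) * z) (at z)"
    by (intro DERIV_mult DERIV_ident)
  also have "1 * k (1 / z) + eval_fps (fps_deriv K) (1 / z) * (- 1 / z ^ 2) * z =
      k (1 / z) - (1 / z) * eval_fps (fps_deriv K) (1 / z)"
    using z0 by (simp add: power2_eq_square)
  finally show "((\<lambda>z. z * k (1 / z)) has_field_derivative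
      (k (1 / z) - (1 / z) * eval_fps (fps_deriv K) (1 / z))) (at z)" .
  have "open (- cball (0 :: complex) 1)" by auto
  also have "- cball (0 :: complex) 1 = {z. norm z > 1}" by auto
  finally show "open {z :: complex. norm z > 1}" .
qed (use z g_eq in auto)

text \<open>\<open>D\<close> stands for (g \<zeta> - w) / \<zeta>. Its constant term 1 makes
  \<open>inverse D\<close>, and with it the Faber series, converge near t = 0; the radius depends on
  w because \<open>D\<close> vanishes where g takes the value w.\<close>

lemma faber_rec_sums:
  "eventually (\<lambda>\<zeta>. (\<lambda>n. poly (faber_rec K n) w / \<zeta> ^ n) sums (\<zeta> * deriv g \<zeta> / (g \<zeta> - w))) at_infinity"
proof -
  define Fab where "Fab = Abs_fps (\<lambda>n. poly (faber_rec K n) w)"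
  define D where "D = K - fps_const w * fps_X"
  have FD: "Fab * D = K - fps_eulerop K"
    unfolding Fab_def D_def by (rule faber_rec_fps[OF K0])
  have D0: "D $ 0 = 1" by (simp add: D_def K0)
  have rX: "1 \<le> fps_conv_radius (fps_const w * fps_X)"
    by (rule order_trans[OF _ fps_conv_radius_mult]) simp
  have rD: "1 \<le> fps_conv_radius D"
    unfolding D_def by (rule order_trans[OF _ fps_conv_radius_diff]) (simp add: K_radius rX)
  have rK': "1 \<le> fps_conv_radius (fps_deriv K)"
    by (rule order_trans[OF K_radius fps_conv_radius_deriv])
  have rE: "1 \<le> fps_conv_radius (fps_eulerop K)"
    unfolding fps_eulerop_def by (rule order_trans[OF _ fps_conv_radius_mult]) (simp add: rK')
  have rN: "1 \<le> fps_conv_radius (K - fps_eulerop K)"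
    by (rule order_trans[OF _ fps_conv_radius_diff]) (simp add: K_radius rE)
  have "fps_conv_radius (inverse D) > 0"
    using rD D0 by (intro fps_conv_radius_inverse_pos) (auto intro: less_le_trans[of _ 1])
  moreover have "Fab = (K - fps_eulerop K) * inverse D"
    unfolding FD[symmetric] using D0 by (simp add: mult.assoc inverse_mult_eq_1')
  moreover have "fps_conv_radius (K - fps_eulerop K) > 0"
    using rN by (rule less_le_trans[rotated]) simp
  ultimately have rF: "fps_conv_radius Fab > 0"
    by (metis fps_conv_radius_mult less_le_trans min_less_iff_conj)
  have "isCont (eval_fps D) 0"
    using radiusI[of 0 D] rD by (intro continuous_eval_fps) simp
  moreover have "eval_fps D 0 \<noteq> 0" by (simp add: eval_fps_at_0 D0)
  ultimately have "eventually (\<lambda>t. eval_fps D t \<noteq> 0) (nhds 0)"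
    by (intro tendsto_imp_eventually_ne[of _ "eval_fps D 0"]) (auto simp: isCont_def tendsto_at_iff_tendsto_nhds)
  moreover have "eventually (\<lambda>t. t \<in> eball 0 (fps_conv_radius Fab)) (nhds (0 :: complex))"
    using rF by (intro eventually_nhds_in_open) (auto simp: zero_ereal_def)
  ultimately have "eventually (\<lambda>t. eval_fps D t \<noteq> 0 \<and> t \<in> eball 0 (fps_conv_radius Fab)) (nhds 0)"
    by eventually_elim auto
  then have "eventually (\<lambda>\<zeta>. eval_fps D (inverse \<zeta>) \<noteq> 0 \<and> inverse \<zeta> \<in> eball 0 (fps_conv_radius Fab))
      at_infinity"
    by (rule eventually_compose_filterlim) (rule tendsto_inverse_0)
  moreover have "eventually (\<lambda>\<zeta> :: complex. norm \<zeta> \<ge> 2) at_infinity"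
    by (auto simp: eventually_at_infinity)
  ultimately show ?thesis
  proof eventually_elim
    case (elim \<zeta>)
    define t where "t = 1 / \<zeta>"
    have \<zeta>: "norm \<zeta> > 1" "\<zeta> \<noteq> 0" using elim by auto
    have t: "norm t < 1" "t \<noteq> 0" using \<zeta> by (auto simp: t_def norm_divide divide_simps)
    have Dt: "eval_fps D t \<noteq> 0" "ereal (norm t) < fps_conv_radius Fab"
      using elim by (auto simp: t_def inverse_eq_divide)
    have "eval_fps Fab t * eval_fps D t = eval_fps (Fab * D) t"
      using Dt t by (simp add: eval_fps_mult radiusI rD)
    also have "\<dots> = k t - t * eval_fps (fps_deriv K) t"
      unfolding FD fps_eulerop_def using radiusI[OF t(1) rK'] radiusI[OF t(1) K_radius] radiusI[OF t(1) rE]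
      by (simp add: eval_fps_diff eval_fps_mult fps_eulerop_def)
    also have "\<dots> = deriv g \<zeta>"
      using DERIV_imp_deriv[OF has_field_derivative_g[OF \<zeta>(1)]] by (simp add: t_def)
    finally have e1: "eval_fps Fab t * eval_fps D t = deriv g \<zeta>" .
    have e2: "eval_fps D t = (g \<zeta> - w) / \<zeta>"
      unfolding D_def using radiusI[OF t(1) K_radius] radiusI[OF t(1) rX] \<zeta> g_eq[OF \<zeta>(1)]
      by (simp add: eval_fps_diff eval_fps_mult t_def field_simps)
    have "eval_fps Fab t = deriv g \<zeta> / eval_fps D t"
      using e1 Dt by (simp add: field_simps)
    also have "\<dots> = \<zeta> * deriv g \<zeta> / (g \<zeta> - w)" by (simp add: e2)
    finally have "eval_fps Fab t = \<zeta> * deriv g \<zeta> / (g \<zeta> - w)" .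
    moreover have "(\<lambda>n. poly (faber_rec K n) w / \<zeta> ^ n) sums eval_fps Fab t"
      using sums_eval_fps[OF Dt(2)] by (simp add: Fab_def t_def power_one_over divide_inverse power_inverse)
    ultimately show ?case by simp
  qed
qed

lemma faber_poly_eq: "faber_poly g = faber_rec K"
  unfolding faber_poly_def
proof (rule the_equality)
  show "(\<forall>n. degree (faber_rec K n) = n \<and> lead_coeff (faber_rec K n) = 1) \<and>
     (\<forall>w. eventually (\<lambda>\<zeta>. (\<lambda>n. poly (faber_rec K n) w / \<zeta> ^ n) sums (\<zeta> * deriv g \<zeta> / (g \<zeta> - w)))
            at_infinity)"
    using faber_rec_monic faber_rec_sums by blast
next
  fix P
  assume *: "(\<forall>n. degree (P n) = n \<and> lead_coeff (P n) = 1) \<and>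
     (\<forall>w. eventually (\<lambda>\<zeta>. (\<lambda>n. poly (P n) w / \<zeta> ^ n) sums (\<zeta> * deriv g \<zeta> / (g \<zeta> - w)))
            at_infinity)"
  have "(\<lambda>n. poly (P n) w) = (\<lambda>n. poly (faber_rec K n) w)" for w
    using * faber_rec_sums
    by (intro sums_at_infinity_unique[where f = "\<lambda>\<zeta>. \<zeta> * deriv g \<zeta> / (g \<zeta> - w)"]) blast+
  then have "poly (P n) = poly (faber_rec K n)" for n by (metis ext)
  then show "P = faber_rec K" by (auto simp: poly_eq_poly_eq_iff)
qed

lemma faber_poly_sums:
  assumes z: "norm z > 1"
  shows "(\<lambda>m. B $ n $ m / z ^ m) sums (poly (faber_poly g n) (g z) - z ^ n)"
proof -
  have s: "norm (1 / z) < 1" "0 < norm (1 / z)" using z by (auto simp: norm_divide divide_simps)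
  have "poly (faber_poly g n) (g z) - z ^ n = eval_fps (B $ n) (1 / z)"
    using faber_rec_g[OF s(2,1), of n] g_eq[OF z] by (simp add: faber_poly_eq mult.commute)
  then show ?thesis
    using sums_eval_fps[OF radiusI[OF s(1) grunsky_B_radius[OF K_radius]], of n]
    by (simp add: power_one_over divide_inverse power_inverse)
qed

lemma grunsky_coeff_eq: "grunsky_coeff g n = (\<lambda>m. B $ n $ m)"
  unfolding grunsky_coeff_def
proof (rule the_equality)
  show "B $ n $ 0 = 0 \<and> (\<forall>z. norm z > 1 \<longrightarrow>
        (\<lambda>m. B $ n $ m / z ^ m) sums (poly (faber_poly g n) (g z) - z ^ n))"
    using faber_poly_sums by simp
next
  fix \<beta> assume *: "\<beta> 0 = 0 \<and> (\<forall>z. norm z > 1 \<longrightarrow>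
        (\<lambda>k. \<beta> k / z ^ k) sums (poly (faber_poly g n) (g z) - z ^ n))"
  have "eventually (\<lambda>z :: complex. norm z \<ge> 2) at_infinity"
    by (auto simp: eventually_at_infinity)
  then have ev: "eventually (\<lambda>z :: complex. norm z > 1) at_infinity"
    by eventually_elim simp
  show "\<beta> = (\<lambda>m. B $ n $ m)"
    by (rule sums_at_infinity_unique; rule eventually_mono[OF ev]) (use * faber_poly_sums in auto)
qed

lemma scaled_grunsky_coeff_sym:
  assumes "n \<ge> 1" "m \<ge> 1"
  shows "scaled_grunsky_coeff g n m = scaled_grunsky_coeff g m n"
proof -
  have sq: "sqrt (real m / real n) * real n = sqrt (real m * real n)"
    "sqrt (real n / real m) * real m = sqrt (real m * real n)"
    using assms by (simp_all add: real_sqrt_divide real_sqrt_mult field_simps)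
  have "of_nat m * (of_nat n * scaled_grunsky_coeff g n m) =
     complex_of_real (sqrt (real m / real n) * real n) * (of_nat m * B $ n $ m)"
    by (simp add: scaled_grunsky_coeff_def grunsky_coeff_eq)
  also have "\<dots> = of_nat m * (of_nat n * scaled_grunsky_coeff g m n)"
    unfolding sq(1) grunsky_B_symmetric[of m K n] unfolding sq(2)[symmetric]
    by (simp add: scaled_grunsky_coeff_def grunsky_coeff_eq)
  finally show ?thesis using assms by simp
qed

text \<open>With \<open>L t = \<Sum>n. B\<^sub>n(s) t ^ n / n\<close>, the function \<open>U s t * exp (L t) / (s - t)\<close> has derivative 0,
  hence equals its value 1 at \<open>t = 0\<close>.\<close>

lemma inj_on_if_scaled_grunsky_coeff_bounded:
  assumes bnd: "\<And>n m. n \<ge> 1 \<Longrightarrow> m \<ge> 1 \<Longrightarrow> norm (scaled_grunsky_coeff g n m) \<le> 1"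
  shows "inj_on g {z. norm z > 1}"
proof -
  \<comment> \<open>A bound linear in n suffices: the coefficients of \<open>L\<close> are divided
    by n, so they are bounded uniformly in n by the geometric series in s, and \<open>L\<close> has
    radius at least 1.\<close>
  have Bb: "norm (B $ n $ m) \<le> real n" for n m
  proof (cases "n = 0 \<or> m = 0")
    case False
    then have nm: "n \<ge> 1" "m \<ge> 1" by auto
    have "sqrt (real m / real n) * norm (B $ n $ m) \<le> 1"
      using bnd[OF nm] nm by (simp add: scaled_grunsky_coeff_def grunsky_coeff_eq norm_mult)
    then have "norm (B $ n $ m) \<le> sqrt (real n / real m)"
      using nm by (simp add: real_sqrt_divide field_simps)
    also have "\<dots> \<le> sqrt (real n ^ 2)"
    proof (rule real_sqrt_le_mono)
      have "real n / real m \<le> real n / 1" using nm by (intro divide_left_mono) auto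
      also have "\<dots> \<le> real n ^ 2" using nm by (simp add: power2_eq_square)
      finally show "real n / real m \<le> real n ^ 2" .
    qed
    finally show ?thesis by simp
  qed auto
  \<comment> \<open>With s = 1 / w and t = 1 / z the expression is (g z - g w) / (z w).\<close>
  have main: "s * k t - k s * t \<noteq> 0" if s: "0 < norm s" "norm s < 1" and t: "norm t < 1" "t \<noteq> s" for s t
  proof -
    have s0: "s \<noteq> 0" using s by auto
    define L where "L = Abs_fps (\<lambda>n. evB s $ n / of_nat n)"
    have evB0: "evB s $ 0 = 0" by (simp add: evB_def)
    have EL: "fps_X * fps_deriv L = evB s"
      by (rule fps_ext) (auto simp: L_def evB0 gr0_conv_Suc)
    have nL: "norm (L $ n) \<le> 1 / (1 - norm s)" for n
    proof (cases "n = 0")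
      case False
      have sm: "summable (\<lambda>m. real n * norm s ^ m)"
        using s by (intro summable_mult summable_geometric) simp
      have "norm (B $ n $ m * s ^ m) \<le> real n * norm s ^ m" for m
        unfolding norm_mult norm_power by (intro mult_right_mono Bb) simp
      then have "norm (eval_fps (B $ n) s) \<le> (\<Sum>m. real n * norm s ^ m)"
        unfolding eval_fps_def using sm by (intro norm_suminf_le)
      also have "\<dots> = real n * (1 / (1 - norm s))"
        using s by (simp add: suminf_mult summable_geometric suminf_geometric)
      finally show ?thesis using False by (simp add: L_def evB_def norm_divide field_simps)
    qed (use s in \<open>simp add: L_def\<close>)
    have "conv_radius (fps_nth L) \<ge> 1"
    proof (rule conv_radius_geI_ex')
      fix r :: real assume r: "0 < r" "ereal r < 1"
      show "summable (\<lambda>n. fps_nth L n * of_real r ^ n)"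
      proof (rule summable_comparison_test')
        show "summable (\<lambda>n. 1 / (1 - norm s) * r ^ n)"
          using r by (intro summable_mult summable_geometric) simp
        show "norm (fps_nth L n * of_real r ^ n) \<le> 1 / (1 - norm s) * r ^ n" for n
          using nL[of n] r s by (simp only: norm_mult norm_power norm_of_real) (intro mult_mono, auto)
      qed
    qed
    then have rL: "1 \<le> fps_conv_radius L" by (simp add: fps_conv_radius_def)
    let ?S = "fps_const s - fps_X"
    have "fps_X * (?S * (fps_deriv (U s) + U s * fps_deriv L)) =
        ?S * (fps_eulerop (U s) + U s * (fps_X * fps_deriv L))"
      by (simp add: fps_eulerop_def algebra_simps)
    also have "\<dots> = fps_X * (- U s)"
    proof -
      have ES: "fps_eulerop (?S * evQ s) = ?S * fps_eulerop (evQ s) - fps_X * evQ s"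
        by (simp add: fps_eulerop_def algebra_simps)
      have "?S * evQ s * evB s = ?S * (evB s * evQ s)" by (simp only: mult_ac)
      then show ?thesis
        unfolding EL U_eq[OF s(2)] ES evB_mult[OF s(2)] by (simp add: algebra_simps)
    qed
    \<comment> \<open>This is the vanishing of the derivative of U exp L / (s - t), up to the
      nonzero factor exp L / (s - t)^2.\<close>
    finally have ode: "?S * (fps_deriv (U s) + U s * fps_deriv L) = - U s"
      by (simp only: mult_cancel_left) simp
    have rU: "1 \<le> fps_conv_radius (U s)"
    proof -
      have "1 \<le> fps_conv_radius (fps_const s * K)" "1 \<le> fps_conv_radius (fps_const (k s) * fps_X)"
        by (rule order_trans[OF _ fps_conv_radius_mult], simp add: K_radius)+
      then show ?thesis unfolding U_def by (intro order_trans[OF _ fps_conv_radius_diff]) simp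
    qed
    have rU': "1 \<le> fps_conv_radius (fps_deriv (U s))" and rL': "1 \<le> fps_conv_radius (fps_deriv L)"
      by (rule order_trans[OF _ fps_conv_radius_deriv], simp add: rU rL)+
    have rUL: "1 \<le> fps_conv_radius (U s * fps_deriv L)"
      by (rule order_trans[OF _ fps_conv_radius_mult]) (simp add: rU rL')
    have rA: "1 \<le> fps_conv_radius (fps_deriv (U s) + U s * fps_deriv L)"
      by (rule order_trans[OF _ fps_conv_radius_add]) (simp add: rU' rUL)
    have rS: "1 \<le> fps_conv_radius ?S"
      by (rule order_trans[OF _ fps_conv_radius_diff]) simp
    have Uev: "eval_fps (U s) x = s * k x - k s * x" if "norm x < 1" for x
      unfolding U_def using radiusI[OF that K_radius] fps_conv_radius_mult[of "fps_const s" K]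
        fps_conv_radius_mult[of "fps_const (k s)" fps_X]
      by (subst eval_fps_diff) (auto simp: eval_fps_mult intro!: radiusI[OF that] order_trans[OF _ fps_conv_radius_mult] K_radius)
    have ode': "(s - x) * (eval_fps (fps_deriv (U s)) x + eval_fps (U s) x * eval_fps (fps_deriv L) x) =
        - eval_fps (U s) x" if x: "norm x < 1" for x
      using arg_cong[OF ode, of "\<lambda>f. eval_fps f x"] radiusI[OF x rU] radiusI[OF x rU'] radiusI[OF x rL']
        radiusI[OF x rUL] radiusI[OF x rA] radiusI[OF x rS]
      by (simp add: eval_fps_mult eval_fps_add eval_fps_diff eval_fps_minus)
    define M where "M x = eval_fps (U s) x * exp (eval_fps L x) / (s - x)" for x
    have "(M has_field_derivative 0) (at x)" if "x \<in> ball 0 1 - {s}" for x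
    proof -
      have x: "norm x < 1" "s - x \<noteq> 0" using that by auto
      have "(M has_field_derivative
         (((eval_fps (fps_deriv (U s)) x * exp (eval_fps L x) + exp (eval_fps L x) * eval_fps (fps_deriv L) x * eval_fps (U s) x) * (s - x)
          - eval_fps (U s) x * exp (eval_fps L x) * (0 - 1)) / ((s - x) * (s - x)))) (at x)"
        unfolding M_def[abs_def] using x
        by (intro DERIV_divide DERIV_mult DERIV_chain2[OF DERIV_exp] has_field_derivative_eval_fps
            radiusI rU rL DERIV_diff DERIV_const DERIV_ident)
      also have "(eval_fps (fps_deriv (U s)) x * exp (eval_fps L x) + exp (eval_fps L x) * eval_fps (fps_deriv L) x * eval_fps (U s) x) * (s - x)
          - eval_fps (U s) x * exp (eval_fps L x) * (0 - 1) =
         exp (eval_fps L x) * ((s - x) * (eval_fps (fps_deriv (U s)) x + eval_fps (U s) x * eval_fps (fps_deriv L) x) + eval_fps (U s) x)"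
        by (simp add: algebra_simps)
      also have "\<dots> = 0" unfolding ode'[OF x(1)] by simp
      finally show ?thesis by simp
    qed
    \<comment> \<open>The quotient \<open>M\<close> is undefined at s, but a punctured disc is still
      connected.\<close>
    moreover have "connected (ball 0 1 - {s})"
      by (intro connected_open_delete) auto
    ultimately have "M constant_on (ball 0 1 - {s})"
      by (intro has_field_derivative_0_imp_constant_on) auto
    then have "M t = M 0" using s0 t unfolding constant_on_def by auto
    also have "M 0 = 1"
      using s0 by (simp add: M_def Uev eval_fps_at_0 K0 L_def U_def)
    finally show ?thesis using Uev[OF t(1)] by (auto simp: M_def)
  qed
  show ?thesis
  proof (rule inj_onI)
    fix z w :: complex assume zw: "z \<in> {z. norm z > 1}" "w \<in> {z. norm z > 1}" "g z = g w"
    then have 0: "z \<noteq> 0" "w \<noteq> 0" by auto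
    have n: "norm (1 / z) < 1" "norm (1 / w) < 1" "0 < norm (1 / w)"
      using zw by (auto simp: norm_divide divide_simps)
    have "1 / w * k (1 / z) - k (1 / w) * (1 / z) = (g z - g w) / (z * w)"
      using zw 0 by (simp add: g_eq field_simps)
    then have "1 / w * k (1 / z) - k (1 / w) * (1 / z) = 0" using zw by simp
    then have "1 / z = 1 / w" using main[OF n(3,2,1)] by blast
    then show "z = w" by simp
  qed
qed

end

section \<open>The area enclosed by a closed curve\<close>

lemma nn_integral_inverse_sqrt_finite:
  "(\<integral>\<^sup>+s. ennreal (1 / sqrt \<bar>s\<bar> * indicator {-c..c} s) \<partial>lborel) < \<infinity>"
proof (cases "c \<ge> 0")
  case True
  let ?f = "\<lambda>s. ennreal (1 / sqrt \<bar>s\<bar> * indicator {0..c} s)"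
  \<comment> \<open>Also true at s = 0, where both sides are 0 by convention.\<close>
  have eq: "s powr (- (1 / 2)) = 1 / sqrt \<bar>s\<bar>" if "s \<ge> 0" for s :: real
    unfolding powr_minus_divide using that by (simp add: powr_half_sqrt)
  have "((\<lambda>s. s powr (- (1 / 2))) has_integral (c powr (- (1 / 2) + 1) / (- (1 / 2) + 1))) {0..c}"
    using True by (intro has_integral_powr_from_0) auto
  then have "(\<integral>\<^sup>+s. ennreal (s powr (- (1 / 2))) * indicator {0..c} s \<partial>lborel) =
      ennreal (c powr (- (1 / 2) + 1) / (- (1 / 2) + 1))"
    by (intro nn_integral_has_integral_lebesgue') auto
  also have "(\<integral>\<^sup>+s. ennreal (s powr (- (1 / 2))) * indicator {0..c} s \<partial>lborel) = (\<integral>\<^sup>+s. ?f s \<partial>lborel)"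
    by (intro nn_integral_cong) (auto simp: indicator_def eq)
  finally have fin: "(\<integral>\<^sup>+s. ?f s \<partial>lborel) < \<infinity>" by simp
  have "(\<integral>\<^sup>+s. ennreal (1 / sqrt \<bar>s\<bar> * indicator {-c..c} s) \<partial>lborel) \<le>
      (\<integral>\<^sup>+s. ?f s + ?f (0 + (- 1) * s) \<partial>lborel)"
    by (intro nn_integral_mono) (auto simp: indicator_def)
  also have "\<dots> = (\<integral>\<^sup>+s. ?f s \<partial>lborel) + (\<integral>\<^sup>+s. ?f (0 + (- 1) * s) \<partial>lborel)"
    by (intro nn_integral_add) auto
  also have "(\<integral>\<^sup>+s. ?f (0 + (- 1) * s) \<partial>lborel) = (\<integral>\<^sup>+s. ?f s \<partial>lborel)"
    using nn_integral_real_affine[of ?f "-1" 0] by simp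
  finally have "(\<integral>\<^sup>+s. ennreal (1 / sqrt \<bar>s\<bar> * indicator {-c..c} s) \<partial>lborel) \<le>
      (\<integral>\<^sup>+s. ?f s \<partial>lborel) + (\<integral>\<^sup>+s. ?f s \<partial>lborel)" .
  also have "\<dots> < \<infinity>" using fin by (simp add: less_top[symmetric])
  finally show ?thesis .
next
  case False
  then have "indicator {-c..c} s = (0 :: real)" for s by (auto simp: indicator_def)
  then show ?thesis by simp
qed

text \<open>Substitute s = x - u, which stays within distance 2 M of 0. The resulting bound no
  longer depends on x.\<close>

lemma nn_integral_inverse_sqrt_shift:
  assumes "\<bar>x\<bar> \<le> M"
  shows "(\<integral>\<^sup>+u. ennreal (1 / sqrt \<bar>x - u\<bar> * indicator {-M..M} u) \<partial>lborel) \<le>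
    (\<integral>\<^sup>+s. ennreal (1 / sqrt \<bar>s\<bar> * indicator {-(2*M)..2*M} s) \<partial>lborel)"
proof -
  have "(\<integral>\<^sup>+s. ennreal (1 / sqrt \<bar>s\<bar> * indicator {-(2*M)..2*M} s) \<partial>lborel) =
      (\<integral>\<^sup>+u. ennreal (1 / sqrt \<bar>x + (-1) * u\<bar> * indicator {-(2*M)..2*M} (x + (-1) * u)) \<partial>lborel)"
    by (subst nn_integral_real_affine[of _ "-1" x]) auto
  also have "\<dots> \<ge> (\<integral>\<^sup>+u. ennreal (1 / sqrt \<bar>x - u\<bar> * indicator {-M..M} u) \<partial>lborel)"
    using assms by (intro nn_integral_mono) (auto simp: indicator_def)
  finally show ?thesis .
qed

text \<open>The two-dimensional singularity splits because \<open>1 / |p + i q| \<le> 1 / sqrt |p q|\<close>.\<close>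

lemma nn_integral_cauchy_kernel_le:
  assumes z: "norm z \<le> M"
  shows "(\<integral>\<^sup>+p. ennreal (indicator {-M..M} (fst p) * indicator {-M..M} (snd p) /
        norm (z - Complex (fst p) (snd p))) \<partial>(lborel \<Otimes>\<^sub>M lborel)) \<le>
    (\<integral>\<^sup>+s. ennreal (1 / sqrt \<bar>s\<bar> * indicator {-(2*M)..2*M} s) \<partial>lborel) ^ 2"
proof -
  let ?W = "\<integral>\<^sup>+s. ennreal (1 / sqrt \<bar>s\<bar> * indicator {-(2*M)..2*M} s) \<partial>lborel"
  let ?q = "\<lambda>x u. 1 / sqrt \<bar>x - u\<bar> * indicator {-M..M} u"
  have xy: "\<bar>Re z\<bar> \<le> M" "\<bar>Im z\<bar> \<le> M"
    using z abs_Re_le_cmod[of z] abs_Im_le_cmod[of z] by linarith+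
  have kernel: "1 / norm (z - Complex u v) \<le> 1 / sqrt \<bar>Re z - u\<bar> * (1 / sqrt \<bar>Im z - v\<bar>)"
    if "u \<noteq> Re z" "v \<noteq> Im z" for u v
  proof -
    let ?a = "\<bar>Re z - u\<bar>" and ?b = "\<bar>Im z - v\<bar>"
    have pos: "?a > 0" "?b > 0" using that by auto
    have "0 \<le> (?a - ?b)\<^sup>2" by simp
    then have "2 * (?a * ?b) \<le> (Re z - u)\<^sup>2 + (Im z - v)\<^sup>2"
      by (simp add: power2_diff)
    moreover have "0 < ?a * ?b" using pos by simp
    ultimately have "?a * ?b \<le> (Re z - u)\<^sup>2 + (Im z - v)\<^sup>2" by linarith
    then have "sqrt (?a * ?b) \<le> norm (z - Complex u v)"
      by (simp add: cmod_def)
    moreover have "sqrt (?a * ?b) > 0" using pos by simp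
    ultimately have "1 / norm (z - Complex u v) \<le> 1 / sqrt (?a * ?b)"
      by (intro divide_left_mono mult_pos_pos) linarith+
    then show ?thesis by (simp add: real_sqrt_mult)
  qed
  have "(\<integral>\<^sup>+p. ennreal (indicator {-M..M} (fst p) * indicator {-M..M} (snd p) /
        norm (z - Complex (fst p) (snd p))) \<partial>(lborel \<Otimes>\<^sub>M lborel)) =
      (\<integral>\<^sup>+u. \<integral>\<^sup>+v. ennreal (indicator {-M..M} u * indicator {-M..M} v / norm (z - Complex u v)) \<partial>lborel \<partial>lborel)"
    by (subst lborel.nn_integral_fst[symmetric]) (auto simp: cmod_def)
  also have "\<dots> \<le> (\<integral>\<^sup>+u. \<integral>\<^sup>+v. ennreal (?q (Re z) u) * ennreal (?q (Im z) v) \<partial>lborel \<partial>lborel)"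
  \<comment> \<open>On the lines u = Re z and v = Im z the majorant is 0 because 1 / 0 = 0, so the
    comparison holds only off these null sets.\<close>
  proof (rule nn_integral_mono_AE)
    have "(\<integral>\<^sup>+v. ennreal (indicator {-M..M} u * indicator {-M..M} v / norm (z - Complex u v)) \<partial>lborel)
        \<le> (\<integral>\<^sup>+v. ennreal (?q (Re z) u) * ennreal (?q (Im z) v) \<partial>lborel)" if u: "u \<noteq> Re z" for u
    proof (rule nn_integral_mono_AE)
      have "ennreal (indicator {-M..M} u * indicator {-M..M} v / norm (z - Complex u v)) \<le>
          ennreal (?q (Re z) u) * ennreal (?q (Im z) v)" if v: "v \<noteq> Im z" for v
        using kernel[OF u v]
        by (subst ennreal_mult[symmetric]) (auto simp: indicator_def intro!: ennreal_leI)
      then show "AE v in lborel. ennreal (indicator {-M..M} u * indicator {-M..M} v / norm (z - Complex u v)) \<le>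
          ennreal (?q (Re z) u) * ennreal (?q (Im z) v)"
        by (rule AE_mp[OF AE_lborel_singleton[of "Im z"] AE_I2[OF impI]])
    qed
    then show "AE u in lborel. (\<integral>\<^sup>+v. ennreal (indicator {-M..M} u * indicator {-M..M} v / norm (z - Complex u v)) \<partial>lborel)
        \<le> (\<integral>\<^sup>+v. ennreal (?q (Re z) u) * ennreal (?q (Im z) v) \<partial>lborel)"
      by (rule AE_mp[OF AE_lborel_singleton[of "Re z"] AE_I2[OF impI]])
  qed
  also have "\<dots> = (\<integral>\<^sup>+u. ennreal (?q (Re z) u) \<partial>lborel) * (\<integral>\<^sup>+v. ennreal (?q (Im z) v) \<partial>lborel)"
    by (subst nn_integral_cmult, simp, subst nn_integral_multc, simp_all)
  also have "\<dots> \<le> ?W * ?W"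
    by (intro mult_mono nn_integral_inverse_sqrt_shift xy) auto
  finally show ?thesis by (simp add: power2_eq_square)
qed

text \<open>The integrand is the imaginary part of (a + i b) / ((x - u) + i c), the Cauchy kernel
  along a horizontal line at height difference c. The logarithms will cancel as M grows, and the
  arctangents add up to pi times the sign of c.\<close>

lemma integral_cauchy_kernel_segment:
  fixes a b c x M :: real
  assumes c: "c \<noteq> 0" and M: "M \<ge> 0"
  shows "(\<integral>u. (b * (x - u) - a * c) / ((x - u)\<^sup>2 + c\<^sup>2) * indicator {-M..M} u \<partial>lborel) =
    b * (ln ((x + M)\<^sup>2 + c\<^sup>2) - ln ((x - M)\<^sup>2 + c\<^sup>2)) / 2
      - a * (arctan ((M - x) / c) + arctan ((M + x) / c))"
proof -
  define F where "F u = - b / 2 * ln ((x - u)\<^sup>2 + c\<^sup>2) - a * arctan ((u - x) / c)" for u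
  have pos: "(x - u)\<^sup>2 + c\<^sup>2 > 0" for u
    using c by (simp add: add_nonneg_pos)
  have "(\<integral>u. (b * (x - u) - a * c) / ((x - u)\<^sup>2 + c\<^sup>2) * indicator {-M..M} u \<partial>lborel) = F M - F (- M)"
  proof (rule integral_FTC_Icc_real)
    fix u :: real
    have "((\<lambda>u. ln ((x - u)\<^sup>2 + c\<^sup>2)) has_real_derivative - 2 * (x - u) / ((x - u)\<^sup>2 + c\<^sup>2)) (at u)"
      using pos[of u] by (auto intro!: derivative_eq_intros simp: field_simps)
    moreover have "((\<lambda>u. arctan ((u - x) / c)) has_real_derivative (1 / c) * (1 / (1 + ((u - x) / c)\<^sup>2))) (at u)"
      using c by (auto intro!: derivative_eq_intros simp: field_simps)
    moreover have "(1 / c) * (1 / (1 + ((u - x) / c)\<^sup>2)) = c / ((x - u)\<^sup>2 + c\<^sup>2)"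
    proof -
      have "1 + ((u - x) / c)\<^sup>2 = ((x - u)\<^sup>2 + c\<^sup>2) / c\<^sup>2"
        using c by (simp add: power_divide add_divide_distrib power2_commute)
      then show ?thesis using c by (simp add: power2_eq_square)
    qed
    ultimately have "(F has_real_derivative - b / 2 * (- 2 * (x - u) / ((x - u)\<^sup>2 + c\<^sup>2))
        - a * (c / ((x - u)\<^sup>2 + c\<^sup>2))) (at u)"
      unfolding F_def[abs_def] by (intro DERIV_diff DERIV_cmult) auto
    also have "- b / 2 * (- 2 * (x - u) / ((x - u)\<^sup>2 + c\<^sup>2)) - a * (c / ((x - u)\<^sup>2 + c\<^sup>2)) =
        (b * (x - u) - a * c) / ((x - u)\<^sup>2 + c\<^sup>2)"
    proof -
      have "- b / 2 * (- 2 * y / D) - a * (c / D) = (b * y - a * c) / D" for y D :: real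
        by (simp add: diff_divide_distrib)
      then show ?thesis .
    qed
    finally show "(F has_real_derivative (b * (x - u) - a * c) / ((x - u)\<^sup>2 + c\<^sup>2)) (at u)" .
    show "isCont (\<lambda>u. (b * (x - u) - a * c) / ((x - u)\<^sup>2 + c\<^sup>2)) u"
      using pos[of u] by (intro continuous_intros) auto
  qed (use M in auto)
  moreover have "arctan ((- M - x) / c) = - arctan ((M + x) / c)"
  proof -
    have "- M - x = - (M + x)" by simp
    then show ?thesis by (simp only: minus_divide_left[symmetric] arctan_minus)
  qed
  ultimately show ?thesis by (simp add: F_def algebra_simps diff_divide_distrib)
qed

text \<open>With A and D the two arguments, ln A - ln D is at most (A - D) / D = 4 x M / D, and D is
  at least M^2 / 4. Replacing x by -x exchanges A and D, so the one-sided estimate gives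
  both.\<close>

lemma ln_quotient_bound:
  fixes x c M R :: real
  assumes x: "\<bar>x\<bar> \<le> R" and M: "2 * R \<le> M" "0 < M" and c: "c \<noteq> 0"
  shows "\<bar>ln ((x + M)\<^sup>2 + c\<^sup>2) - ln ((x - M)\<^sup>2 + c\<^sup>2)\<bar> \<le> 16 * R / M"
proof -
  have *: "ln ((y + M)\<^sup>2 + c\<^sup>2) - ln ((y - M)\<^sup>2 + c\<^sup>2) \<le> 16 * R / M" if y: "\<bar>y\<bar> \<le> R" for y
  proof -
    define A D where "A = (y + M)\<^sup>2 + c\<^sup>2" and "D = (y - M)\<^sup>2 + c\<^sup>2"
    have pos: "A > 0" "D > 0" using c by (simp_all add: A_def D_def add_nonneg_pos)
    have "M / 2 \<le> M - y" using y M by linarith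
    then have "(M / 2)\<^sup>2 \<le> (M - y)\<^sup>2" using M by (intro power_mono) auto
    also have "\<dots> \<le> D" by (simp add: D_def power2_commute)
    finally have D: "M\<^sup>2 / 4 \<le> D" by (simp add: power_divide)
    have "ln A - ln D = ln (A / D)" using pos by (simp add: ln_div)
    also have "\<dots> \<le> A / D - 1" using pos by (intro ln_le_minus_one) simp
    also have "\<dots> = (A - D) / D" using pos by (simp add: diff_divide_distrib)
    also have "A - D = 4 * y * M" by (simp add: A_def D_def power2_eq_square algebra_simps)
    also have "4 * y * M / D \<le> 4 * R * M / D"
      using y M pos by (intro divide_right_mono mult_right_mono mult_left_mono) auto
    also have "\<dots> \<le> 4 * R * M / (M\<^sup>2 / 4)"
      using y M D pos by (intro divide_left_mono mult_pos_pos mult_nonneg_nonneg) auto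
    also have "\<dots> = 16 * R / M" using M by (simp add: power2_eq_square)
    finally show ?thesis by (simp add: A_def D_def)
  qed
  have "(- x + M)\<^sup>2 = (x - M)\<^sup>2" "(- x - M)\<^sup>2 = (x + M)\<^sup>2"
    by (simp_all add: power2_eq_square algebra_simps)
  then have "ln ((x - M)\<^sup>2 + c\<^sup>2) - ln ((x + M)\<^sup>2 + c\<^sup>2) \<le> 16 * R / M"
    using *[of "- x"] x by simp
  then show ?thesis using *[OF x] by linarith
qed

text \<open>For positive c the difference is arctan (c / p), which is at most c / p; negative c
  follows by oddness.\<close>

lemma arctan_sgn_bound:
  fixes p c :: real
  assumes p: "p > 0" and c: "c \<noteq> 0"
  shows "\<bar>pi / 2 * sgn c - arctan (p / c)\<bar> \<le> \<bar>c\<bar> / p"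
proof -
  have *: "\<bar>pi / 2 - arctan (p / d)\<bar> \<le> d / p" if d: "d > 0" for d
  proof -
    have "pi / 2 - arctan (p / d) = arctan (d / p)"
      using arctan_inverse[of "p / d"] p d by (simp add: inverse_eq_divide)
    then show ?thesis using abs_arctan_le[of "d / p"] p d by simp
  qed
  show ?thesis
  proof (cases "c > 0")
    case True
    then show ?thesis using *[of c] by simp
  next
    case False
    then have "c < 0" using c by simp
    then show ?thesis using *[of "- c"] by (simp add: arctan_minus abs_minus_commute)
  qed
qed

lemma cauchy_kernel_segment_bound:
  fixes a b c x M R :: real
  assumes x: "\<bar>x\<bar> \<le> R" and M: "2 * R \<le> M" "0 < M" and c: "c \<noteq> 0" "\<bar>c\<bar> \<le> 2 * R"
    and ab: "\<bar>a\<bar> \<le> C" "\<bar>b\<bar> \<le> C"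
  shows "\<bar>(\<integral>u. (b * (x - u) - a * c) / ((x - u)\<^sup>2 + c\<^sup>2) * indicator {-M..M} u \<partial>lborel)
    + a * pi * sgn c\<bar> \<le> 16 * C * R / M"
proof -
  define P where "P = ln ((x + M)\<^sup>2 + c\<^sup>2) - ln ((x - M)\<^sup>2 + c\<^sup>2)"
  define Q where "Q = pi * sgn c - (arctan ((M - x) / c) + arctan ((M + x) / c))"
  have C: "C \<ge> 0" using ab by linarith
  have R: "R \<ge> 0" using x by linarith
  have "\<bar>Q\<bar> \<le> \<bar>pi / 2 * sgn c - arctan ((M - x) / c)\<bar> + \<bar>pi / 2 * sgn c - arctan ((M + x) / c)\<bar>"
    unfolding Q_def by (simp add: algebra_simps)
  also have "\<dots> \<le> \<bar>c\<bar> / (M - x) + \<bar>c\<bar> / (M + x)"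
    using x M c by (intro add_mono arctan_sgn_bound) auto
  \<comment> \<open>Both M - x and M + x are at least M / 2.\<close>
  also have "\<dots> \<le> 2 * R / (M / 2) + 2 * R / (M / 2)"
    using x M c R by (intro add_mono frac_le) auto
  also have "\<dots> = 8 * R / M" by simp
  finally have Q: "\<bar>Q\<bar> \<le> 8 * R / M" .
  have P: "\<bar>P\<bar> \<le> 16 * R / M" unfolding P_def by (rule ln_quotient_bound[OF x M c(1)])
  have "(\<integral>u. (b * (x - u) - a * c) / ((x - u)\<^sup>2 + c\<^sup>2) * indicator {-M..M} u \<partial>lborel)
    + a * pi * sgn c = b * P / 2 + a * Q"
    using integral_cauchy_kernel_segment[OF c(1), of M b x a] M
    by (simp add: P_def Q_def algebra_simps)
  also have "\<bar>\<dots>\<bar> \<le> \<bar>b\<bar> * \<bar>P\<bar> / 2 + \<bar>a\<bar> * \<bar>Q\<bar>"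
    using abs_triangle_ineq[of "b * P / 2" "a * Q"] by (simp add: abs_mult)
  also have "\<dots> \<le> C * (16 * R / M) / 2 + C * (8 * R / M)"
    using P Q ab C by (intro add_mono divide_right_mono mult_mono) auto
  also have "\<dots> = 16 * C * R / M" by simp
  finally show ?thesis .
qed

text \<open>The integral is the length y + R below y minus the length R - y above it. This recovers
  the height of the curve point from a sign.\<close>

lemma integral_sgn_segment:
  fixes y R :: real
  assumes "\<bar>y\<bar> \<le> R"
  shows "has_bochner_integral lborel (\<lambda>v. sgn (y - v) * indicator {-R..R} v) (2 * y)"
proof -
  have "has_bochner_integral lborel (\<lambda>v. indicator {-R..y} v - indicator {y..R} v) (measure lborel {-R..y} - measure lborel {y..R})"
    by (intro has_bochner_integral_diff has_bochner_integral_real_indicator)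
      (auto simp: emeasure_lborel_Icc_eq)
  also have "measure lborel {-R..y} - measure lborel {y..R} = 2 * y"
    using assms by (simp add: abs_le_iff)
  finally have 1: "has_bochner_integral lborel (\<lambda>v. indicator {-R..y} v - indicator {y..R} v) (2 * y)" .
  show ?thesis
  proof (rule has_bochner_integralI_AE[OF 1])
    show "AE v in lborel. indicator {-R..y} v - indicator {y..R} v = sgn (y - v) * indicator {-R..R} v"
      by (rule AE_mp[OF AE_lborel_singleton[of y] AE_I2[OF impI]])
        (use assms in \<open>auto simp: indicator_def sgn_if\<close>)
  qed auto
qed

lemma Im_cauchy_kernel:
  "Im (d / (z - Complex u v)) =
    (Im d * (Re z - u) - Re d * (Im z - v)) / ((Re z - u)\<^sup>2 + (Im z - v)\<^sup>2)"
  by (simp add: Im_divide)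

text \<open>The winding number of the curve is integrated over the points \<open>(u, v)\<close> of the rectangle
  \<open>[-M, M] \<times> [-R, R]\<close>. After exchanging the order of integration, the integral over \<open>u\<close> is
  \<open>- \<pi> Re (G' t) sgn (Im (G t) - v) + O(1 / M)\<close>, and integrating the main term over \<open>v\<close> gives
  \<open>- 2 \<pi> Re (G' t) Im (G t)\<close>.\<close>

lemma area_integral_estimate:
  fixes G G' :: "real \<Rightarrow> complex"
  assumes meas [measurable]: "G \<in> borel_measurable borel" "G' \<in> borel_measurable borel"
    and GR: "\<And>t. norm (G t) \<le> R" and GC: "\<And>t. norm (G' t) \<le> C * indicator {0..1} t"
    and pos: "AE p in lborel. 0 \<le> (\<integral>t. Im (G' t / (G t - Complex (fst p) (snd p))) \<partial>lborel)"
    and M: "2 * R \<le> M" "0 < M"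
  shows "2 * pi * (\<integral>t. Re (G' t) * Im (G t) \<partial>lborel) \<le> 32 * C * R\<^sup>2 / M"
proof -
  have R: "R \<ge> 0" using GR[of 0] norm_ge_zero order_trans by blast
  have C: "C \<ge> 0" using order_trans[OF norm_ge_zero GC[of 0]] by simp
  define h :: "real \<times> real \<times> real \<Rightarrow> real" where
    "h = (\<lambda>(t, p). Im (G' t / (G t - Complex (fst p) (snd p))) *
      indicator {-M..M} (fst p) * indicator {-R..R} (snd p))"
  have "h \<in> borel_measurable (lborel \<Otimes>\<^sub>M (lborel \<Otimes>\<^sub>M lborel))"
    unfolding h_def Im_cauchy_kernel split_beta by measurable
  then have [measurable]: "h \<in> borel_measurable (lborel \<Otimes>\<^sub>M lborel)"
    by (simp only: lborel_prod)
  \<comment> \<open>A bound for the kernel integral that is the same for all t; it makes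
    \<open>h\<close> integrable on the product, as Fubini requires.\<close>
  define W where "W = (\<integral>\<^sup>+s. ennreal (1 / sqrt \<bar>s\<bar> * indicator {-(2*M)..2*M} s) \<partial>lborel) ^ 2"
  have W: "W < \<infinity>"
    unfolding W_def using nn_integral_inverse_sqrt_finite[of "2 * M"]
    by (simp add: ennreal_mult_less_top power2_eq_square)
  have inner: "(\<integral>\<^sup>+p. ennreal (norm (h (t, p))) \<partial>lborel) \<le> ennreal (C * indicator {0..1} t) * W" for t
  proof -
    let ?k = "\<lambda>p. indicator {-M..M} (fst p) * indicator {-M..M} (snd p) / norm (G t - Complex (fst p) (snd p))"
    have "norm (h (t, p)) \<le> (C * indicator {0..1} t) * ?k p" for p
    proof -
      have "norm (h (t, p)) \<le> norm (G' t / (G t - Complex (fst p) (snd p))) *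
          (indicator {-M..M} (fst p) * indicator {-M..M} (snd p))"
        unfolding h_def split_beta using M R abs_Im_le_cmod[of "G' t / (G t - Complex (fst p) (snd p))"]
        by (auto simp: abs_mult indicator_def)
      also have "\<dots> = norm (G' t) * ?k p" by (simp add: norm_divide)
      also have "\<dots> \<le> (C * indicator {0..1} t) * ?k p"
        by (intro mult_right_mono GC) simp
      finally show ?thesis .
    qed
    then have "(\<integral>\<^sup>+p. ennreal (norm (h (t, p))) \<partial>lborel) \<le>
        (\<integral>\<^sup>+p. ennreal (C * indicator {0..1} t) * ennreal (?k p) \<partial>lborel)"
      using C by (intro nn_integral_mono) (simp add: ennreal_mult[symmetric] ennreal_leI)
    also have "\<dots> = ennreal (C * indicator {0..1} t) *
        (\<integral>\<^sup>+p. ennreal (?k p) \<partial>lborel)"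
      by (rule nn_integral_cmult) (simp add: cmod_def borel_prod[symmetric])
    also have "\<dots> \<le> ennreal (C * indicator {0..1} t) * W"
      unfolding W_def using GR[of t] M R by (intro mult_left_mono nn_integral_cauchy_kernel_le[unfolded lborel_prod]) auto
    finally show ?thesis .
  qed
  have int_p: "integrable lborel (\<lambda>p. h (t, p))" for t
  proof (rule integrableI_bounded)
    show "(\<integral>\<^sup>+p. ennreal (norm (h (t, p))) \<partial>lborel) < \<infinity>"
      using inner[of t] W by (simp add: ennreal_mult_less_top le_less_trans)
  qed simp
  have int_h: "integrable (lborel \<Otimes>\<^sub>M lborel) h"
  proof (rule integrableI_bounded)
    have "(\<integral>\<^sup>+q. ennreal (norm (h q)) \<partial>(lborel \<Otimes>\<^sub>M lborel)) =
        (\<integral>\<^sup>+t. \<integral>\<^sup>+p. ennreal (norm (h (t, p))) \<partial>lborel \<partial>lborel)"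
      by (rule lborel.nn_integral_fst[symmetric]) simp
    also have "\<dots> \<le> (\<integral>\<^sup>+(t :: real). (ennreal C * W) * indicator {0..1} t \<partial>lborel)"
      by (rule nn_integral_mono, rule order_trans[OF inner]) (auto simp: indicator_def)
    also have "\<dots> = ennreal C * W" by (simp add: nn_integral_cmult_indicator)
    also have "\<dots> < \<infinity>" using W by (simp add: ennreal_mult_less_top)
    finally show "(\<integral>\<^sup>+q. ennreal (norm (h q)) \<partial>(lborel \<Otimes>\<^sub>M lborel)) < \<infinity>" .
  qed simp
  have "0 \<le> (\<integral>p. (\<integral>t. h (t, p) \<partial>lborel) \<partial>lborel)"
  proof (rule integral_nonneg_AE)
    show "AE p in lborel. 0 \<le> (\<integral>t. h (t, p) \<partial>lborel)"
      using pos
    proof eventually_elim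
      case (elim p)
      have "(\<integral>t. h (t, p) \<partial>lborel) = (\<integral>t. Im (G' t / (G t - Complex (fst p) (snd p))) \<partial>lborel) *
          (indicator {-M..M} (fst p) * indicator {-R..R} (snd p))"
        unfolding h_def prod.case mult.assoc by (rule Bochner_Integration.integral_mult_left_zero)
      then show ?case using elim by simp
    qed
  qed
  also have "(\<integral>p. (\<integral>t. h (t, p) \<partial>lborel) \<partial>lborel) = (\<integral>t. (\<integral>p. h (t, p) \<partial>lborel) \<partial>lborel)"
    using lborel_pair.Fubini_integral[of "\<lambda>t p. h (t, p)"] int_h by simp
  finally have I: "0 \<le> (\<integral>t. (\<integral>p. h (t, p) \<partial>lborel) \<partial>lborel)" .
  define H where "H t = (\<integral>p. h (t, p) \<partial>lborel)" for t
  have int_H: "integrable lborel H"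
    unfolding H_def[abs_def] by (rule lborel_pair.integrable_fst'[OF int_h])
  have H_bound: "\<bar>H t + 2 * pi * (Re (G' t) * Im (G t))\<bar> \<le> 32 * C * R\<^sup>2 / M * indicator {0..1} t" for t
  proof (cases "t \<in> {0..1}")
    case False
    then have "G' t = 0" using GC[of t] by simp
    then show ?thesis using False by (simp add: H_def h_def)
  next
    case True
    define x y a b where "x = Re (G t)" and "y = Im (G t)" and "a = Re (G' t)" and "b = Im (G' t)"
    have xy: "\<bar>x\<bar> \<le> R" "\<bar>y\<bar> \<le> R"
      using GR[of t] abs_Re_le_cmod[of "G t"] abs_Im_le_cmod[of "G t"] by (auto simp: x_def y_def)
    have ab: "\<bar>a\<bar> \<le> C" "\<bar>b\<bar> \<le> C"
      using GC[of t] True abs_Re_le_cmod[of "G' t"] abs_Im_le_cmod[of "G' t"] by (auto simp: a_def b_def)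
    define J where "J v = (\<integral>u. h (t, (u, v)) \<partial>lborel)" for v
    have int_p': "integrable (lborel \<Otimes>\<^sub>M lborel) (\<lambda>(u, v). h (t, (u, v)))"
      using int_p[of t] by (simp add: case_prod_beta' lborel_prod)
    have HJ: "H t = (\<integral>v. J v \<partial>lborel)"
      unfolding H_def J_def using lborel_pair.integral_snd[OF int_p'] by (simp add: case_prod_beta' lborel_prod)
    have int_J: "integrable lborel J"
      unfolding J_def[abs_def] by (rule lborel_pair.integrable_snd[OF int_p'])
    note sgn = integral_sgn_segment[OF xy(2)]
    define S where "S v = a * pi * (sgn (y - v) * indicator {-R..R} v)" for v
    have S: "has_bochner_integral lborel S (a * pi * (2 * y))"
      unfolding S_def[abs_def] by (intro has_bochner_integral_mult_right sgn)
    have JS: "AE v in lborel. norm (J v + S v) \<le> 16 * C * R / M * indicator {-R..R} v"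
    \<comment> \<open>At v = y the horizontal line may meet the pole of the kernel: there c = 0 and
      the segment estimate does not apply.\<close>
    proof (rule AE_mp[OF AE_lborel_singleton[of y] AE_I2[OF impI]])
      fix v assume v: "v \<noteq> y"
      show "norm (J v + S v) \<le> 16 * C * R / M * indicator {-R..R} v"
      proof (cases "v \<in> {-R..R}")
        case True
        have "J v = (\<integral>u. (b * (x - u) - a * (y - v)) / ((x - u)\<^sup>2 + (y - v)\<^sup>2) * indicator {-M..M} u \<partial>lborel)"
          using True unfolding J_def h_def prod.case Im_cauchy_kernel fst_conv snd_conv
          by (simp add: x_def y_def a_def b_def)
        moreover have "\<bar>y - v\<bar> \<le> 2 * R" using True xy by auto
        ultimately show ?thesis
          using cauchy_kernel_segment_bound[OF xy(1) M _ _ ab, of "y - v"] v True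
          by (simp add: S_def mult.assoc)
      next
        case False
        then show ?thesis by (simp add: J_def h_def S_def)
      qed
    qed
    have ind: "has_bochner_integral lborel (indicator {-R..R}) (measure lborel {-R..R})"
      by (intro has_bochner_integral_real_indicator) (auto simp: emeasure_lborel_Icc_eq)
    have "H t + 2 * pi * (a * y) = (\<integral>v. J v + S v \<partial>lborel)"
      unfolding HJ using int_J S by (simp add: has_bochner_integral_iff)
    also have "norm \<dots> \<le> (\<integral>v. norm (J v + S v) \<partial>lborel)"
      by (rule integral_norm_bound)
    also have "\<dots> \<le> (\<integral>v. 16 * C * R / M * indicator {-R..R} v \<partial>lborel)"
      using int_J S JS ind by (intro integral_mono_AE) (auto simp: has_bochner_integral_iff)
    \<comment> \<open>The error 16 C R / M per line is integrated over a strip of height 2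
      R.\<close>
    also have "\<dots> = 16 * C * R / M * (2 * R)"
      using ind R by (simp add: has_bochner_integral_iff)
    finally show ?thesis using True by (simp add: a_def y_def power2_eq_square mult_ac)
  qed
  have int_aY: "integrable lborel (\<lambda>t. Re (G' t) * Im (G t))"
  proof (rule Bochner_Integration.integrable_bound)
    show "integrable lborel (\<lambda>t. (C * R) * indicator {0..1::real} t :: real)"
      by (intro integrable_mult_right) (simp add: integrable_indicator_iff emeasure_lborel_Icc_eq)
    have "norm (Re (G' t) * Im (G t)) \<le> norm (C * R * indicator {0..1::real} t :: real)" for t
    proof -
      have "norm (Re (G' t) * Im (G t)) \<le> norm (G' t) * norm (G t)"
        unfolding real_norm_def abs_mult by (intro mult_mono abs_Re_le_cmod abs_Im_le_cmod) auto
      also have "\<dots> \<le> (C * indicator {0..1::real} t) * R" using GC GR C by (intro mult_mono) auto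
      finally show ?thesis using C R by (simp add: abs_mult mult_ac)
    qed
    then show "AE t in lborel. norm (Re (G' t) * Im (G t)) \<le> norm (C * R * indicator {0..1::real} t :: real)"
      by (intro AE_I2)
  qed simp
  have "(\<integral>t. H t \<partial>lborel) + 2 * pi * (\<integral>t. Re (G' t) * Im (G t) \<partial>lborel) =
      (\<integral>t. H t + 2 * pi * (Re (G' t) * Im (G t)) \<partial>lborel)"
    using int_H int_aY by simp
  also have "\<dots> \<le> (\<integral>t. 32 * C * R\<^sup>2 / M * indicator {0..1::real} t \<partial>lborel)"
  proof (rule integral_mono)
    show "integrable lborel (\<lambda>t. H t + 2 * pi * (Re (G' t) * Im (G t)))"
      using int_H int_aY by simp
    show "integrable lborel (\<lambda>t. 32 * C * R\<^sup>2 / M * indicator {0..1::real} t :: real)"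
      by (intro integrable_mult_right) (simp add: integrable_indicator_iff emeasure_lborel_Icc_eq)
    show "H t + 2 * pi * (Re (G' t) * Im (G t)) \<le> 32 * C * R\<^sup>2 / M * indicator {0..1::real} t" for t
      using H_bound[of t] by linarith
  qed
  also have "\<dots> = 32 * C * R\<^sup>2 / M" by simp
  finally show ?thesis using I by (simp add: H_def)
qed

lemma area_integral_nonpos:
  fixes G G' :: "real \<Rightarrow> complex"
  assumes "G \<in> borel_measurable borel" "G' \<in> borel_measurable borel"
    and "\<And>t. norm (G t) \<le> R" and "\<And>t. norm (G' t) \<le> C * indicator {0..1::real} t"
    and "AE p in lborel. 0 \<le> (\<integral>t. Im (G' t / (G t - Complex (fst p) (snd p))) \<partial>lborel)"
  shows "(\<integral>t. Re (G' t) * Im (G t) \<partial>lborel) \<le> 0"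
proof -
  let ?A = "2 * pi * (\<integral>t. Re (G' t) * Im (G t) \<partial>lborel)"
  have "eventually (\<lambda>M. ?A \<le> 32 * C * R\<^sup>2 / M) at_top"
    using eventually_ge_at_top[of "2 * R"] eventually_gt_at_top[of 0]
    by eventually_elim (rule area_integral_estimate[OF assms])
  moreover have "((\<lambda>M. 32 * C * R\<^sup>2 / M) \<longlongrightarrow> 0) at_top"
    by (intro tendsto_divide_0[OF tendsto_const] filterlim_at_top_imp_at_infinity filterlim_ident)
  ultimately have "?A \<le> 0" by (intro tendsto_lowerbound[where F = at_top]) auto
  then show ?thesis using pi_gt_zero by (auto simp: mult_le_0_iff)
qed

text \<open>With \<gamma> = x + i y the integrand has imaginary part x y' - y x', so the conclusion
  concerns twice the signed area. Since the curve is closed, x y' + x' y integrates to 0, and what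
  remains is -2 times the integral of x' y, whose sign is known from the averaged winding
  number.\<close>

lemma closed_curve_area_nonneg:
  fixes \<gamma> \<gamma>' :: "real \<Rightarrow> complex"
  assumes deriv: "\<And>t. t \<in> {0..1} \<Longrightarrow> (\<gamma> has_vector_derivative \<gamma>' t) (at t within {0..1})"
    and cont': "continuous_on {0..1} \<gamma>'"
    and closed: "\<gamma> 0 = \<gamma> 1"
    and winding: "\<And>w. w \<notin> \<gamma> ` {0..1} \<Longrightarrow> 0 \<le> Im (integral {0..1} (\<lambda>t. \<gamma>' t / (\<gamma> t - w)))"
  shows "0 \<le> Im (integral {0..1} (\<lambda>t. cnj (\<gamma> t) * \<gamma>' t))"
proof -
  have cont: "continuous_on {0..1} \<gamma>"
    using deriv by (meson continuous_on_eq_continuous_within has_vector_derivative_continuous)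
  \<comment> \<open>Extension by 0 turns integrals over [0, 1] into Lebesgue integrals over the
    line.\<close>
  define G G' where "G t = indicator {0..1} t *\<^sub>R \<gamma> t" and "G' t = indicator {0..1} t *\<^sub>R \<gamma>' t" for t
  obtain R where R: "\<And>t. t \<in> {0..1} \<Longrightarrow> norm (\<gamma> t) \<le> R" "R > 0"
    using compact_imp_bounded[OF compact_continuous_image[OF cont compact_Icc]]
    unfolding bounded_pos by force
  obtain C where C: "\<And>t. t \<in> {0..1} \<Longrightarrow> norm (\<gamma>' t) \<le> C" "C > 0"
    using compact_imp_bounded[OF compact_continuous_image[OF cont' compact_Icc]]
    unfolding bounded_pos by force
  have "(\<integral>t. Re (G' t) * Im (G t) \<partial>lborel) \<le> 0"
  proof (rule area_integral_nonpos)
    show "G \<in> borel_measurable borel" "G' \<in> borel_measurable borel"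
      unfolding G_def[abs_def] G'_def[abs_def]
      by (intro borel_measurable_continuous_on_indicator cont cont'; simp)+
    show "norm (G t) \<le> R" "norm (G' t) \<le> C * indicator {0..1} t" for t
      using R C by (auto simp: G_def G'_def indicator_def)
    define S where "S = (\<lambda>t. (Re (\<gamma> t), Im (\<gamma> t))) ` {0..1}"
    have "(\<lambda>t. (Re (\<gamma> t), Im (\<gamma> t))) differentiable_on {0..1}"
      unfolding differentiable_on_def
    proof
      fix t :: real assume t: "t \<in> {0..1}"
      have "(\<gamma> has_derivative (\<lambda>h. h *\<^sub>R \<gamma>' t)) (at t within {0..1})"
        using deriv[OF t] by (simp add: has_vector_derivative_def)
      then have "((\<lambda>t. (Re (\<gamma> t), Im (\<gamma> t))) has_derivative
          (\<lambda>h. (Re (h *\<^sub>R \<gamma>' t), Im (h *\<^sub>R \<gamma>' t)))) (at t within {0..1})"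
        by (intro has_derivative_Pair has_derivative_Re has_derivative_Im)
      then show "(\<lambda>t. (Re (\<gamma> t), Im (\<gamma> t))) differentiable at t within {0..1}"
        by (rule differentiableI)
    qed
    \<comment> \<open>A differentiable image of a one-dimensional set is null in the plane, so the
      winding hypothesis, stated off the curve, holds almost everywhere.\<close>
    then have "negligible S"
      unfolding S_def by (intro negligible_differentiable_image_lowdim) auto
    moreover have "compact S"
      unfolding S_def by (intro compact_continuous_image continuous_intros cont) auto
    then have "S \<in> sets lborel" by (simp add: borel_compact)
    ultimately have S: "S \<in> null_sets lborel"
      by (simp add: negligible_iff_null_sets null_sets_completion_iff)
    have main: "0 \<le> (\<integral>t. Im (G' t / (G t - Complex (fst p) (snd p))) \<partial>lborel)" if p: "p \<notin> S" for p
    proof -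
      let ?w = "Complex (fst p) (snd p)"
      have w: "?w \<notin> \<gamma> ` {0..1}"
      proof
        assume "?w \<in> \<gamma> ` {0..1}"
        then obtain t where "t \<in> {0..1}" "?w = \<gamma> t" by auto
        then have "p = (Re (\<gamma> t), Im (\<gamma> t))" by (metis complex.sel prod.collapse)
        with \<open>t \<in> {0..1}\<close> p show False by (auto simp: S_def)
      qed
      have c: "continuous_on {0..1} (\<lambda>t. \<gamma>' t / (\<gamma> t - ?w))"
        using w by (intro continuous_intros cont cont') (metis eq_iff_diff_eq_0 image_eqI)
      have "(\<integral>t. Im (G' t / (G t - ?w)) \<partial>lborel) =
          set_lebesgue_integral lborel {0..1} (\<lambda>t. Im (\<gamma>' t / (\<gamma> t - ?w)))"
        unfolding set_lebesgue_integral_def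
        by (rule Bochner_Integration.integral_cong) (auto simp: G_def G'_def indicator_def)
      also have "\<dots> = integral {0..1} (\<lambda>t. Im (\<gamma>' t / (\<gamma> t - ?w)))"
        by (intro set_borel_integral_eq_integral borel_integrable_atLeastAtMost'
            continuous_on_Im c)
      also have "\<dots> = Im (integral {0..1} (\<lambda>t. \<gamma>' t / (\<gamma> t - ?w)))"
        by (rule integral_unique[OF has_integral_Im[OF integrable_integral[OF integrable_continuous_real[OF c]]]])
      finally show ?thesis using winding[OF w] by simp
    qed
    show "AE p in lborel. 0 \<le> (\<integral>t. Im (G' t / (G t - Complex (fst p) (snd p))) \<partial>lborel)"
      using AE_not_in[OF S] main by (rule eventually_mono)
  qed
  also have "(\<integral>t. Re (G' t) * Im (G t) \<partial>lborel) =
      set_lebesgue_integral lborel {0..1} (\<lambda>t. Re (\<gamma>' t) * Im (\<gamma> t))"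
    unfolding set_lebesgue_integral_def
    by (rule Bochner_Integration.integral_cong) (auto simp: G_def G'_def indicator_def)
  also have "\<dots> = integral {0..1} (\<lambda>t. Re (\<gamma>' t) * Im (\<gamma> t))"
    by (intro set_borel_integral_eq_integral borel_integrable_atLeastAtMost' continuous_intros cont cont')
  finally have le: "integral {0..1} (\<lambda>t. Re (\<gamma>' t) * Im (\<gamma> t)) \<le> 0" .
  have i1: "(\<lambda>t. Re (\<gamma>' t) * Im (\<gamma> t)) integrable_on {0..1}"
    by (intro integrable_continuous_real continuous_intros cont cont')
  have "((\<lambda>t. Re (\<gamma>' t) * Im (\<gamma> t) + Re (\<gamma> t) * Im (\<gamma>' t)) has_integral
      Re (\<gamma> 1) * Im (\<gamma> 1) - Re (\<gamma> 0) * Im (\<gamma> 0)) {0..1}"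
  proof (rule fundamental_theorem_of_calculus)
    fix t :: real assume t: "t \<in> {0..1}"
    have d: "((\<lambda>t. Re (\<gamma> t)) has_vector_derivative Re (\<gamma>' t)) (at t within {0..1})"
        "((\<lambda>t. Im (\<gamma> t)) has_vector_derivative Im (\<gamma>' t)) (at t within {0..1})"
      using bounded_linear.has_vector_derivative[OF bounded_linear_Re deriv[OF t]]
        bounded_linear.has_vector_derivative[OF bounded_linear_Im deriv[OF t]] by simp_all
    show "((\<lambda>t. Re (\<gamma> t) * Im (\<gamma> t)) has_vector_derivative
        Re (\<gamma>' t) * Im (\<gamma> t) + Re (\<gamma> t) * Im (\<gamma>' t)) (at t within {0..1})"
      using has_vector_derivative_mult[OF d] by (simp add: add.commute)
  qed simp
  then have hi: "((\<lambda>t. Re (\<gamma>' t) * Im (\<gamma> t) + Re (\<gamma> t) * Im (\<gamma>' t)) has_integral 0) {0..1}"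
    using closed by simp
  have c: "continuous_on {0..1} (\<lambda>t. cnj (\<gamma> t) * \<gamma>' t)"
    by (intro continuous_intros cont cont')
  have "Im (integral {0..1} (\<lambda>t. cnj (\<gamma> t) * \<gamma>' t)) = integral {0..1} (\<lambda>t. Im (cnj (\<gamma> t) * \<gamma>' t))"
    by (rule integral_unique[OF has_integral_Im[OF integrable_integral[OF integrable_continuous_real[OF c]]], symmetric])
  also have "(\<lambda>t. Im (cnj (\<gamma> t) * \<gamma>' t)) = (\<lambda>t. (Re (\<gamma>' t) * Im (\<gamma> t) + Re (\<gamma> t) * Im (\<gamma>' t))
      - 2 * (Re (\<gamma>' t) * Im (\<gamma> t)))"
    by (simp add: algebra_simps)
  also have "integral {0..1} \<dots> = 0 - 2 * integral {0..1} (\<lambda>t. Re (\<gamma>' t) * Im (\<gamma> t))"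
    by (rule integral_unique, rule has_integral_diff[OF hi], rule has_integral_mult_right)
      (rule integrable_integral[OF i1])
  finally show ?thesis using le by simp
qed

section \<open>The area inequality for polynomials of an injective function\<close>

text \<open>Since \<open>t = 1 / z\<close>, the circle is traversed clockwise in \<open>t\<close> so that \<open>z\<close> runs counterclockwise.\<close>

definition clockwise_circle :: "real \<Rightarrow> real \<Rightarrow> complex" where
  "clockwise_circle r \<tau> = of_real r * exp (- (2 * of_real pi * \<i> * of_real \<tau>))"

lemma clockwise_circle_eq: "clockwise_circle r = reversepath (circlepath 0 r)"
proof
  fix \<tau>
  have "exp (2 * of_real pi * \<i> * of_real (1 - \<tau>)) = exp (2 * of_real pi * \<i>) * exp (- (2 * of_real pi * \<i> * of_real \<tau>))"
    unfolding exp_add[symmetric] by (simp add: algebra_simps)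
  also have "\<dots> = exp (- (2 * of_real pi * \<i> * of_real \<tau>))"
    by simp
  finally show "clockwise_circle r \<tau> = reversepath (circlepath 0 r) \<tau>"
    by (simp add: clockwise_circle_def reversepath_def circlepath)
qed

lemma norm_clockwise_circle [simp]: "norm (clockwise_circle r \<tau>) = \<bar>r\<bar>"
  by (simp add: clockwise_circle_def norm_mult)

lemma has_vector_derivative_clockwise_circle:
  "(clockwise_circle r has_vector_derivative - (2 * of_real pi * \<i>) * clockwise_circle r \<tau>) (at \<tau> within A)"
proof -
  have "((\<lambda>z. of_real r * exp (- (2 * of_real pi * \<i> * z))) has_field_derivative
      - (2 * of_real pi * \<i>) * clockwise_circle r \<tau>) (at (of_real \<tau>))"
    unfolding clockwise_circle_def by (auto intro!: derivative_eq_intros)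
  from has_vector_derivative_real_field[OF this] show ?thesis
    by (simp add: clockwise_circle_def[abs_def])
qed

lemma continuous_on_clockwise_circle [continuous_intros]:
  "continuous_on A (clockwise_circle r)"
  unfolding clockwise_circle_def[abs_def] by (intro continuous_intros)

lemma has_integral_clockwise_circle:
  assumes "(h has_contour_integral c) (circlepath 0 r)"
  shows "((\<lambda>\<tau>. h (clockwise_circle r \<tau>) * (- (2 * of_real pi * \<i>) * clockwise_circle r \<tau>)) has_integral - c) {0..1}"
proof -
  have "(h has_contour_integral - c) (clockwise_circle r)"
    unfolding clockwise_circle_eq using assms by (intro has_contour_integral_reversepath) auto
  then have "((\<lambda>\<tau>. h (clockwise_circle r \<tau>) * vector_derivative (clockwise_circle r) (at \<tau>)) has_integral - c) {0..1}"
    unfolding has_contour_integral .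
  moreover have "vector_derivative (clockwise_circle r) (at \<tau>) = - (2 * of_real pi * \<i>) * clockwise_circle r \<tau>" for \<tau>
    by (rule vector_derivative_at[OF has_vector_derivative_clockwise_circle])
  ultimately show ?thesis by simp
qed

section \<open>Winding numbers of the curves P (g z)\<close>

context laurent_at_infinity
begin

text \<open>This is g (1 / t) on the punctured disc, where the pole of g at infinity becomes a
  simple pole at 0.\<close>

definition g_inv_arg :: "complex \<Rightarrow> complex" where
  "g_inv_arg t = k t / t"

definition g_inv_arg' :: "complex \<Rightarrow> complex" where
  "g_inv_arg' t = (eval_fps (fps_deriv K) t * t - k t) / t ^ 2"

lemma K'_radius: "1 \<le> fps_conv_radius (fps_deriv K)"
  by (rule order_trans[OF K_radius fps_conv_radius_deriv])

lemma has_field_derivative_k: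
  assumes "norm t < 1"
  shows "(k has_field_derivative eval_fps (fps_deriv K) t) (at t within A)"
  by (rule has_field_derivative_eval_fps[OF radiusI[OF assms K_radius]])

lemma holomorphic_k: "k holomorphic_on ball 0 1" "eval_fps (fps_deriv K) holomorphic_on ball 0 1"
  by (rule holomorphic_on_eval_fps; use radiusI K_radius K'_radius in force)+

lemma has_field_derivative_g_inv_arg:
  assumes "norm t < 1" "t \<noteq> 0"
  shows "(g_inv_arg has_field_derivative g_inv_arg' t) (at t within A)"
  unfolding g_inv_arg_def[abs_def] g_inv_arg'_def
  using DERIV_divide[OF has_field_derivative_k[OF assms(1)] DERIV_ident assms(2)]
  by (simp add: power2_eq_square)

lemma g_inv_arg_inj:
  assumes inj: "inj_on g {z. norm z > 1}"
  shows "inj_on g_inv_arg (ball 0 1 - {0})"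
proof (rule inj_onI)
  fix s t assume st: "s \<in> ball 0 1 - {0}" "t \<in> ball 0 1 - {0}" "g_inv_arg s = g_inv_arg t"
  have *: "g (1 / x) = g_inv_arg x \<and> norm (1 / x) > 1" if "x \<in> ball 0 1 - {0}" for x
  proof -
    have n: "norm (1 / x) > 1" using that by (simp add: norm_divide divide_simps)
    show ?thesis using n g_eq[OF n] by (simp add: g_inv_arg_def)
  qed
  have "1 / s = 1 / t"
    by (rule inj_onD[OF inj]) (use *[OF st(1)] *[OF st(2)] st(3) in auto)
  then show "s = t" by simp
qed

text \<open>\<open>D t\<close> is t (g (1 / t) - w). Its zeros are the preimages of w: at most one
  by injectivity, and a simple one because an injective holomorphic function has nonzero derivative.
  Hence D' / D integrates to 2 pi i Z with Z = 0 or Z = 1. Dividing D by t subtracts 1, and the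
  clockwise direction changes the sign, leaving 1 - Z.\<close>

lemma log_derivative_circle_integral:
  assumes inj: "inj_on g {z. norm z > 1}" and r: "0 < r" "r < 1"
    and w: "\<And>t. norm t = r \<Longrightarrow> g_inv_arg t \<noteq> w"
  shows "\<exists>c\<ge>0. ((\<lambda>\<tau>. g_inv_arg' (clockwise_circle r \<tau>) / (g_inv_arg (clockwise_circle r \<tau>) - w) *
      (- (2 * of_real pi * \<i>) * clockwise_circle r \<tau>)) has_integral 2 * of_real pi * \<i> * of_real c) {0..1}"
proof -
  define D where "D t = k t - w * t" for t
  define D' where "D' t = eval_fps (fps_deriv K) t - w" for t
  have dD: "(D has_field_derivative D' t) (at t within A)" if "norm t < 1" for t A
    unfolding D_def[abs_def] D'_def
    by (rule DERIV_diff[OF has_field_derivative_k[OF that] DERIV_cmult_Id])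
  have holD: "D holomorphic_on ball 0 1" "D' holomorphic_on ball 0 1"
    unfolding D_def[abs_def] D'_def[abs_def] by (intro holomorphic_intros holomorphic_k)+
  have D0: "D 0 = 1" by (simp add: D_def eval_fps_at_0 K0)
  have sub: "cball 0 r \<subseteq> ball (0 :: complex) 1" using r by auto
  have Dnz: "D t \<noteq> 0" if "norm t = r" for t
    using w[OF that] that r by (auto simp: D_def g_inv_arg_def)
  have zero_g: "t \<noteq> 0 \<and> g_inv_arg t = w" if "D t = 0" for t
    using that D0 by (cases "t = 0") (auto simp: D_def g_inv_arg_def)
  have nz_int: "((\<lambda>t. E' t / E t) has_contour_integral 0) (circlepath 0 r)"
    if "E holomorphic_on ball 0 1" "E' holomorphic_on ball 0 1" "\<And>t. t \<in> cball 0 r \<Longrightarrow> E t \<noteq> 0" for E E' :: "complex \<Rightarrow> complex"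
  proof (rule Cauchy_theorem_convex_simple)
    show "(\<lambda>t. E' t / E t) holomorphic_on cball 0 r"
      using that sub by (intro holomorphic_intros) (auto elim: holomorphic_on_subset)
  qed (use r in auto)
  have inv_int: "((\<lambda>t. 1 / (t - a)) has_contour_integral 2 * of_real pi * \<i>) (circlepath 0 r)" if "norm a < r" for a
    using Cauchy_integral_circlepath_simple[of "\<lambda>_. 1" 0 r a] that by simp
  have DD: "\<exists>Z\<in>{0, 1}. ((\<lambda>t. D' t / D t) has_contour_integral (2 * of_real pi * \<i>) * Z) (circlepath 0 r)"
  proof (cases "\<exists>a\<in>cball 0 r. D a = 0")
    case False
    then show ?thesis using nz_int[OF holD] by auto
  next
    case True
    then obtain a where a: "norm a \<le> r" "D a = 0" by auto
    then have ar: "norm a < r" using Dnz[of a] by force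
    have aB: "a \<in> ball 0 1" using ar r by auto
    note za = zero_g[OF a(2)]
    \<comment> \<open>\<open>m\<close> is D with its zero divided out; it is holomorphic and has no
      zero on the closed disc, so its logarithmic derivative integrates to 0.\<close>
    define m where "m t = (if t = a then deriv D a else (D t - D a) / (t - a))" for t
    have holm: "m holomorphic_on ball 0 1"
      unfolding m_def[abs_def] by (rule pole_lemma_open) (auto intro: holD)
    have "deriv g_inv_arg a \<noteq> 0"
    proof (rule holomorphic_injective_imp_regular)
      show "g_inv_arg holomorphic_on ball 0 1 - {0}"
        unfolding g_inv_arg_def[abs_def] by (intro holomorphic_intros holomorphic_on_subset[OF holomorphic_k(1)]) auto
    qed (use g_inv_arg_inj[OF inj] aB za in auto)
    moreover have "deriv g_inv_arg a = g_inv_arg' a"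
      using has_field_derivative_g_inv_arg[of a UNIV] aB za by (intro DERIV_imp_deriv) auto
    moreover have "g_inv_arg' a = D' a / a"
      using za by (auto simp: g_inv_arg'_def g_inv_arg_def D'_def power2_eq_square field_simps)
    ultimately have "D' a \<noteq> 0" by auto
    then have "m a \<noteq> 0" using DERIV_imp_deriv[OF dD[of a UNIV]] aB by (simp add: m_def)
    moreover have "m t \<noteq> 0" if "t \<in> cball 0 r" "t \<noteq> a" for t
    proof -
      have "D t \<noteq> 0"
      proof
        assume "D t = 0"
        from zero_g[OF this] za have "g_inv_arg t = g_inv_arg a" "t \<in> ball 0 1 - {0}" "a \<in> ball 0 1 - {0}"
          using that sub aB by auto
        then show False using g_inv_arg_inj[OF inj] that by (auto dest: inj_onD)
      qed
      then show ?thesis using that a by (simp add: m_def)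
    qed
    ultimately have mnz: "m t \<noteq> 0" if "t \<in> cball 0 r" for t using that by blast
    have holm': "deriv m holomorphic_on ball 0 1" using holm by (intro holomorphic_deriv) auto
    have "((\<lambda>t. 1 / (t - a) + deriv m t / m t) has_contour_integral 2 * of_real pi * \<i> + 0) (circlepath 0 r)"
      by (intro has_contour_integral_add inv_int ar nz_int holm holm' mnz)
    moreover have "1 / (t - a) + deriv m t / m t = D' t / D t" if "t \<in> path_image (circlepath 0 r)" for t
    proof -
      have t: "norm t = r" using that r by auto
      have ta: "t \<noteq> a" using t ar by auto
      have tB: "t \<in> ball 0 1" using t r by auto
      have Dm: "D x = (x - a) * m x" for x using a by (auto simp: m_def)
      have "((\<lambda>x. (x - a) * m x) has_field_derivative (1 - 0) * m t + deriv m t * (t - a)) (at t)"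
        using tB by (intro DERIV_mult DERIV_diff DERIV_ident DERIV_const holomorphic_derivI[OF holm]) auto
      moreover have "(\<lambda>x. (x - a) * m x) = D" using Dm by auto
      ultimately have "D' t = m t + deriv m t * (t - a)"
        using DERIV_unique[of D _ t "D' t"] dD[of t UNIV] tB by auto
      moreover have "m t \<noteq> 0" using mnz[of t] t by simp
      ultimately show ?thesis using ta by (simp add: Dm field_simps)
    qed
    ultimately have "((\<lambda>t. D' t / D t) has_contour_integral 2 * of_real pi * \<i> + 0) (circlepath 0 r)"
      by (rule has_contour_integral_eq)
    then show ?thesis by auto
  qed
  then obtain Z where Z: "Z \<in> {0, 1}" "((\<lambda>t. D' t / D t) has_contour_integral (2 * of_real pi * \<i>) * Z) (circlepath 0 r)"
    by blast
  have "((\<lambda>t. D' t / D t - 1 / (t - 0)) has_contour_integral (2 * of_real pi * \<i>) * Z - 2 * of_real pi * \<i>) (circlepath 0 r)"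
    using r by (intro has_contour_integral_diff Z inv_int) auto
  moreover have "D' t / D t - 1 / (t - 0) = g_inv_arg' t / (g_inv_arg t - w)" if "t \<in> path_image (circlepath 0 r)" for t
  proof -
    have t: "norm t = r" using that r by auto
    have t0: "t \<noteq> 0" using t r by auto
    have e1: "g_inv_arg t - w = D t / t" using t0 by (simp add: g_inv_arg_def D_def field_simps)
    have e2: "g_inv_arg' t = (D' t * t - D t) / t ^ 2" by (simp add: g_inv_arg'_def D'_def D_def algebra_simps)
    show ?thesis unfolding e1 e2 using t0 Dnz[OF t] by (simp add: field_simps power2_eq_square)
  qed
  ultimately have "((\<lambda>t. g_inv_arg' t / (g_inv_arg t - w)) has_contour_integral (2 * of_real pi * \<i>) * Z - 2 * of_real pi * \<i>) (circlepath 0 r)"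
    by (rule has_contour_integral_eq)
  note int = has_integral_clockwise_circle[OF this]
  \<comment> \<open>No zero of \<open>D\<close> with |t| < r means that w is enclosed, with winding
    number 1; if there is a zero, w lies outside the curve.\<close>
  from Z(1) consider "Z = 0" | "Z = 1" by blast
  then show ?thesis
  proof cases
    case 1
    with int show ?thesis by (intro exI[of _ 1]) simp
  next
    case 2
    with int show ?thesis by (intro exI[of _ 0]) simp
  qed
qed

lemma poly_log_derivative_circle_integral:
  assumes inj: "inj_on g {z. norm z > 1}" and r: "0 < r" "r < 1"
    and nz: "\<And>t. norm t = r \<Longrightarrow> poly q (g_inv_arg t) \<noteq> 0"
  shows "\<exists>c\<ge>0. ((\<lambda>\<tau>. poly (pderiv q) (g_inv_arg (clockwise_circle r \<tau>)) * g_inv_arg' (clockwise_circle r \<tau>) /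
      poly q (g_inv_arg (clockwise_circle r \<tau>)) *
      (- (2 * of_real pi * \<i>) * clockwise_circle r \<tau>)) has_integral 2 * of_real pi * \<i> * of_real c) {0..1}"
  using nz
proof (induction "degree q" arbitrary: q rule: less_induct)
  case less
  show ?case
  proof (cases "degree q = 0")
    case True
    then obtain a where "q = [:a:]" by (elim degree_eq_zeroE)
    then show ?thesis by (auto simp: pderiv_pCons intro!: exI[of _ 0])
  next
    case False
    then have "\<not> constant (poly q)" by (simp add: constant_degree)
    then obtain a where "poly q a = 0" using fundamental_theorem_of_algebra by blast
    then obtain q1 where q: "q = [:- a, 1:] * q1" unfolding poly_eq_0_iff_dvd by (elim dvdE)
    have "q1 \<noteq> 0" using q False by auto
    then have "degree q = Suc (degree q1)" unfolding q by (subst degree_mult_eq) auto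
    moreover have nz1: "g_inv_arg t \<noteq> a" "poly q1 (g_inv_arg t) \<noteq> 0" if "norm t = r" for t
      using less(2)[OF that] by (auto simp: q)
    ultimately obtain c1 where c1: "c1 \<ge> 0" "((\<lambda>\<tau>. poly (pderiv q1) (g_inv_arg (clockwise_circle r \<tau>)) * g_inv_arg' (clockwise_circle r \<tau>) /
      poly q1 (g_inv_arg (clockwise_circle r \<tau>)) *
      (- (2 * of_real pi * \<i>) * clockwise_circle r \<tau>)) has_integral 2 * of_real pi * \<i> * of_real c1) {0..1}"
      using less(1)[of q1] by auto
    obtain c2 where c2: "c2 \<ge> 0" "((\<lambda>\<tau>. g_inv_arg' (clockwise_circle r \<tau>) / (g_inv_arg (clockwise_circle r \<tau>) - a) *
      (- (2 * of_real pi * \<i>) * clockwise_circle r \<tau>)) has_integral 2 * of_real pi * \<i> * of_real c2) {0..1}"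
      using log_derivative_circle_integral[OF inj r nz1(1)] by blast
    have "poly (pderiv q) y * d / poly q y * e = poly (pderiv q1) y * d / poly q1 y * e + d / (y - a) * e"
      if "y \<noteq> a" "poly q1 y \<noteq> 0" for y d e
    proof -
      have e: "poly (pderiv q) y = poly q1 y + (y - a) * poly (pderiv q1) y" "poly q y = (y - a) * poly q1 y"
        unfolding q pderiv_mult by (simp_all add: pderiv_pCons algebra_simps)
      show ?thesis unfolding e using that by (simp add: field_simps)
    qed
    then have "poly (pderiv q) (g_inv_arg (clockwise_circle r \<tau>)) * g_inv_arg' (clockwise_circle r \<tau>) /
      poly q (g_inv_arg (clockwise_circle r \<tau>)) * (- (2 * of_real pi * \<i>) * clockwise_circle r \<tau>) =
      poly (pderiv q1) (g_inv_arg (clockwise_circle r \<tau>)) * g_inv_arg' (clockwise_circle r \<tau>) /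
      poly q1 (g_inv_arg (clockwise_circle r \<tau>)) * (- (2 * of_real pi * \<i>) * clockwise_circle r \<tau>) +
      g_inv_arg' (clockwise_circle r \<tau>) / (g_inv_arg (clockwise_circle r \<tau>) - a) * (- (2 * of_real pi * \<i>) * clockwise_circle r \<tau>)" for \<tau>
      using nz1[of "clockwise_circle r \<tau>"] r by simp
    then have "((\<lambda>\<tau>. poly (pderiv q) (g_inv_arg (clockwise_circle r \<tau>)) * g_inv_arg' (clockwise_circle r \<tau>) /
      poly q (g_inv_arg (clockwise_circle r \<tau>)) * (- (2 * of_real pi * \<i>) * clockwise_circle r \<tau>)) has_integral
      2 * of_real pi * \<i> * of_real c1 + 2 * of_real pi * \<i> * of_real c2) {0..1}"
      using has_integral_add[OF c1(2) c2(2)] by simp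
    then show ?thesis using c1(1) c2(1)
      by (intro exI[of _ "c1 + c2"]) (simp add: algebra_simps)
  qed
qed

lemma poly_curve_area_nonneg:
  assumes inj: "inj_on g {z. norm z > 1}" and r: "0 < r" "r < 1"
  shows "0 \<le> Im (integral {0..1} (\<lambda>\<tau>. cnj (poly P (g_inv_arg (clockwise_circle r \<tau>))) *
    (poly (pderiv P) (g_inv_arg (clockwise_circle r \<tau>)) * g_inv_arg' (clockwise_circle r \<tau>) *
      (- (2 * of_real pi * \<i>) * clockwise_circle r \<tau>))))"
proof (rule closed_curve_area_nonneg)
  let ?c = "clockwise_circle r"
  have nz: "?c \<tau> \<noteq> 0" "norm (?c \<tau>) < 1" for \<tau>
    using r norm_clockwise_circle[of r \<tau>] by (auto simp del: norm_clockwise_circle)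
  fix t :: real
  have "((\<lambda>x. poly P (g_inv_arg x)) has_field_derivative poly (pderiv P) (g_inv_arg (?c t)) * g_inv_arg' (?c t)) (at (?c t))"
    by (rule DERIV_chain2[OF poly_DERIV has_field_derivative_g_inv_arg[OF nz(2,1)]])
  from field_vector_diff_chain_within[OF has_vector_derivative_clockwise_circle has_field_derivative_at_within[OF this]]
  show "((\<lambda>\<tau>. poly P (g_inv_arg (?c \<tau>))) has_vector_derivative
      poly (pderiv P) (g_inv_arg (?c t)) * g_inv_arg' (?c t) * (- (2 * of_real pi * \<i>) * ?c t)) (at t within {0..1})"
    by (simp add: o_def mult_ac)
next
  let ?c = "clockwise_circle r"
  have nz: "?c \<tau> \<noteq> 0" "norm (?c \<tau>) < 1" for \<tau>
    using r norm_clockwise_circle[of r \<tau>] by (auto simp del: norm_clockwise_circle)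
  have im: "?c ` {0..1} \<subseteq> ball 0 1" using nz by auto
  note ck = continuous_on_compose2[OF holomorphic_on_imp_continuous_on[OF holomorphic_k(1)] continuous_on_clockwise_circle im]
    continuous_on_compose2[OF holomorphic_on_imp_continuous_on[OF holomorphic_k(2)] continuous_on_clockwise_circle im]
  show "continuous_on {0..1} (\<lambda>\<tau>. poly (pderiv P) (g_inv_arg (?c \<tau>)) * g_inv_arg' (?c \<tau>) *
      (- (2 * of_real pi * \<i>) * ?c \<tau>))"
    unfolding g_inv_arg_def g_inv_arg'_def
    by (intro continuous_on_mult continuous_on_poly continuous_on_divide continuous_on_diff
        continuous_on_power ck continuous_on_const continuous_on_clockwise_circle) (use nz in auto)
next
  show "poly P (g_inv_arg (clockwise_circle r 0)) = poly P (g_inv_arg (clockwise_circle r 1))"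
    by (simp add: clockwise_circle_def exp_minus)
next
  fix w assume w: "w \<notin> (\<lambda>\<tau>. poly P (g_inv_arg (clockwise_circle r \<tau>))) ` {0..1}"
  \<comment> \<open>The parametrisation covers the whole circle, so a point w off the curve leaves P
    - w without zeros on it.\<close>
  have "poly (P - [:w:]) (g_inv_arg t) \<noteq> 0" if t: "norm t = r" for t
  proof -
    have "t \<in> path_image (clockwise_circle r)"
      unfolding clockwise_circle_eq path_image_reversepath using t r by auto
    then show ?thesis using w by (auto simp: path_image_def)
  qed
  from poly_log_derivative_circle_integral[OF inj r this]
  obtain c where c: "c \<ge> 0" "((\<lambda>\<tau>. poly (pderiv (P - [:w:])) (g_inv_arg (clockwise_circle r \<tau>)) * g_inv_arg' (clockwise_circle r \<tau>) /
      poly (P - [:w:]) (g_inv_arg (clockwise_circle r \<tau>)) *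
      (- (2 * of_real pi * \<i>) * clockwise_circle r \<tau>)) has_integral 2 * of_real pi * \<i> * of_real c) {0..1}"
    by blast
  then have "integral {0..1} (\<lambda>\<tau>. poly (pderiv P) (g_inv_arg (clockwise_circle r \<tau>)) * g_inv_arg' (clockwise_circle r \<tau>) *
      (- (2 * of_real pi * \<i>) * clockwise_circle r \<tau>) / (poly P (g_inv_arg (clockwise_circle r \<tau>)) - w)) =
      2 * of_real pi * \<i> * of_real c"
    by (intro integral_unique) (simp add: pderiv_diff pderiv_pCons)
  then show "0 \<le> Im (integral {0..1} (\<lambda>\<tau>. poly (pderiv P) (g_inv_arg (clockwise_circle r \<tau>)) * g_inv_arg' (clockwise_circle r \<tau>) *
      (- (2 * of_real pi * \<i>) * clockwise_circle r \<tau>) / (poly P (g_inv_arg (clockwise_circle r \<tau>)) - w)))"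
    using c(1) by simp
qed

end

section \<open>Orthogonality of exponentials and Parseval for finite sums\<close>

definition trig :: "int \<Rightarrow> real \<Rightarrow> complex" where
  "trig j \<tau> = exp (2 * of_real pi * \<i> * of_int j * of_real \<tau>)"

lemma trig_add: "trig (i + j) \<tau> = trig i \<tau> * trig j \<tau>"
  by (simp add: trig_def exp_add[symmetric] algebra_simps)

lemma cnj_trig: "cnj (trig j \<tau>) = trig (- j) \<tau>"
  by (simp add: trig_def exp_cnj)

lemma trig_of_nat: "trig (int n) \<tau> = trig 1 \<tau> ^ n" "trig (- int n) \<tau> = trig (-1) \<tau> ^ n"
  by (simp_all add: trig_def exp_of_nat_mult[symmetric] algebra_simps)

lemma has_integral_trig: "(trig j has_integral (if j = 0 then 1 else 0)) {0..1}"
proof (cases "j = 0")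
  case True
  then have "trig j = (\<lambda>_. 1)" by (auto simp: trig_def)
  then show ?thesis using True has_integral_const_real[of "1 :: complex" 0 1] by simp
next
  case False
  let ?c = "2 * of_real pi * \<i> * of_int j :: complex"
  have c: "?c \<noteq> 0" using False by simp
  have e: "exp ?c = 1"
    using exp_integer_2pi[of "of_int j"] by (simp add: mult_ac)
  have "(trig j has_integral trig j 1 / ?c - trig j 0 / ?c) {0..1}"
  proof (rule fundamental_theorem_of_calculus)
    fix x :: real
    have "((\<lambda>z. exp (?c * z) / ?c) has_field_derivative trig j x) (at (of_real x))"
      using c unfolding trig_def by (auto intro!: derivative_eq_intros)
    from has_vector_derivative_real_field[OF this]
    show "((\<lambda>x. trig j x / ?c) has_vector_derivative trig j x) (at x within {0..1})"
      by (simp add: trig_def)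
  qed simp
  then show ?thesis using False e by (simp add: trig_def)
qed

text \<open>Injectivity of \<open>d\<close> leaves only the diagonal terms. Two coefficient families
  are allowed so that a curve can be paired with its derivative.\<close>

lemma has_integral_cnj_trig_sum:
  fixes C C' :: "'i \<Rightarrow> complex" and d :: "'i \<Rightarrow> int"
  assumes I: "finite I" and d: "inj_on d I"
  shows "((\<lambda>\<tau>. cnj (\<Sum>i\<in>I. C i * trig (d i) \<tau>) * (\<Sum>j\<in>I. C' j * trig (d j) \<tau>)) has_integral
    (\<Sum>i\<in>I. cnj (C i) * C' i)) {0..1}"
proof -
  have "((\<lambda>\<tau>. \<Sum>i\<in>I. \<Sum>j\<in>I. cnj (C i) * C' j * trig (d j - d i) \<tau>) has_integral
      (\<Sum>i\<in>I. \<Sum>j\<in>I. cnj (C i) * C' j * (if d j - d i = 0 then 1 else 0))) {0..1}"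
    by (intro has_integral_sum I has_integral_mult_right has_integral_trig)
  also have "(\<lambda>\<tau>. \<Sum>i\<in>I. \<Sum>j\<in>I. cnj (C i) * C' j * trig (d j - d i) \<tau>) =
      (\<lambda>\<tau>. cnj (\<Sum>i\<in>I. C i * trig (d i) \<tau>) * (\<Sum>j\<in>I. C' j * trig (d j) \<tau>))"
  proof
    fix \<tau>
    have "trig (d j - d i) \<tau> = trig (d j) \<tau> * cnj (trig (d i) \<tau>)" for i j
      using trig_add[of "d j" "- d i"] by (simp add: cnj_trig)
    then show "(\<Sum>i\<in>I. \<Sum>j\<in>I. cnj (C i) * C' j * trig (d j - d i) \<tau>) =
        cnj (\<Sum>i\<in>I. C i * trig (d i) \<tau>) * (\<Sum>j\<in>I. C' j * trig (d j) \<tau>)"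
      unfolding cnj_sum sum_product by (intro sum.cong refl) simp
  qed
  also have "(\<Sum>i\<in>I. \<Sum>j\<in>I. cnj (C i) * C' j * (if d j - d i = 0 then 1 else 0)) =
      (\<Sum>i\<in>I. \<Sum>j\<in>I. if j = i then cnj (C i) * C' j else 0)"
    using d by (intro sum.cong refl) (auto dest: inj_onD)
  also have "\<dots> = (\<Sum>i\<in>I. cnj (C i) * C' i)"
    using I by simp
  finally show ?thesis .
qed

lemma uniform_limit_powser_circle:
  fixes F :: "complex fps"
  assumes F: "1 \<le> fps_conv_radius F" and r: "0 < r" "r < 1"
  shows "uniform_limit A (\<lambda>M \<tau>. \<Sum>m<M. F $ m * clockwise_circle r \<tau> ^ m)
    (\<lambda>\<tau>. eval_fps F (clockwise_circle r \<tau>)) sequentially"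
  unfolding eval_fps_def
proof (rule Weierstrass_m_test)
  show "norm (F $ m * clockwise_circle r \<tau> ^ m) \<le> norm (F $ m * of_real r ^ m)" for m \<tau>
    using r by (simp add: norm_mult norm_power)
  have "ereal (norm (of_real r :: complex)) < 1" using r by simp
  then show "summable (\<lambda>m. norm (F $ m * of_real r ^ m))"
    using F by (intro norm_summable_fps) (rule less_le_trans)
qed

lemma clockwise_circle_trig: "clockwise_circle r \<tau> = of_real r * trig (-1) \<tau>"
  by (simp add: clockwise_circle_def trig_def)

lemma inverse_clockwise_circle_trig:
  "1 / clockwise_circle r \<tau> = of_real (1 / r) * trig 1 \<tau>"
proof -
  have "trig 1 \<tau> * trig (-1) \<tau> = 1" by (simp add: trig_add[symmetric]) (simp add: trig_def)
  moreover have "trig (-1) \<tau> \<noteq> 0" by (simp add: trig_def)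
  ultimately have *: "trig 1 \<tau> = 1 / trig (-1) \<tau>" by (simp add: eq_divide_eq)
  show ?thesis unfolding clockwise_circle_trig * by simp
qed

context laurent_at_infinity
begin

text \<open>In terms of t the curve P (g (1 / t)) is the sum of a_n t^(-n) plus the power series
  \<open>E\<close>. On the clockwise circle these have frequencies n and -m, so differentiation
  weights them with opposite signs, and nonnegative area becomes the inequality.\<close>

lemma area_inequality_radius:
  fixes a :: "nat \<Rightarrow> complex"
  assumes inj: "inj_on g {z. norm z > 1}" and r: "0 < r" "r < 1"
  shows "(\<Sum>m<M. real m * norm (\<Sum>n\<in>{1..N}. a n * B $ n $ m) ^ 2 * r ^ (2 * m)) \<le>
    (\<Sum>n\<in>{1..N}. real n * norm (a n) ^ 2 / r ^ (2 * n))"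
proof -
  let ?c = "clockwise_circle r"
  define P where "P = (\<Sum>n\<in>{1..N}. Polynomial.smult (a n) (faber_rec K n))"
  define E where "E = (\<Sum>n\<in>{1..N}. fps_const (a n) * B $ n)"
  define b where "b m = E $ m" for m
  have b: "b m = (\<Sum>n\<in>{1..N}. a n * B $ n $ m)" for m
    by (simp add: b_def E_def fps_sum_nth)
  have rB: "1 \<le> fps_conv_radius (fps_const (a n) * B $ n)" for n
    by (rule order_trans[OF _ fps_conv_radius_mult]) (simp add: grunsky_B_radius K_radius)
  have rE: "1 \<le> fps_conv_radius E"
    unfolding E_def by (rule fps_conv_radius_sum_ge[OF rB])
  have rE': "1 \<le> fps_conv_radius (fps_deriv E)"
    by (rule order_trans[OF rE fps_conv_radius_deriv])
  have rEE: "1 \<le> fps_conv_radius (fps_eulerop E)"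
    unfolding fps_eulerop_def by (rule order_trans[OF _ fps_conv_radius_mult]) (simp add: rE')
  have c: "?c \<tau> \<noteq> 0" "norm (?c \<tau>) < 1" for \<tau>
    using r norm_clockwise_circle[of r \<tau>] by (auto simp del: norm_clockwise_circle)
  have Pgt: "poly P (g_inv_arg t) = (\<Sum>n\<in>{1..N}. a n * (1 / t) ^ n) + eval_fps E t" if "norm t < 1" "t \<noteq> 0" for t
  proof -
    have "eval_fps E t = (\<Sum>n\<in>{1..N}. a n * eval_fps (B $ n) t)"
      unfolding E_def using that rB radiusI[OF that(1) grunsky_B_radius[OF K_radius]]
      by (simp add: eval_fps_sum eval_fps_mult)
    then show ?thesis
      using that faber_rec_g[of t] by (simp add: P_def poly_sum g_inv_arg_def distrib_left sum.distrib)
  qed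
  have Pgt': "poly (pderiv P) (g_inv_arg t) * g_inv_arg' t * t =
      - (\<Sum>n\<in>{1..N}. of_nat n * a n * (1 / t) ^ n) + eval_fps (fps_eulerop E) t" if t: "norm t < 1" "t \<noteq> 0" for t
  proof -
    have "((\<lambda>t. poly P (g_inv_arg t)) has_field_derivative poly (pderiv P) (g_inv_arg t) * g_inv_arg' t) (at t)"
      by (rule DERIV_chain2[OF poly_DERIV has_field_derivative_g_inv_arg[OF t]])
    moreover have "((\<lambda>t. poly P (g_inv_arg t)) has_field_derivative
        (\<Sum>n\<in>{1..N}. a n * (of_nat n * (1 / t) ^ (n - 1) * (- 1 / t ^ 2))) + eval_fps (fps_deriv E) t) (at t)"
    proof (rule has_field_derivative_transform_within_open)
      have "((\<lambda>t. (1 / t) ^ n) has_field_derivative of_nat n * (1 / t) ^ (n - 1) * (- 1 / t ^ 2)) (at t)" for n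
      proof -
        have "((\<lambda>t. 1 / t) has_field_derivative - 1 / t ^ 2) (at t)"
          using t by (auto intro!: derivative_eq_intros simp: power2_eq_square)
        from DERIV_power[OF this, of n] show ?thesis by (simp add: mult_ac)
      qed
      then show "((\<lambda>t. (\<Sum>n\<in>{1..N}. a n * (1 / t) ^ n) + eval_fps E t) has_field_derivative
        (\<Sum>n\<in>{1..N}. a n * (of_nat n * (1 / t) ^ (n - 1) * (- 1 / t ^ 2))) + eval_fps (fps_deriv E) t) (at t)"
        by (intro DERIV_add DERIV_sum DERIV_cmult has_field_derivative_eval_fps radiusI t rE)
      show "open (ball 0 1 - {0 :: complex})" by auto
    qed (use t Pgt in auto)
    ultimately have e1: "poly (pderiv P) (g_inv_arg t) * g_inv_arg' t =
        (\<Sum>n\<in>{1..N}. a n * (of_nat n * (1 / t) ^ (n - 1) * (- 1 / t ^ 2))) + eval_fps (fps_deriv E) t"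
      by (rule DERIV_unique)
    have e2: "(\<Sum>n\<in>{1..N}. a n * (of_nat n * (1 / t) ^ (n - 1) * (- 1 / t ^ 2)) * t) =
        (\<Sum>n\<in>{1..N}. - (of_nat n * a n * (1 / t) ^ n))"
    proof (rule sum.cong[OF refl])
      fix n assume "n \<in> {1..N}"
      then show "a n * (of_nat n * (1 / t) ^ (n - 1) * (- 1 / t ^ 2)) * t = - (of_nat n * a n * (1 / t) ^ n)"
        using t by (cases n) (simp_all add: power2_eq_square)
    qed
    have e3: "eval_fps (fps_eulerop E) t = eval_fps (fps_deriv E) t * t"
      unfolding fps_eulerop_def using radiusI[OF t(1) rE'] by (simp add: eval_fps_mult)
    show ?thesis
      unfolding e1 e3 distrib_right sum_distrib_right e2 sum_negf ..
  qed
  \<comment> \<open>Truncating \<open>E\<close> leaves finite trigonometric sums; uniform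
    convergence on the circle carries their area integrals over to the full curve.\<close>
  define S where "S F m \<tau> = (\<Sum>i<m. F $ i * ?c \<tau> ^ i)" for F :: "complex fps" and m \<tau>
  define A where "A \<tau> = (\<Sum>n\<in>{1..N}. a n * (1 / ?c \<tau>) ^ n)" for \<tau>
  define A1 where "A1 \<tau> = (\<Sum>n\<in>{1..N}. of_nat n * a n * (1 / ?c \<tau>) ^ n)" for \<tau>
  have contA: "continuous_on {0..1} A" "continuous_on {0..1} A1"
    unfolding A_def[abs_def] A1_def[abs_def] using c by (intro continuous_intros; simp)+
  have contS: "continuous_on {0..1} (S F m)" for F m
    unfolding S_def[abs_def] by (intro continuous_intros)
  have im: "?c ` {0..1} \<subseteq> ball 0 1" using c by auto
  have contE: "continuous_on {0..1} (\<lambda>\<tau>. eval_fps F (?c \<tau>))" if "1 \<le> fps_conv_radius F" for F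
  proof (rule continuous_on_compose2[OF _ continuous_on_clockwise_circle im])
    show "continuous_on (ball 0 1) (eval_fps F)"
      by (rule continuous_on_subset[OF continuous_on_eval_fps]) (use that radiusI in force)
  qed
  define T where "T m \<tau> = A \<tau> + S E m \<tau>" for m \<tau>
  define T' where "T' m \<tau> = - (2 * of_real pi * \<i>) * (- A1 \<tau> + S (fps_eulerop E) m \<tau>)" for m \<tau>
  define G where "G \<tau> = A \<tau> + eval_fps E (?c \<tau>)" for \<tau>
  define G' where "G' \<tau> = - (2 * of_real pi * \<i>) * (- A1 \<tau> + eval_fps (fps_eulerop E) (?c \<tau>))" for \<tau>
  have contG: "continuous_on {0..1} G" "continuous_on {0..1} G'"
    unfolding G_def[abs_def] G'_def[abs_def]
    by (intro continuous_on_add continuous_on_mult continuous_on_minus continuous_on_const contA contE rE rEE)+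
  have ulT: "uniform_limit {0..1} T G sequentially"
    unfolding T_def[abs_def] G_def[abs_def] S_def
    by (intro uniform_limit_add uniform_limit_const uniform_limit_powser_circle rE r)
  have ulT': "uniform_limit {0..1} T' G' sequentially"
    unfolding T'_def[abs_def] G'_def[abs_def] S_def
    by (intro uniform_lim_mult uniform_limit_add uniform_limit_const uniform_limit_powser_circle rEE r
        compact_imp_bounded compact_continuous_image continuous_on_add continuous_on_minus
        continuous_on_const contA contE compact_Icc)
  have ul: "uniform_limit {0..1} (\<lambda>m \<tau>. cnj (T m \<tau>) * T' m \<tau>) (\<lambda>\<tau>. cnj (G \<tau>) * G' \<tau>) sequentially"
    by (intro uniform_lim_mult ulT' bounded_linear.uniform_limit[OF bounded_linear_cnj ulT]
        compact_imp_bounded compact_continuous_image continuous_on_cnj contG compact_Icc)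
  obtain I J where IJ: "\<And>m. ((\<lambda>\<tau>. cnj (T m \<tau>) * T' m \<tau>) has_integral I m) {0..1}"
      "((\<lambda>\<tau>. cnj (G \<tau>) * G' \<tau>) has_integral J) {0..1}" "I \<longlonglongrightarrow> J"
    by (rule uniform_limit_integral[OF ul])
      (auto simp: T_def[abs_def] T'_def[abs_def] intro!: continuous_intros contA contS)
  have "0 \<le> Im (integral {0..1} (\<lambda>\<tau>. cnj (G \<tau>) * G' \<tau>))"
  proof -
    have "poly P (g_inv_arg (?c \<tau>)) = G \<tau>" for \<tau>
      using Pgt[OF c(2,1)] by (simp add: G_def A_def)
    moreover have "poly (pderiv P) (g_inv_arg (?c \<tau>)) * g_inv_arg' (?c \<tau>) * (- (2 * of_real pi * \<i>) * ?c \<tau>) = G' \<tau>" for \<tau>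
    proof -
      have "poly (pderiv P) (g_inv_arg (?c \<tau>)) * g_inv_arg' (?c \<tau>) * (- (2 * of_real pi * \<i>) * ?c \<tau>) =
          - (2 * of_real pi * \<i>) * (poly (pderiv P) (g_inv_arg (?c \<tau>)) * g_inv_arg' (?c \<tau>) * ?c \<tau>)"
        by (simp only: mult_ac)
      then show ?thesis unfolding Pgt'[OF c(2,1)] by (simp only: G'_def A1_def)
    qed
    ultimately show ?thesis using poly_curve_area_nonneg[OF inj r, of P] by simp
  qed
  then have J: "0 \<le> Im J" using IJ(2) by (simp add: integral_unique)
  define V where "V m = (\<Sum>n\<in>{1..N}. real n * norm (a n) ^ 2 / r ^ (2 * n)) -
      (\<Sum>i<m. real i * norm (b i) ^ 2 * r ^ (2 * i))" for m
  have I: "I m = 2 * of_real pi * \<i> * of_real (V m)" for m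
  proof -
    \<comment> \<open>Left indices have frequencies at least 1 and right indices at most 0, so all
      frequencies are distinct.\<close>
    let ?I = "{1..N} <+> {..<m}"
    define d :: "nat + nat \<Rightarrow> int" where "d = case_sum int (\<lambda>i. - int i)"
    define C where "C = case_sum (\<lambda>n. a n / of_real r ^ n) (\<lambda>i. b i * of_real r ^ i)"
    have "inj_on d ?I" by (auto simp: inj_on_def d_def)
    then have h0: "((\<lambda>\<tau>. cnj (\<Sum>i\<in>?I. C i * trig (d i) \<tau>) *
        (\<Sum>i\<in>?I. (2 * of_real pi * \<i> * of_int (d i) * C i) * trig (d i) \<tau>)) has_integral
        (\<Sum>i\<in>?I. cnj (C i) * (2 * of_real pi * \<i> * of_int (d i) * C i))) {0..1}"
      by (intro has_integral_cnj_trig_sum) auto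
    have e1: "(\<Sum>i\<in>?I. C i * trig (d i) \<tau>) = T m \<tau>" for \<tau>
      unfolding T_def A_def S_def inverse_clockwise_circle_trig unfolding clockwise_circle_trig
      by (simp add: sum.Plus o_def C_def d_def trig_of_nat power_mult_distrib power_divide b_def mult_ac)
    have e2: "(\<Sum>i\<in>?I. (2 * of_real pi * \<i> * of_int (d i) * C i) * trig (d i) \<tau>) = T' m \<tau>" for \<tau>
      unfolding T'_def A1_def S_def inverse_clockwise_circle_trig unfolding clockwise_circle_trig
      by (simp add: sum.Plus o_def C_def d_def trig_of_nat power_mult_distrib power_divide b_def mult_ac
          sum_distrib_left sum_negf right_diff_distrib)
    have e3: "(\<Sum>i\<in>?I. cnj (C i) * (2 * of_real pi * \<i> * of_int (d i) * C i)) = 2 * of_real pi * \<i> * of_real (V m)"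
    proof -
      have 1: "cnj (C i) * (2 * of_real pi * \<i> * of_int (d i) * C i) =
          2 * of_real pi * \<i> * of_real (of_int (d i) * norm (C i) ^ 2)" for i
        using complex_norm_square[of "C i"] by (simp add: mult_ac)
      have "(\<Sum>i\<in>?I. of_int (d i) * norm (C i) ^ 2) = V m"
        using r by (simp add: sum.Plus o_def C_def d_def V_def norm_mult norm_divide norm_power
            power_mult_distrib power_divide power_mult[symmetric] mult.commute[of 2] sum_negf mult_ac)
      then show ?thesis unfolding 1 by (simp only: sum_distrib_left[symmetric] of_real_sum[symmetric])
    qed
    show ?thesis by (rule has_integral_unique[OF IJ(1) h0[unfolded e1 e2 e3]])
  qed
  have "(\<lambda>m. 2 * pi * V m) \<longlonglongrightarrow> Im J"
    using tendsto_Im[OF IJ(3)] by (simp add: I)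
  \<comment> \<open>Each truncation subtracts one more nonnegative term, so every \<open>V M\<close>
    lies above the limit, which is nonnegative.\<close>
  moreover have "decseq (\<lambda>m. 2 * pi * V m)"
    unfolding V_def decseq_Suc_iff using r by simp
  ultimately have "Im J \<le> 2 * pi * V M" by (rule decseq_ge[rotated])
  then have "0 \<le> 2 * pi * V M" using J by linarith
  then have "0 \<le> V M" using pi_gt_zero by (simp add: zero_le_mult_iff)
  then show ?thesis by (simp add: V_def b)
qed

text \<open>Let r tend to 1. Both sides are finite sums, the left one thanks to the truncation at M,
  so the limit is taken term by term.\<close>

lemma area_inequality:
  fixes a :: "nat \<Rightarrow> complex"
  assumes inj: "inj_on g {z. norm z > 1}"
  shows "(\<Sum>m<M. real m * norm (\<Sum>n\<in>{1..N}. a n * B $ n $ m) ^ 2) \<le>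
    (\<Sum>n\<in>{1..N}. real n * norm (a n) ^ 2)"
proof (rule tendsto_le)
  let ?b = "\<lambda>m. norm (\<Sum>n\<in>{1..N}. a n * B $ n $ m)"
  have "((\<lambda>r. \<Sum>m<M. real m * ?b m ^ 2 * r ^ (2 * m)) \<longlongrightarrow> (\<Sum>m<M. real m * ?b m ^ 2 * 1 ^ (2 * m))) (at_left (1 :: real))"
    by (intro tendsto_intros)
  then show "((\<lambda>r. \<Sum>m<M. real m * ?b m ^ 2 * r ^ (2 * m)) \<longlongrightarrow> (\<Sum>m<M. real m * ?b m ^ 2)) (at_left (1 :: real))"
    by simp
  have "((\<lambda>r. \<Sum>n\<in>{1..N}. real n * norm (a n) ^ 2 / r ^ (2 * n)) \<longlongrightarrow> (\<Sum>n\<in>{1..N}. real n * norm (a n) ^ 2 / 1 ^ (2 * n))) (at_left (1 :: real))"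
    by (intro tendsto_intros) auto
  then show "((\<lambda>r. \<Sum>n\<in>{1..N}. real n * norm (a n) ^ 2 / r ^ (2 * n)) \<longlongrightarrow> (\<Sum>n\<in>{1..N}. real n * norm (a n) ^ 2)) (at_left (1 :: real))"
    by simp
  have "eventually (\<lambda>r :: real. 0 < r \<and> r < 1) (at_left 1)"
    by (rule eventually_at_leftI[of 0]) auto
  then show "eventually (\<lambda>r. (\<Sum>m<M. real m * ?b m ^ 2 * r ^ (2 * m)) \<le>
      (\<Sum>n\<in>{1..N}. real n * norm (a n) ^ 2 / r ^ (2 * n))) (at_left 1)"
    by (rule eventually_mono) (use area_inequality_radius[OF inj] in blast)
qed auto

end

section \<open>Eigenvalues of the Grunsky matrices\<close>

definition real_symmetric_mat :: "complex Matrix.mat \<Rightarrow> bool" where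
  "real_symmetric_mat A \<longleftrightarrow> (\<forall>i<dim_row A. \<forall>j<dim_row A. A $$ (i, j) \<in> \<real> \<and> A $$ (i, j) = A $$ (j, i))"

lemma mat_square_nth:
  fixes A :: "complex Matrix.mat"
  assumes A: "A \<in> carrier_mat N N" and ij: "i < N" "j < N"
  shows "(A * A) $$ (i, j) = (\<Sum>k<N. A $$ (i, k) * A $$ (k, j))"
  using A ij by (simp add: scalar_prod_def atLeast0LessThan)

lemma real_symmetric_mult_self:
  assumes A: "A \<in> carrier_mat N N" and sym: "real_symmetric_mat A"
  shows "real_symmetric_mat (A * A)"
  unfolding real_symmetric_mat_def
proof (intro allI impI conjI)
  fix i j assume "i < dim_row (A * A)" "j < dim_row (A * A)"
  then have ij: "i < N" "j < N" using A by auto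
  have s: "A $$ (a, b) \<in> \<real>" "A $$ (a, b) = A $$ (b, a)" if "a < N" "b < N" for a b
    using sym A that by (auto simp: real_symmetric_mat_def)
  show "(A * A) $$ (i, j) \<in> \<real>"
    unfolding mat_square_nth[OF A ij] using s ij
    by (intro sum_in_Reals Reals_mult) auto
  show "(A * A) $$ (i, j) = (A * A) $$ (j, i)"
    unfolding mat_square_nth[OF A ij] mat_square_nth[OF A ij(2,1)]
  proof (rule sum.cong[OF refl])
    fix k assume "k \<in> {..<N}"
    then show "A $$ (i, k) * A $$ (k, j) = A $$ (j, k) * A $$ (k, i)"
      using s(2)[of i k] s(2)[of k j] ij by simp
  qed
qed

text \<open>A diagonal entry of the square is the squared norm of the corresponding row, of which
  any single entry is a part.\<close>

lemma real_symmetric_mult_self_diag: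
  fixes A :: "complex Matrix.mat"
  assumes A: "A \<in> carrier_mat N N" and sym: "real_symmetric_mat A" and ij: "i < N" "j < N"
  shows "norm (A $$ (i, j)) ^ 2 \<le> norm ((A * A) $$ (i, i))"
proof -
  have s: "A $$ (i, k) * A $$ (k, i) = of_real (norm (A $$ (i, k)) ^ 2)" if "k < N" for k
  proof -
    have "A $$ (k, i) = cnj (A $$ (i, k))"
      using sym A that ij unfolding real_symmetric_mat_def by (metis Reals_cnj_iff carrier_matD(1))
    then show ?thesis using complex_norm_square[of "A $$ (i, k)"] by simp
  qed
  have "(A * A) $$ (i, i) = (\<Sum>k<N. of_real (norm (A $$ (i, k)) ^ 2))"
    unfolding mat_square_nth[OF A ij(1) ij(1)] using s by (intro sum.cong refl) auto
  then have "(A * A) $$ (i, i) = of_real (\<Sum>k<N. norm (A $$ (i, k)) ^ 2)" by simp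
  then have "norm ((A * A) $$ (i, i)) = (\<Sum>k<N. norm (A $$ (i, k)) ^ 2)"
    by (simp only: norm_of_real) (simp add: sum_nonneg)
  moreover have "norm (A $$ (i, j)) ^ 2 \<le> (\<Sum>k<N. norm (A $$ (i, k)) ^ 2)"
    using ij by (intro member_le_sum) auto
  ultimately show ?thesis by simp
qed

lemma pow_mat_add:
  assumes A: "A \<in> carrier_mat N N"
  shows "A ^\<^sub>m a * A ^\<^sub>m b = A ^\<^sub>m (a + b)"
proof (induction b)
  case 0
  then show ?case using A by simp
next
  case (Suc b)
  have "A ^\<^sub>m a * (A ^\<^sub>m b * A) = (A ^\<^sub>m a * A ^\<^sub>m b) * A"
    using A by (intro assoc_mult_mat[symmetric]) auto
  then show ?case using Suc by simp
qed

text \<open>Repeated squaring turns an entry of modulus \<open>q > 1\<close> into diagonal entries of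
  \<open>A ^ (2 ^ k)\<close> growing like \<open>q ^ (2 ^ k)\<close>, whereas the powers of a matrix
  of spectral radius at most 1 grow only polynomially.\<close>

lemma real_symmetric_entry_le_1:
  fixes A :: "complex Matrix.mat"
  assumes A: "A \<in> carrier_mat N N" and sym: "real_symmetric_mat A" and ij: "i < N" "j < N"
    and ev: "\<And>e. eigenvalue A e \<Longrightarrow> norm e \<le> 1"
  shows "norm (A $$ (i, j)) \<le> 1"
proof (rule ccontr)
  assume "\<not> norm (A $$ (i, j)) \<le> 1"
  then have q: "norm (A $$ (i, j)) > 1" by simp
  define q where "q = norm (A $$ (i, j))"
  have symP: "real_symmetric_mat (A ^\<^sub>m (2 ^ k))" for k
  proof (induction k)
    case 0
    then show ?case using A sym by simp
  next
    case (Suc k)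
    have "A ^\<^sub>m (2 ^ Suc k) = A ^\<^sub>m (2 ^ k) * A ^\<^sub>m (2 ^ k)"
      unfolding pow_mat_add[OF A] by (simp add: mult_2)
    then show ?case using real_symmetric_mult_self[OF pow_carrier_mat[OF A] Suc] by simp
  qed
  \<comment> \<open>The squaring at k = 0 moves the large entry from (i, j) to the diagonal; all
    further squarings stay at (i, i).\<close>
  have grow: "q ^ (2 ^ Suc k) \<le> norm ((A ^\<^sub>m (2 ^ Suc k)) $$ (i, i))" for k
  proof (induction k)
    case 0
    have "A ^\<^sub>m (2 ^ Suc 0) = A * A" using A by (simp add: numeral_2_eq_2)
    then show ?case using real_symmetric_mult_self_diag[OF A sym ij] by (simp add: q_def)
  next
    case (Suc k)
    have "q ^ (2 ^ Suc (Suc k)) = (q ^ (2 ^ Suc k)) ^ 2"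
      by (simp add: power_mult[symmetric] mult_ac)
    also have "\<dots> \<le> norm ((A ^\<^sub>m (2 ^ Suc k)) $$ (i, i)) ^ 2"
      using Suc q by (intro power_mono) (auto simp: q_def)
    also have "\<dots> \<le> norm ((A ^\<^sub>m (2 ^ Suc k) * A ^\<^sub>m (2 ^ Suc k)) $$ (i, i))"
      by (rule real_symmetric_mult_self_diag[OF pow_carrier_mat[OF A] symP ij(1) ij(1)])
    also have "A ^\<^sub>m (2 ^ Suc k) * A ^\<^sub>m (2 ^ Suc k) = A ^\<^sub>m (2 ^ Suc (Suc k))"
      unfolding pow_mat_add[OF A] by (simp add: mult_2)
    finally show ?case .
  qed
  have "spectral_radius A \<le> 1"
    using spectral_radius_mem_max(1)[OF A] ij ev by (auto simp: spectrum_def)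
  moreover obtain as where "char_poly A = (\<Prod>a\<leftarrow>as. [:- a, 1:])"
    using char_poly_factorized[OF A] by blast
  \<comment> \<open>Jordan blocks have size at most N, so powers with eigenvalues of modulus at most
    1 grow at most like k^(N - 1).\<close>
  ultimately obtain c1 c2 where c: "\<And>k. norm_bound (A ^\<^sub>m k) (c1 + c2 * of_nat k ^ (N - 1))"
    using spectral_radius_jnf_norm_bound_le_1[OF A _ jordan_nf_exists[OF A]] by metis
  have bound: "norm ((A ^\<^sub>m k) $$ (i, i)) \<le> c1 + c2 * real k ^ (N - 1)" for k
    using c[of k] A ij unfolding norm_bound_def by simp
  have "filterlim (\<lambda>n::nat. q ^ n - (c1 + c2 * real n ^ (N - 1))) at_top sequentially"
    using q unfolding q_def[symmetric] by real_asymp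
  moreover have "filterlim (\<lambda>k::nat. (2::nat) ^ Suc k) sequentially sequentially"
    by (intro filterlim_subseq strict_monoI) simp
  ultimately have "filterlim (\<lambda>k::nat. q ^ (2 ^ Suc k) - (c1 + c2 * real (2 ^ Suc k) ^ (N - 1))) at_top sequentially"
    by (rule filterlim_compose)
  then have "eventually (\<lambda>k. q ^ (2 ^ Suc k) - (c1 + c2 * real (2 ^ Suc k) ^ (N - 1)) > 0) sequentially"
    unfolding filterlim_at_top_dense by blast
  then obtain k where "q ^ (2 ^ Suc k) > c1 + c2 * real (2 ^ Suc k) ^ (N - 1)"
    by (auto dest: eventually_happens)
  moreover have "q ^ (2 ^ Suc k) \<le> c1 + c2 * real (2 ^ Suc k) ^ (N - 1)"
    by (rule order_trans[OF grow bound])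
  ultimately show False by linarith
qed

lemma eigenvector_nth:
  fixes A :: "complex Matrix.mat"
  assumes A: "A \<in> carrier_mat N N" and ev: "eigenvector A v e" and i: "i < N"
  shows "(\<Sum>j<N. A $$ (i, j) * Matrix.vec_index v j) = e * Matrix.vec_index v i"
proof -
  have v: "v \<in> carrier_vec N" "A *\<^sub>v v = e \<cdot>\<^sub>v v" using ev A by (auto simp: eigenvector_def)
  have "Matrix.vec_index (A *\<^sub>v v) i = (\<Sum>j<N. A $$ (i, j) * Matrix.vec_index v j)"
    using A v(1) i by (simp add: scalar_prod_def atLeast0LessThan)
  moreover have "Matrix.vec_index (e \<cdot>\<^sub>v v) i = e * Matrix.vec_index v i" using v(1) i by simp
  ultimately show ?thesis using v(2) by simp
qed

lemma eigenvector_norm_pos: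
  fixes A :: "complex Matrix.mat"
  assumes A: "A \<in> carrier_mat N N" and ev: "eigenvector A v e"
  shows "0 < (\<Sum>j<N. norm (Matrix.vec_index v j) ^ 2)"
proof -
  have v: "v \<in> carrier_vec N" "v \<noteq> 0\<^sub>v N" using ev A by (auto simp: eigenvector_def)
  then obtain j where j: "j < N" "Matrix.vec_index v j \<noteq> 0"
    by (metis carrier_vecD eq_vecI index_zero_vec)
  then show ?thesis by (intro sum_pos2[of _ j]) auto
qed

text \<open>The Hermitian form \<open>Q\<close> at an eigenvector equals e times its squared norm,
  and is its own conjugate.\<close>

lemma real_symmetric_eigenvalue_real:
  fixes A :: "complex Matrix.mat"
  assumes A: "A \<in> carrier_mat N N" and sym: "real_symmetric_mat A" and ev: "eigenvector A v e"
  shows "e \<in> \<real>"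
proof -
  let ?v = "\<lambda>i. Matrix.vec_index v i"
  define n where "n = (\<Sum>j<N. norm (?v j) ^ 2)"
  define Q where "Q = (\<Sum>i<N. \<Sum>j<N. cnj (?v i) * A $$ (i, j) * ?v j)"
  have "Q = (\<Sum>i<N. cnj (?v i) * (\<Sum>j<N. A $$ (i, j) * ?v j))"
    by (simp add: Q_def sum_distrib_left mult_ac)
  also have "\<dots> = (\<Sum>i<N. e * of_real (norm (?v i) ^ 2))"
    using eigenvector_nth[OF A ev] complex_norm_square[of "?v _"]
    by (intro sum.cong refl) (simp add: mult_ac)
  finally have Q: "Q = e * of_real n" by (simp add: n_def sum_distrib_left)
  have "cnj Q = (\<Sum>i<N. \<Sum>j<N. ?v i * cnj (A $$ (i, j)) * cnj (?v j))"
    by (simp add: Q_def)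
  also have "\<dots> = (\<Sum>i<N. \<Sum>j<N. ?v i * A $$ (j, i) * cnj (?v j))"
    using sym A unfolding real_symmetric_mat_def by (intro sum.cong refl) (auto simp: Reals_cnj_iff)
  also have "\<dots> = Q" unfolding Q_def by (subst sum.swap) (simp add: mult_ac)
  finally have "Q \<in> \<real>" by (simp add: Reals_cnj_iff)
  then have "Q / of_real n \<in> \<real>" by (rule Reals_divide) simp
  moreover have "n > 0" unfolding n_def by (rule eigenvector_norm_pos[OF A ev])
  then have "e = Q / of_real n" using Q by simp
  ultimately show ?thesis by (simp only:)
qed

context laurent_at_infinity
begin


lemma grunsky_mat_carrier: "grunsky_mat g N \<in> carrier_mat N N"
  by (simp add: grunsky_mat_def)

lemma grunsky_mat_nth: "i < N \<Longrightarrow> j < N \<Longrightarrow> grunsky_mat g N $$ (i, j) = scaled_grunsky_coeff g (Suc i) (Suc j)"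
  by (simp add: grunsky_mat_def)

lemma scaled_grunsky_coeff_real:
  assumes "\<And>i. K $ i \<in> \<real>"
  shows "scaled_grunsky_coeff g n m \<in> \<real>"
  unfolding scaled_grunsky_coeff_def grunsky_coeff_eq
  by (intro Reals_mult grunsky_B_real assms) simp

lemma grunsky_mat_real_symmetric:
  assumes "\<And>i. K $ i \<in> \<real>"
  shows "real_symmetric_mat (grunsky_mat g N)"
  unfolding real_symmetric_mat_def
  using grunsky_mat_carrier[of N] scaled_grunsky_coeff_real[OF assms]
  by (auto simp: grunsky_mat_nth intro: scaled_grunsky_coeff_sym)

text \<open>With a_n = v_(n-1) / sqrt n the right side of the area inequality is the squared norm of
  v, and the first N terms of the left side are |e|^2 times it.\<close>

lemma grunsky_eigenvalue_le_1:
  assumes inj: "inj_on g {z. norm z > 1}" and ev: "eigenvector (grunsky_mat g N) v e"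
  shows "norm e \<le> 1"
proof -
  let ?A = "grunsky_mat g N" and ?v = "\<lambda>i. Matrix.vec_index v i"
  define a where "a n = ?v (n - 1) / of_real (sqrt (real n))" for n
  define S where "S = (\<Sum>j<N. norm (?v j) ^ 2)"
  have S: "S > 0" unfolding S_def by (rule eigenvector_norm_pos[OF grunsky_mat_carrier ev])
  have b: "real (Suc i) * norm (\<Sum>n\<in>{1..N}. a n * B $ n $ Suc i) ^ 2 = norm e ^ 2 * norm (?v i) ^ 2"
    if i: "i < N" for i
  proof -
    have "of_real (sqrt (real (Suc i))) * (\<Sum>n\<in>{1..N}. a n * B $ n $ Suc i) =
        (\<Sum>n\<in>{1..N}. ?v (n - 1) * scaled_grunsky_coeff g n (Suc i))"
      by (simp add: sum_distrib_left a_def scaled_grunsky_coeff_def grunsky_coeff_eq real_sqrt_divide mult_ac)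
    \<comment> \<open>The area inequality sums over the first Grunsky index, the matrix product over
      the second; symmetry exchanges them.\<close>
    also have "\<dots> = (\<Sum>j<N. ?A $$ (i, j) * ?v j)"
      by (rule sum.reindex_bij_witness[of _ Suc "\<lambda>n. n - 1"])
        (use i scaled_grunsky_coeff_sym in \<open>auto simp: grunsky_mat_nth mult_ac\<close>)
    also have "\<dots> = e * ?v i" by (rule eigenvector_nth[OF grunsky_mat_carrier ev i])
    finally have "norm (of_real (sqrt (real (Suc i))) * (\<Sum>n\<in>{1..N}. a n * B $ n $ Suc i)) ^ 2 =
        norm (e * ?v i) ^ 2" by simp
    then show ?thesis by (simp add: norm_mult power_mult_distrib del: of_nat_Suc)
  qed
  have "norm e ^ 2 * S = (\<Sum>i<N. real (Suc i) * norm (\<Sum>n\<in>{1..N}. a n * B $ n $ Suc i) ^ 2)"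
    using b by (simp add: S_def sum_distrib_left del: of_nat_Suc)
  \<comment> \<open>The added term m = 0 vanishes through its weight.\<close>
  also have "\<dots> = (\<Sum>m<Suc N. real m * norm (\<Sum>n\<in>{1..N}. a n * B $ n $ m) ^ 2)"
    by (subst sum.lessThan_Suc_shift) simp
  also have "\<dots> \<le> (\<Sum>n\<in>{1..N}. real n * norm (a n) ^ 2)"
    by (rule area_inequality[OF inj])
  also have "\<dots> = (\<Sum>n\<in>{1..N}. norm (?v (n - 1)) ^ 2)"
    by (intro sum.cong refl) (simp add: a_def norm_divide power_divide)
  also have "\<dots> = S"
    unfolding S_def by (rule sum.reindex_bij_witness[of _ Suc "\<lambda>n. n - 1"]) auto
  finally have "norm e ^ 2 * S \<le> 1 * S" by simp
  then have "norm e ^ 2 \<le> 1" using S by (simp only: mult_le_cancel_right_pos)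
  then show ?thesis by (simp add: power_le_one_iff)
qed

theorem inj_iff_grunsky_eigenvalues:
  assumes real: "\<And>i. K $ i \<in> \<real>"
  shows "inj_on g {z. norm z > 1} \<longleftrightarrow>
    (\<forall>N\<ge>1. \<forall>e. eigenvalue (grunsky_mat g N) e \<longrightarrow> e \<in> complex_of_real ` {-1..1})"
proof (intro iffI allI impI)
  fix N :: nat and e assume inj: "inj_on g {z. norm z > 1}" and "eigenvalue (grunsky_mat g N) e"
  then obtain v where v: "eigenvector (grunsky_mat g N) v e" by (auto simp: eigenvalue_def)
  have "e \<in> \<real>"
    by (rule real_symmetric_eigenvalue_real[OF grunsky_mat_carrier grunsky_mat_real_symmetric[OF real] v])
  then obtain x where x: "e = complex_of_real x" by (auto elim: Reals_cases)
  then have "\<bar>x\<bar> \<le> 1" using grunsky_eigenvalue_le_1[OF inj v] by simp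
  then have "x \<in> {-1..1}" by auto
  then show "e \<in> complex_of_real ` {-1..1}" unfolding x by (rule imageI)
next
  assume ev: "\<forall>N\<ge>1. \<forall>e. eigenvalue (grunsky_mat g N) e \<longrightarrow> e \<in> complex_of_real ` {-1..1}"
  show "inj_on g {z. norm z > 1}"
  proof (rule inj_on_if_scaled_grunsky_coeff_bounded)
    fix n m :: nat assume nm: "n \<ge> 1" "m \<ge> 1"
    define N where "N = max n m"
    have N: "n - 1 < N" "m - 1 < N" "N \<ge> 1" using nm by (auto simp: N_def)
    have "norm (grunsky_mat g N $$ (n - 1, m - 1)) \<le> 1"
    proof (rule real_symmetric_entry_le_1[OF grunsky_mat_carrier grunsky_mat_real_symmetric[OF real] N(1,2)])
      fix e assume "eigenvalue (grunsky_mat g N) e"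
      then have "e \<in> complex_of_real ` {-1..1}" using ev N by blast
      then show "norm e \<le> 1" by auto
    qed
    then show "norm (scaled_grunsky_coeff g n m) \<le> 1"
      using N nm by (simp add: grunsky_mat_nth)
  qed
qed

end

section \<open>The reciprocal Cauchy transform\<close>

locale interval_distribution = real_distribution \<mu> for \<mu> :: "real measure" +
  assumes support: "measure_support \<mu> \<subseteq> {-2..2}"
begin

abbreviation "G \<equiv> cauchy_transform \<mu>"
abbreviation "slit \<equiv> complex_of_real ` {-2..2}"

text \<open>The complement of the support is a union of open null sets. By the Lindelof property
  countably many of them cover it, so it is null.\<close>

lemma AE_support: "AE x in \<mu>. x \<in> {-2..2}"
proof -
  define \<F> where "\<F> = {U :: real set. open U \<and> emeasure \<mu> U = 0}"
  obtain \<F>' where F': "\<F>' \<subseteq> \<F>" "countable \<F>'" "\<Union>\<F>' = \<Union>\<F>"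
    by (rule Lindelof[of \<F>]) (auto simp: \<F>_def)
  have "(\<Union>U\<in>\<F>'. U) \<in> null_sets \<mu>"
    using F' by (intro null_sets_UN') (auto simp: \<F>_def null_sets_def)
  then have "\<Union>\<F> \<in> null_sets \<mu>" using F' by simp
  from AE_not_in[OF this] show ?thesis
  proof (rule eventually_mono)
    fix x assume x: "x \<notin> \<Union>\<F>"
    have "x \<in> measure_support \<mu>"
      unfolding measure_support_def
    proof safe
      fix U assume "open U" "x \<in> U"
      then have "emeasure \<mu> U \<noteq> 0" using x by (auto simp: \<F>_def)
      then show "0 < emeasure \<mu> U" by (simp add: zero_less_iff_neq_zero)
    qed
    then show "x \<in> {-2..2}" using support by blast
  qed
qed

lemma integrable_bounded_on_support:
  fixes f :: "real \<Rightarrow> 'b :: {banach, second_countable_topology}"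
  assumes "f \<in> borel_measurable borel" and "\<And>x. x \<in> {-2..2} \<Longrightarrow> norm (f x) \<le> C"
  shows "integrable \<mu> f"
proof (rule integrable_const_bound)
  show "AE x in \<mu>. norm (f x) \<le> C" using AE_support by (rule eventually_mono) (rule assms(2))
qed (use assms in simp)

lemma norm_integral_le_on_support:
  fixes f :: "real \<Rightarrow> complex"
  assumes "f \<in> borel_measurable borel" and "\<And>x. x \<in> {-2..2} \<Longrightarrow> norm (f x) \<le> C"
  shows "norm (LINT x|\<mu>. f x) \<le> C"
proof -
  have "norm (LINT x|\<mu>. f x) \<le> (LINT x|\<mu>. norm (f x))" by (rule integral_norm_bound)
  also have "\<dots> \<le> (LINT x|\<mu>. C)"
  proof (rule integral_mono_AE)
    show "integrable \<mu> (\<lambda>x. norm (f x))"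
      by (rule integrable_norm[OF integrable_bounded_on_support[OF assms]])
    show "AE x in \<mu>. norm (f x) \<le> C" using AE_support by (rule eventually_mono) (rule assms(2))
  qed simp
  also have "\<dots> = C" using prob_space by simp
  finally show ?thesis .
qed

lemma integral_ge_on_support:
  fixes f :: "real \<Rightarrow> real"
  assumes "integrable \<mu> f" and "\<And>x. x \<in> {-2..2} \<Longrightarrow> c \<le> f x"
  shows "c \<le> (LINT x|\<mu>. f x)"
  by (rule integral_ge_const[OF assms(1)]) (rule eventually_mono[OF AE_support assms(2)])

lemma closed_slit: "closed slit"
  by (intro compact_imp_closed compact_continuous_image continuous_intros) auto

lemma slit_dist:
  assumes "z \<notin> slit"
  obtains \<delta> where "\<delta> > 0" "\<And>x. x \<in> {-2..2} \<Longrightarrow> \<delta> \<le> norm (z - complex_of_real x)"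
proof -
  obtain d where d: "d > 0" "\<And>y. y \<in> slit \<Longrightarrow> d \<le> dist z y"
    using separate_point_closed[OF closed_slit assms] by blast
  show ?thesis by (rule that[of d]) (use d in \<open>auto simp: dist_norm\<close>)
qed

lemma slit_neq: "z \<notin> slit \<Longrightarrow> x \<in> {-2..2} \<Longrightarrow> z - complex_of_real x \<noteq> 0"
  by auto

lemma integrable_cauchy_kernel:
  assumes "z \<notin> slit"
  shows "integrable \<mu> (\<lambda>x. 1 / (z - complex_of_real x))"
proof -
  obtain \<delta> where d: "\<delta> > 0" "\<And>x. x \<in> {-2..2} \<Longrightarrow> \<delta> \<le> norm (z - complex_of_real x)"
    using slit_dist[OF assms] by blast
  show ?thesis
  proof (rule integrable_bounded_on_support)
    show "norm (1 / (z - complex_of_real x)) \<le> 1 / \<delta>" if "x \<in> {-2..2}" for x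
      unfolding norm_divide norm_one using d(1) d(2)[OF that]
      by (intro divide_left_mono mult_pos_pos) auto
  qed simp
qed

text \<open>With p = y - x and q = z - x, the error of the difference quotient of the kernel is (p -
  q) / (p q^2). As |q| is at least \<delta> and |p| at least \<delta> / 2 on the support, it is at
  most |y - z| times 2 / \<delta>^3, uniformly in x.\<close>

lemma cauchy_transform_has_field_derivative:
  assumes z: "z \<notin> slit"
  shows "(G has_field_derivative (LINT x|\<mu>. - 1 / (z - complex_of_real x) ^ 2)) (at z)"
  unfolding has_field_derivative_iff
proof -
  let ?D = "LINT x|\<mu>. - 1 / (z - complex_of_real x) ^ 2"
  obtain \<delta> where d: "\<delta> > 0" "\<And>x. x \<in> {-2..2} \<Longrightarrow> \<delta> \<le> norm (z - complex_of_real x)"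
    using slit_dist[OF z] by blast
  have intD: "integrable \<mu> (\<lambda>x. - 1 / (z - complex_of_real x) ^ 2)"
  proof (rule integrable_bounded_on_support)
    show "norm (- 1 / (z - complex_of_real x) ^ 2) \<le> 1 / \<delta> ^ 2" if "x \<in> {-2..2}" for x
      using d(1) d(2)[OF that] by (simp add: norm_divide norm_power frac_le power_mono)
  qed simp
  have bound: "norm ((G y - G z) / (y - z) - ?D) \<le> norm (y - z) * (2 / \<delta> ^ 3)" if y: "y \<noteq> z" "dist y z < \<delta> / 2" for y
  proof -
    have dy: "\<delta> / 2 \<le> norm (y - complex_of_real x)" if "x \<in> {-2..2}" for x
      using d(2)[OF that] y(2) norm_triangle_ineq[of "z - y" "y - complex_of_real x"]
      by (simp add: dist_norm norm_minus_commute)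
    have ys: "y \<notin> slit" using dy d(1) by force
    have "(G y - G z) / (y - z) - ?D =
        (LINT x|\<mu>. (1 / (y - complex_of_real x) - 1 / (z - complex_of_real x)) / (y - z) - (- 1 / (z - complex_of_real x) ^ 2))"
      unfolding cauchy_transform_def using integrable_cauchy_kernel[OF ys] integrable_cauchy_kernel[OF z] intD
      by simp
    also have "norm \<dots> \<le> norm (y - z) * (2 / \<delta> ^ 3)"
    proof (rule norm_integral_le_on_support)
      fix x :: real assume x: "x \<in> {-2..2}"
      define p q where "p = y - complex_of_real x" and "q = z - complex_of_real x"
      have pq: "p \<noteq> 0" "q \<noteq> 0" "p - q = y - z" using slit_neq[OF ys x] slit_neq[OF z x] by (auto simp: p_def q_def)
      have "(1 / p - 1 / q) / (p - q) - (- 1 / q ^ 2) = (p - q) / (p * q ^ 2)" if "p \<noteq> q"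
      proof -
        have "1 / p - 1 / q = - (p - q) / (p * q)" using pq(1,2) by (simp add: field_simps)
        then have "(1 / p - 1 / q) / (p - q) = - 1 / (p * q)"
          using that pq(1,2) by (simp add: divide_simps)
        moreover have "- 1 / (p * q) - (- 1 / q ^ 2) = (p - q) / (p * q ^ 2)"
          using pq(1,2) by (simp add: field_simps power2_eq_square)
        ultimately show ?thesis by simp
      qed
      moreover have "p \<noteq> q" using y(1) pq(3) by auto
      ultimately have "(1 / p - 1 / q) / (y - z) - (- 1 / q ^ 2) = (y - z) / (p * q ^ 2)"
        using pq(3) by simp
      then have "norm ((1 / p - 1 / q) / (y - z) - (- 1 / q ^ 2)) = norm (y - z) / (norm p * norm q ^ 2)"
        by (simp add: norm_divide norm_mult norm_power)
      also have "\<dots> \<le> norm (y - z) / (\<delta> / 2 * \<delta> ^ 2)"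
        using dy[OF x] d(1) d(2)[OF x] unfolding p_def[symmetric] q_def[symmetric]
        by (intro divide_left_mono mult_mono power_mono mult_pos_pos) auto
      also have "\<dots> = norm (y - z) * (2 / \<delta> ^ 3)" by (simp add: power3_eq_cube power2_eq_square)
      finally show "norm ((1 / (y - complex_of_real x) - 1 / (z - complex_of_real x)) / (y - z) - (- 1 / (z - complex_of_real x) ^ 2))
          \<le> norm (y - z) * (2 / \<delta> ^ 3)" by (simp only: p_def q_def)
    qed simp
    finally show ?thesis .
  qed
  show "((\<lambda>y. (G y - G z) / (y - z)) \<longlongrightarrow> ?D) (at z)"
  proof (rule Lim_null[THEN iffD2], rule Lim_null_comparison)
    show "eventually (\<lambda>y. norm ((G y - G z) / (y - z) - ?D) \<le> norm (y - z) * (2 / \<delta> ^ 3)) (at z)"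
      unfolding eventually_at using bound d(1) by (intro exI[of _ "\<delta> / 2"]) auto
    have "((\<lambda>y. norm (y - z) * (2 / \<delta> ^ 3)) \<longlongrightarrow> norm (z - z) * (2 / \<delta> ^ 3)) (at z)"
      by (intro tendsto_intros)
    then show "((\<lambda>y. norm (y - z) * (2 / \<delta> ^ 3)) \<longlongrightarrow> 0) (at z)" by simp
  qed
qed

lemma holomorphic_G: "G holomorphic_on - slit"
  using cauchy_transform_has_field_derivative closed_slit
  by (auto simp: holomorphic_on_open open_Compl)

lemma cauchy_transform_cnj: "G (cnj z) = cnj (G z)"
proof -
  have "G (cnj z) = (LINT x|\<mu>. cnj (1 / (z - complex_of_real x)))"
    by (simp add: cauchy_transform_def)
  then show ?thesis by (simp only: Bochner_Integration.integral_cnj cauchy_transform_def)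
qed

text \<open>The kernel has imaginary part - Im z / |z - x|^2. The explicit bound |z - x| <= |z| + 2
  keeps the inequality strict after integration.\<close>

lemma Im_cauchy_transform:
  assumes z: "Im z \<noteq> 0"
  shows "Im (G z) * Im z < 0"
proof -
  have zs: "z \<notin> slit" using z by auto
  have int: "integrable \<mu> (\<lambda>x. Im (1 / (z - complex_of_real x)))"
    by (rule integrable_Im[OF integrable_cauchy_kernel[OF zs]])
  have "(Im z) ^ 2 / (norm z + 2) ^ 2 \<le> (LINT x|\<mu>. - Im z * Im (1 / (z - complex_of_real x)))"
  proof (rule integral_ge_on_support)
    show "integrable \<mu> (\<lambda>x. - Im z * Im (1 / (z - complex_of_real x)))"
      using int by simp
    fix x :: real assume x: "x \<in> {-2..2}"
    have "norm (z - complex_of_real x) \<le> norm z + 2"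
      using norm_triangle_ineq4[of z "complex_of_real x"] x by auto
    then have "(Im z) ^ 2 / (norm z + 2) ^ 2 \<le> (Im z) ^ 2 / norm (z - complex_of_real x) ^ 2"
      using slit_neq[OF zs x] by (intro divide_left_mono power_mono mult_pos_pos zero_less_power add_nonneg_pos) auto
    also have "\<dots> = - Im z * Im (1 / (z - complex_of_real x))"
      by (simp add: Im_divide' power2_eq_square)
    finally show "(Im z) ^ 2 / (norm z + 2) ^ 2 \<le> - Im z * Im (1 / (z - complex_of_real x))" .
  qed
  also have "\<dots> = - Im z * Im (G z)"
    using integral_Im[OF integrable_cauchy_kernel[OF zs]] by (simp add: cauchy_transform_def)
  finally have "(Im z) ^ 2 / (norm z + 2) ^ 2 \<le> - Im z * Im (G z)" .
  moreover have "0 < (Im z) ^ 2 / (norm z + 2) ^ 2"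
    using z by (intro divide_pos_pos zero_less_power[of "norm z + 2"] add_nonneg_pos) auto
  ultimately show ?thesis by (simp add: mult.commute)
qed

text \<open>1 - x / a lies between 0 and 2. Using a / (a - x) instead of 1 / (a - x) treats both
  rays outside the interval alike.\<close>

lemma ratio_bounds:
  fixes a x :: real
  assumes "2 < \<bar>a\<bar>" "x \<in> {-2..2}"
  shows "1 / 2 \<le> a / (a - x)"
proof -
  have "\<bar>x\<bar> < \<bar>a\<bar>" using assms by auto
  then have "\<bar>x / a\<bar> < 1" by (simp add: divide_simps)
  then have "x / a < 1" "- (x / a) < 1" unfolding abs_less_iff by blast+
  then have "0 < 1 - x / a" "1 - x / a \<le> 2" by linarith+
  then have "1 / 2 \<le> 1 / (1 - x / a)" by (intro divide_left_mono) auto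
  also have "1 / (1 - x / a) = a / (a - x)"
    using assms by (simp add: field_simps)
  finally show ?thesis .
qed

lemma real_notin_slit: "2 < \<bar>a\<bar> \<Longrightarrow> complex_of_real a \<notin> slit"
  by auto

lemma cauchy_transform_real:
  assumes a: "2 < \<bar>a\<bar>"
  shows "\<exists>c>0. of_real a * G (of_real a) = of_real c"
proof -
  have int: "integrable \<mu> (\<lambda>x. 1 / (complex_of_real a - complex_of_real x))"
    by (rule integrable_cauchy_kernel[OF real_notin_slit[OF a]])
  have eq: "complex_of_real a * (1 / (complex_of_real a - complex_of_real x)) = complex_of_real (a / (a - x))" for x
    by simp
  have int': "integrable \<mu> (\<lambda>x. a / (a - x))"
    using integrable_Re[OF integrable_mult_right[OF int, of "of_real a"]] unfolding eq by simp
  have "of_real a * G (of_real a) = (LINT x|\<mu>. complex_of_real (a / (a - x)))"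
    unfolding cauchy_transform_def eq[symmetric]
    by (rule Bochner_Integration.integral_mult_right[symmetric]) (use int in simp)
  also have "\<dots> = of_real (LINT x|\<mu>. a / (a - x))" by (rule integral_complex_of_real)
  finally have "of_real a * G (of_real a) = of_real (LINT x|\<mu>. a / (a - x))" .
  moreover have "1 / 2 \<le> (LINT x|\<mu>. a / (a - x))"
    by (rule integral_ge_on_support[OF int' ratio_bounds[OF a]])
  ultimately show ?thesis by (intro exI[of _ "LINT x|\<mu>. a / (a - x)"]) auto
qed

lemma notin_slit_real:
  assumes "z \<notin> slit" "Im z = 0"
  obtains a where "z = complex_of_real a" "2 < \<bar>a\<bar>"
proof
  show z: "z = complex_of_real (Re z)" using assms by (simp add: complex_eq_iff)
  then have "Re z \<notin> {-2..2}" using assms by (metis imageI)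
  then show "2 < \<bar>Re z\<bar>" by auto
qed

lemma cauchy_transform_nonzero:
  assumes "z \<notin> slit"
  shows "G z \<noteq> 0"
proof (cases "Im z = 0")
  case True
  obtain a where "z = of_real a" "2 < \<bar>a\<bar>" by (rule notin_slit_real[OF assms True])
  then show ?thesis using cauchy_transform_real[of a] by auto
next
  case False
  then show ?thesis using Im_cauchy_transform[of z] by auto
qed

text \<open>For distinct a and b, a b / (b - a) times G a - G b is the integral of a b / ((a - x) (b
  - x)), which is at least 1 / 4 even if a and b lie on different rays.\<close>

lemma cauchy_transform_inj_real:
  assumes a: "2 < \<bar>a\<bar>" and b: "2 < \<bar>b\<bar>" and eq: "G (of_real a) = G (of_real b)"
  shows "a = b"
proof (rule ccontr)
  assume ab: "a \<noteq> b"
  let ?f = "\<lambda>x. a / (a - x) * (b / (b - x))"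
  have f: "1 / 2 * (1 / 2) \<le> ?f x" if "x \<in> {-2..2}" for x
    using ratio_bounds[OF a that] ratio_bounds[OF b that] by (intro mult_mono) linarith+
  have cf: "complex_of_real (?f x) = of_real (a * b / (b - a)) *
      (1 / (complex_of_real a - complex_of_real x) - 1 / (complex_of_real b - complex_of_real x))"
    if "x \<in> {-2..2}" for x
  proof -
    have ne: "a - x \<noteq> 0" "b - x \<noteq> 0" "b - a \<noteq> 0" using that a b ab by auto
    have "?f x = a * b / (b - a) * (1 / (a - x) - 1 / (b - x))"
    proof -
      have "1 / (a - x) - 1 / (b - x) = (b - a) / ((a - x) * (b - x))"
        using ne by (simp add: diff_frac_eq)
      then show ?thesis using ne by simp
    qed
    then show ?thesis by simp
  qed
  define h where "h x = of_real (a * b / (b - a)) *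
      (1 / (complex_of_real a - complex_of_real x) - 1 / (complex_of_real b - complex_of_real x))" for x
  have int: "integrable \<mu> h"
    unfolding h_def[abs_def]
    by (intro integrable_mult_right Bochner_Integration.integrable_diff integrable_cauchy_kernel real_notin_slit a b)
  have "(LINT x|\<mu>. h x) = of_real (a * b / (b - a)) * (G (of_real a) - G (of_real b))"
    using integrable_cauchy_kernel[OF real_notin_slit[OF a]] integrable_cauchy_kernel[OF real_notin_slit[OF b]]
    unfolding cauchy_transform_def h_def by simp
  then have "(LINT x|\<mu>. Re (h x)) = 0"
    unfolding integral_Re[OF int] eq by simp
  moreover have "1 / 2 * (1 / 2) \<le> (LINT x|\<mu>. Re (h x))"
  proof (rule integral_ge_on_support)
    show "integrable \<mu> (\<lambda>x. Re (h x))" by (rule integrable_Re[OF int])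
    show "1 / 2 * (1 / 2) \<le> Re (h x)" if "x \<in> {-2..2}" for x
      using f[OF that] unfolding h_def cf[OF that, symmetric] by simp
  qed
  ultimately show False by linarith
qed

text \<open>Im (z + 1 / z) = Im z (1 - 1 / |z|^2), so a real value forces z to be real; and |a + 1 /
  a| > 2 for real a with |a| > 1.\<close>

lemma joukowski_notin_slit:
  assumes "norm z > 1"
  shows "joukowski z \<notin> slit"
proof
  assume "joukowski z \<in> slit"
  then obtain x where x: "x \<in> {-2..2}" "z + 1 / z = complex_of_real x" by (auto simp: joukowski_def)
  have z0: "z \<noteq> 0" using assms by auto
  have n2: "norm z ^ 2 > 1" using assms by (intro one_less_power) auto
  have "1 / z = cnj z / of_real (norm z ^ 2)"
    using z0 complex_norm_square[of z] by (simp add: field_simps)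
  then have "Im (z + 1 / z) = Im z * (1 - 1 / norm z ^ 2)"
    by (simp add: Im_divide_of_real algebra_simps del: of_real_power)
  moreover have "Im (z + 1 / z) = 0" using x by (simp only: Im_complex_of_real)
  ultimately have "Im z * (1 - 1 / norm z ^ 2) = 0" by simp
  moreover have "1 / norm z ^ 2 < 1" using n2 by (simp add: divide_less_eq)
  then have "1 - 1 / norm z ^ 2 \<noteq> 0" by linarith
  ultimately have "Im z = 0" by (simp only: mult_eq_0_iff simp_thms)
  then obtain a where a: "z = of_real a" by (metis complex_is_Real_iff Reals_cases)
  then have "\<bar>a\<bar> > 1" using assms by simp
  then have "\<bar>a\<bar> - 1 > 0" by simp
  then have "(\<bar>a\<bar> - 1) ^ 2 > 0" by (rule zero_less_power)
  then have "a\<^sup>2 + 1 > 2 * \<bar>a\<bar>" by (simp add: power2_diff)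
  moreover have "complex_of_real (a + 1 / a) = of_real x" using x a by simp
  then have "a + 1 / a = x" by (simp only: of_real_eq_iff)
  then have "a\<^sup>2 + 1 = x * a" using \<open>\<bar>a\<bar> > 1\<close> by (auto simp: field_simps power2_eq_square)
  moreover have "x * a \<le> 2 * \<bar>a\<bar>"
  proof -
    have "x * a \<le> \<bar>x\<bar> * \<bar>a\<bar>" by (metis abs_ge_self abs_mult)
    also have "\<dots> \<le> 2 * \<bar>a\<bar>" using x by (intro mult_right_mono) auto
    finally show ?thesis .
  qed
  ultimately show False by linarith
qed

lemma joukowski_inj: "inj_on joukowski {z. norm z > 1}"
proof (rule inj_onI)
  fix z w assume zw: "z \<in> {z. norm z > 1}" "w \<in> {z. norm z > 1}" "joukowski z = joukowski w"
  then have 0: "z \<noteq> 0" "w \<noteq> 0" by auto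
  have "norm (z * w) > 1 * 1" unfolding norm_mult using zw by (intro mult_strict_mono) auto
  then have "z * w \<noteq> 1" by auto
  have "(z - w) * (z * w - 1) = z * w * (joukowski z - joukowski w)"
    using 0 by (simp add: joukowski_def field_simps)
  then have "(z - w) * (z * w - 1) = 0" using zw by simp
  then show "z = w" using \<open>z * w \<noteq> 1\<close> by simp
qed

text \<open>The two roots of z^2 - w z + 1 have product 1. If neither lies outside the closed unit
  disc, both are on the circle and conjugate, which makes w real.\<close>

lemma joukowski_surj:
  assumes w: "Im w > 0"
  obtains z where "norm z > 1" "joukowski z = w"
proof -
  define z1 z2 where "z1 = (w + csqrt (w ^ 2 - 4)) / 2" and "z2 = (w - csqrt (w ^ 2 - 4)) / 2"
  have prod: "z1 * z2 = 1"
  proof -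
    have "z1 * z2 = (w ^ 2 - csqrt (w ^ 2 - 4) ^ 2) / 4"
      by (simp add: z1_def z2_def power2_eq_square algebra_simps)
    also have "\<dots> = 1" unfolding power2_csqrt by simp
    finally show ?thesis .
  qed
  have sum: "z1 + z2 = w" by (simp add: z1_def z2_def field_simps)
  have nz: "z1 \<noteq> 0" "z2 \<noteq> 0" using prod by auto
  have inv: "z2 = 1 / z1" "z1 = 1 / z2" using prod nz by (auto simp: field_simps)
  have n: "norm z2 = 1 / norm z1" by (subst inv(1)) (simp add: norm_divide)
  have "norm z2 > 1" if "norm z1 < 1" unfolding n using that nz by (simp add: less_divide_eq)
  then consider "norm z1 > 1" | "norm z2 > 1" | "norm z1 = 1" by linarith
  then show ?thesis
  proof cases
    case 1
    then show ?thesis using that[of z1] sum unfolding inv(1) by (simp add: joukowski_def)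
  next
    case 2
    then show ?thesis using that[of z2] sum unfolding joukowski_def inv(2)[symmetric] by (simp add: add.commute)
  next
    case 3
    then have "z1 * cnj z1 = 1" using complex_norm_square[of z1] by simp
    then have "z2 = cnj z1" using prod nz by (metis mult_left_cancel)
    then have "Im w = 0" using sum by auto
    then show ?thesis using w by simp
  qed
qed

lemma recip_analytic: "recip_cauchy_transform \<mu> analytic_on upper_half_plane"
proof -
  have sub: "upper_half_plane \<subseteq> - slit" by (auto simp: upper_half_plane_def)
  have "open upper_half_plane" unfolding upper_half_plane_def by (rule open_halfspace_Im_gt)
  moreover have "(\<lambda>z. 1 / G z) holomorphic_on upper_half_plane"
    using sub cauchy_transform_nonzero
    by (intro holomorphic_intros holomorphic_on_subset[OF holomorphic_G]) auto
  ultimately show ?thesis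
    by (simp add: analytic_on_open recip_cauchy_transform_def[abs_def])
qed

text \<open>G exchanges the half-planes and is real on the real rays, so points with equal values
  lie in the same half-plane or are both real. Conjugation reduces the lower half-plane to the upper
  one, and \<open>cauchy_transform_inj_real\<close> settles the real case.\<close>

lemma cauchy_transform_inj_iff:
  "inj_on G upper_half_plane \<longleftrightarrow> inj_on (G \<circ> joukowski) {z. norm z > 1}"
proof
  assume inj: "inj_on G upper_half_plane"
  have main: "z = w" if zw: "z \<notin> slit" "w \<notin> slit" "G z = G w" for z w
  proof (cases "Im z = 0")
    case True
    have "Im w = 0"
    proof (rule ccontr)
      assume "Im w \<noteq> 0"
      from Im_cauchy_transform[OF this] have "Im (G w) \<noteq> 0" by auto
      moreover have "cnj z = z" using True by (simp add: complex_eq_iff)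
      then have "cnj (G z) = G z" using cauchy_transform_cnj[of z] by metis
      then have "Im (G z) = 0" by (simp add: complex_eq_iff)
      ultimately show False using zw(3) by simp
    qed
    obtain a where a: "z = of_real a" "2 < \<bar>a\<bar>" by (rule notin_slit_real[OF zw(1) True])
    obtain b where b: "w = of_real b" "2 < \<bar>b\<bar>" by (rule notin_slit_real[OF zw(2) \<open>Im w = 0\<close>])
    have "a = b" by (rule cauchy_transform_inj_real[OF a(2) b(2)]) (use zw(3) a(1) b(1) in simp)
    then show ?thesis using a(1) b(1) by simp
  next
    case False
    have wz: "Im w \<noteq> 0"
    proof
      assume 0: "Im w = 0"
      then have "cnj w = w" by (simp add: complex_eq_iff)
      then have "cnj (G w) = G w" using cauchy_transform_cnj[of w] by metis
      then have "Im (G w) = 0" by (simp add: complex_eq_iff)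
      then show False using Im_cauchy_transform[OF False] zw(3) by simp
    qed
    have s: "Im (G z) * Im z < 0" "Im (G z) * Im w < 0"
      using Im_cauchy_transform[OF False] Im_cauchy_transform[OF wz] zw(3) by auto
    show ?thesis
    proof (cases "Im z > 0")
      case True
      then have "Im w > 0" using s wz by (auto simp: mult_less_0_iff)
      with True show ?thesis
        by (intro inj_onD[OF inj zw(3)]) (simp_all add: upper_half_plane_def)
    next
      case f: False
      then have "Im z < 0" "Im w < 0" using False s wz by (auto simp: mult_less_0_iff)
      moreover have eq: "G (cnj z) = G (cnj w)" using zw(3) by (simp add: cauchy_transform_cnj)
      ultimately have "cnj z = cnj w"
        by (intro inj_onD[OF inj eq]) (simp_all add: upper_half_plane_def)
      then show ?thesis by simp
    qed
  qed
  show "inj_on (G \<circ> joukowski) {z. norm z > 1}"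
  proof (rule inj_onI)
    fix z w assume zw: "z \<in> {z. norm z > 1}" "w \<in> {z. norm z > 1}" "(G \<circ> joukowski) z = (G \<circ> joukowski) w"
    have "joukowski z = joukowski w"
      by (rule main[OF joukowski_notin_slit joukowski_notin_slit]) (use zw in simp_all)
    then show "z = w" by (rule inj_onD[OF joukowski_inj _ zw(1,2)])
  qed
next
  assume inj: "inj_on (G \<circ> joukowski) {z. norm z > 1}"
  show "inj_on G upper_half_plane"
  proof (rule inj_onI)
    fix z w assume zw: "z \<in> upper_half_plane" "w \<in> upper_half_plane" "G z = G w"
    have "Im z > 0" using zw by (simp add: upper_half_plane_def)
    then obtain a where a: "norm a > 1" "joukowski a = z" by (rule joukowski_surj)
    have "Im w > 0" using zw by (simp add: upper_half_plane_def)
    then obtain b where b: "norm b > 1" "joukowski b = w" by (rule joukowski_surj)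
    have "a = b" by (rule inj_onD[OF inj]) (use a b zw in auto)
    then show "z = w" using a b by simp
  qed
qed

lemma univalent_recip_iff:
  "univalent_on (recip_cauchy_transform \<mu>) upper_half_plane \<longleftrightarrow>
    inj_on (recip_cauchy_transform \<mu> \<circ> joukowski) {z. norm z > 1}"
proof -
  have "inj_on (recip_cauchy_transform \<mu>) upper_half_plane \<longleftrightarrow> inj_on G upper_half_plane"
    by (simp add: inj_on_def recip_cauchy_transform_def)
  moreover have "inj_on (recip_cauchy_transform \<mu> \<circ> joukowski) {z. norm z > 1} \<longleftrightarrow>
      inj_on (G \<circ> joukowski) {z. norm z > 1}"
    by (simp add: inj_on_def recip_cauchy_transform_def)
  ultimately show ?thesis
    by (simp add: univalent_on_def recip_analytic cauchy_transform_inj_iff)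
qed

section \<open>The expansion of g at infinity\<close>

lemma cauchy_transform_at_infinity: "((\<lambda>z. z * G z) \<longlongrightarrow> 1) at_infinity"
proof (rule Lim_null[THEN iffD2], rule Lim_null_comparison)
  have "eventually (\<lambda>z :: complex. norm z \<ge> 3) at_infinity"
    by (auto simp: eventually_at_infinity)
  then show "eventually (\<lambda>z. norm (z * G z - 1) \<le> 2 / (norm z - 2)) at_infinity"
  proof eventually_elim
    case (elim z)
    then have zs: "z \<notin> slit" by auto
    have "z * G z - 1 = (LINT x|\<mu>. z * (1 / (z - complex_of_real x)) - 1)"
    proof -
      have i: "integrable \<mu> (\<lambda>x. z * (1 / (z - complex_of_real x)))"
        by (intro integrable_mult_right integrable_cauchy_kernel zs)
      show ?thesis
        unfolding cauchy_transform_def Bochner_Integration.integral_diff[OF i integrable_const]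
        using prob_space integrable_cauchy_kernel[OF zs]
        by (subst Bochner_Integration.integral_mult_right) simp_all
    qed
    also have "norm \<dots> \<le> 2 / (norm z - 2)"
    proof (rule norm_integral_le_on_support)
      fix x :: real assume x: "x \<in> {-2..2}"
      have "z * (1 / (z - complex_of_real x)) - 1 = of_real x / (z - complex_of_real x)"
        using slit_neq[OF zs x] by (simp add: field_simps)
      also have "norm \<dots> = \<bar>x\<bar> / norm (z - complex_of_real x)" by (simp add: norm_divide)
      also have "\<dots> \<le> 2 / (norm z - 2)"
        using x elim norm_triangle_ineq2[of z "complex_of_real x"] by (intro frac_le) auto
      finally show "norm (z * (1 / (z - complex_of_real x)) - 1) \<le> 2 / (norm z - 2)" .
    qed simp
    finally show ?case .
  qed
  have "filterlim (\<lambda>z :: complex. norm z - 2) at_top at_infinity"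
    using filterlim_tendsto_add_at_top[OF tendsto_const[of "-2"] filterlim_norm_at_top]
    by simp
  then show "((\<lambda>z :: complex. 2 / (norm z - 2)) \<longlongrightarrow> 0) at_infinity"
    by (intro tendsto_divide_0[OF tendsto_const] filterlim_at_top_imp_at_infinity)
qed

text \<open>This is t g (1 / t), with the value 1 at t = 0 that removes the singularity.\<close>

definition k_fun :: "complex \<Rightarrow> complex" where
  "k_fun t = (if t = 0 then 1 else t / G (t + 1 / t))"

lemma punctured_ball_notin_slit:
  assumes "t \<in> ball 0 1 - {0}"
  shows "t + 1 / t \<notin> slit"
proof -
  have "norm (1 / t) > 1" using assms by (simp add: norm_divide divide_simps)
  from joukowski_notin_slit[OF this] show ?thesis by (simp add: joukowski_def add.commute)
qed

lemma k_fun_holomorphic: "k_fun holomorphic_on ball 0 1"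
proof (rule no_isolated_singularity')
  show "k_fun holomorphic_on ball 0 1 - {0}"
  proof (rule holomorphic_transform)
    have "(\<lambda>t. G (t + 1 / t)) holomorphic_on ball 0 1 - {0}"
    proof (rule holomorphic_on_compose_gen[OF _ holomorphic_G, unfolded o_def])
      show "(\<lambda>t :: complex. t + 1 / t) holomorphic_on ball 0 1 - {0}"
        by (intro holomorphic_intros) auto
      show "(\<lambda>t. t + 1 / t) ` (ball 0 1 - {0}) \<subseteq> - slit"
      proof (rule image_subsetI)
        fix t :: complex assume "t \<in> ball 0 1 - {0}"
        then show "t + 1 / t \<in> - slit" unfolding Compl_iff by (rule punctured_ball_notin_slit)
      qed
    qed
    then show "(\<lambda>t. t / G (t + 1 / t)) holomorphic_on ball 0 1 - {0}"
      using punctured_ball_notin_slit cauchy_transform_nonzero by (intro holomorphic_intros) auto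
  qed (auto simp: k_fun_def)
  fix z :: complex assume "z \<in> {0}"
  have "filterlim (\<lambda>t :: complex. t + inverse t) at_infinity (at 0)"
    by (rule tendsto_add_filterlim_at_infinity[OF tendsto_ident_at filterlim_inverse_at_infinity])
  then have "((\<lambda>t. (t + inverse t) * G (t + inverse t)) \<longlongrightarrow> 1) (at 0)"
    by (rule filterlim_compose[OF cauchy_transform_at_infinity])
  \<comment> \<open>For w = t + 1 / t one has t w = 1 + t^2, so t / G w = (1 + t^2) / (w G w), and w
    G w tends to 1.\<close>
  then have "((\<lambda>t :: complex. (1 + t * t) / ((t + inverse t) * G (t + inverse t))) \<longlongrightarrow> (1 + 0 * 0) / 1) (at 0)"
    by (intro tendsto_intros) auto
  moreover have "eventually (\<lambda>t. (1 + t * t) / ((t + inverse t) * G (t + inverse t)) = k_fun t) (at 0)"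
    unfolding eventually_at
  proof (intro exI[of _ 1] conjI ballI impI)
    fix t :: complex assume t: "t \<noteq> 0 \<and> dist t 0 < 1"
    then have ts: "t + 1 / t \<notin> slit" by (intro punctured_ball_notin_slit) auto
    have "t + 1 / t \<noteq> 0" using slit_neq[OF ts, of 0] by simp
    moreover have "1 + t * t = t * (t + 1 / t)" using t by (simp add: field_simps)
    ultimately show "(1 + t * t) / ((t + inverse t) * G (t + inverse t)) = k_fun t"
      using t by (simp add: k_fun_def inverse_eq_divide)
  qed simp
  ultimately have "(k_fun \<longlongrightarrow> 1) (at 0)" by (simp add: tendsto_cong)
  then show "(k_fun \<longlongrightarrow> k_fun z) (at z within ball 0 1)"
    using \<open>z \<in> {0}\<close> by (auto simp: k_fun_def intro: tendsto_within_subset)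
qed auto

definition K :: "complex fps" where
  "K = fps_expansion k_fun 0"

lemma eball_1 [simp]: "eball (0 :: complex) 1 = ball 0 1"
  using eball_ereal[of "0 :: complex" 1] by (simp add: one_ereal_def)

lemma K_radius: "1 \<le> fps_conv_radius K"
  unfolding K_def by (rule conv_radius_fps_expansion) (simp add: k_fun_holomorphic)

lemma eval_K: "norm t < 1 \<Longrightarrow> eval_fps K t = k_fun t"
  unfolding K_def using eval_fps_expansion'[of k_fun 0 1 t] k_fun_holomorphic by simp

sublocale laurent_at_infinity K "recip_cauchy_transform \<mu> \<circ> joukowski"
proof
  show "K $ 0 = 1" using eval_K[of 0] by (simp add: eval_fps_at_0 k_fun_def)
  show "1 \<le> fps_conv_radius K" by (rule K_radius)
  fix z :: complex assume z: "norm z > 1"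
  then have "norm (1 / z) < 1" "z \<noteq> 0" by (auto simp: norm_divide divide_simps)
  then show "(recip_cauchy_transform \<mu> \<circ> joukowski) z = z * eval_fps K (1 / z)"
    by (simp add: eval_K k_fun_def recip_cauchy_transform_def joukowski_def add.commute)
qed

text \<open>\<open>k_fun\<close> commutes with conjugation, so K and its conjugate are both
  expansions of the same function and coincide.\<close>

lemma K_real: "K $ n \<in> \<real>"
proof -
  have kc: "k_fun (cnj t) = cnj (k_fun t)" for t
    using cauchy_transform_cnj[of "t + 1 / t"] by (simp add: k_fun_def)
  have sums: "(\<lambda>n. K $ n / z ^ n) sums k_fun (1 / z)" if "norm z > 1" for z
  proof -
    have n: "norm (1 / z) < 1" using that by (auto simp: norm_divide divide_simps)
    show ?thesis
      using sums_eval_fps[OF radiusI[OF n K_radius]] n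
      by (simp add: eval_K power_one_over divide_inverse power_inverse)
  qed
  have sums': "(\<lambda>n. cnj (K $ n) / z ^ n) sums k_fun (1 / z)" if "norm z > 1" for z
  proof -
    have "(\<lambda>n. cnj (K $ n / cnj z ^ n)) sums cnj (k_fun (1 / cnj z))"
      using sums[of "cnj z"] that by (subst sums_cnj) simp
    then show ?thesis using kc[of "1 / cnj z"] by simp
  qed
  have "eventually (\<lambda>z :: complex. norm z \<ge> 2) at_infinity"
    by (auto simp: eventually_at_infinity)
  then have ev: "eventually (\<lambda>z :: complex. norm z > 1) at_infinity"
    by eventually_elim simp
  have "(\<lambda>n. K $ n) = (\<lambda>n. cnj (K $ n))"
    by (rule sums_at_infinity_unique; rule eventually_mono[OF ev]) (use sums sums' in auto)
  then have "K $ n = cnj (K $ n)" by metis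
  then show ?thesis by (simp add: Reals_cnj_iff)
qed

end

theorem theorem3p4:
  fixes \<mu> :: "real measure" and F g :: "complex \<Rightarrow> complex"
  assumes "real_distribution \<mu>"
    and "measure_support \<mu> \<subseteq> {-2..2}"
    and "F = recip_cauchy_transform \<mu>"
    and "g = F \<circ> joukowski"
  shows "(\<forall>n\<ge>1. \<forall>k\<ge>1. scaled_grunsky_coeff g n k \<in> \<real> \<and>
            scaled_grunsky_coeff g n k = scaled_grunsky_coeff g k n) \<and>
         (univalent_on F upper_half_plane \<longleftrightarrow>
           (\<forall>N\<ge>1. \<forall>e. eigenvalue (grunsky_mat g N) e \<longrightarrow> e \<in> complex_of_real ` {-1..1}))"
proof -
  interpret interval_distribution \<mu>
    using assms(1,2) by (simp add: interval_distribution_def interval_distribution_axioms_def)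
  have g: "g = recip_cauchy_transform \<mu> \<circ> joukowski" using assms(3,4) by simp
  show ?thesis
    unfolding g assms(3) univalent_recip_iff inj_iff_grunsky_eigenvalues[OF K_real]
    using scaled_grunsky_coeff_real[OF K_real] scaled_grunsky_coeff_sym by blast
qed

end
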